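(* Let $\mathcal V$ and $\mathcal K$ be separable Hilbert spaces, $G$ a unimodular locally compact second countable Hausdorff group of type I, $H\le G$ a compact subgroup, $\Omega=G/H$, $\overline g=gH$, and let $\nu_G,\nu_H,\nu_\Omega$ be as in the context. Let $W:G\to\mathcal U(\mathcal V)$ be a strongly continuous square-integrable unitary representation, i.e. there is a constant $d>0$ such that $$\int_G|\langle\varphi|W(g)\psi\rangle|^2\,d\nu_G(g)=d$$ for all unit vectors $\varphi,\psi\in\mathcal V$, and let $g\mapsto u_g\in\mathcal U(\mathcal K)$ be a strongly continuous (projective) unitary representation of $G$. Then for any $\Gamma\in\mathcal I_u^W(\Omega)$ there are $r\in\mathbb N\cup\{\infty\}$ and Hilbert–Schmidt operators $\mathsf B_j:\mathcal V\to\mathcal K$, $j<r+1$, satisfying $$\sum_{j=1}^r\langle\mathsf B_j\varphi|u_h^*bu_h\mathsf B_j\varphi\rangle=\sum_{j=1}^r\langle\mathsf B_jW(h)\varphi|b\,\mathsf B_jW(h)\varphi\rangle$$ for all $\varphi\in\mathcal V$, $b\in\mathcal L(\mathcal K)$, $h\in H$, such that $$\sum_{j=1}^r\mathrm{tr}[\mathsf B_j^*\mathsf B_j]=1/d$$ and $$\langle\varphi|\Gamma(b,X)\varphi\rangle=\int_X\sum_{j=1}^r\langle u_g\mathsf B_jW(g)^*\varphi|b\,u_g\mathsf B_jW(g)^*\varphi\rangle\,d\nu_\Omega(\overline g)$$ for all $\varphi\in\mathcal V$, $b\in\mathcal L(\mathcal K)$ and $X\in\mathcal B(\Omega)$.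
   Context: $\nu_G$ is a fixed Haar measure of $G$, $\nu_H$ the Haar measure of $H$ with $\nu_H(H)=1$, and $\nu_\Omega$ the $G$-invariant Borel measure on $\Omega$ with $\int_Gf\,d\nu_G=\int_\Omega\int_Hf(gh)\,d\nu_H(h)\,d\nu_\Omega(\overline g)$ for $f\in L^1(\nu_G)$. $\mathcal B(\Omega)$ is the Borel $\sigma$-algebra. A projective unitary representation satisfies $u_{gh}=m(g,h)u_gu_h$ with a $\mathbb T$-valued 2-cocycle $m$. $\mathcal I_u^W(\Omega)$ is the convex set of covariant instruments, i.e. maps $\Gamma:\mathcal L(\mathcal K)\times\mathcal B(\Omega)\to\mathcal L(\mathcal V)$ such that (a) for each $X$, $b\mapsto\Gamma(b,X)$ is a completely positive normal linear map; (b) $\Gamma(I_{\mathcal K},\Omega)=I_{\mathcal V}$; (c) $\mathrm{tr}[T\Gamma(b,\cup_jX_j)]=\sum_j\mathrm{tr}[T\Gamma(b,X_j)]$ for all trace-class $T$ on $\mathcal V$, $b\in\mathcal L(\mathcal K)$ and disjoint sequences $(X_j)$ in $\mathcal B(\Omega)$; (d) $\Gamma(u_gbu_g^*,gX)=W(g)\Gamma(b,X)W(g)^*$ for all $g\in G$, $b\in\mathcal L(\mathcal K)$, $X\in\mathcal B(\Omega)$. *)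

theory Defs
  imports "HOL-Analysis.Analysis" "HOL-Library.Extended_Nat"
begin

section \<open>Complex Hilbert spaces\<close>

text \<open>The scalar product is linear in its second argument. Positivity and definiteness follow from
  \<open>cinner_eq_norm\<close>, completeness and the norm topology from the class \<^class>\<open>banach\<close>.\<close>

class chilbert_space = banach +
  fixes scaleC :: "complex \<Rightarrow> 'a \<Rightarrow> 'a"  (infixr \<open>*\<^sub>C\<close> 75)
    and cinner :: "'a \<Rightarrow> 'a \<Rightarrow> complex"
  assumes scaleC_add_right: "c *\<^sub>C (x + y) = c *\<^sub>C x + c *\<^sub>C y"
    and scaleC_add_left: "(c + c') *\<^sub>C x = c *\<^sub>C x + c' *\<^sub>C x"
    and scaleC_scaleC: "c *\<^sub>C c' *\<^sub>C x = (c * c') *\<^sub>C x"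
    and scaleR_scaleC: "a *\<^sub>R x = complex_of_real a *\<^sub>C x"
    and cinner_commute: "cinner x y = cnj (cinner y x)"
    and cinner_add_right: "cinner x (y + z) = cinner x y + cinner x z"
    and cinner_scaleC_right: "cinner x (c *\<^sub>C y) = c * cinner x y"
    and cinner_eq_norm: "cinner x x = complex_of_real ((norm x)\<^sup>2)"

definition bounded_clinear :: "('a::chilbert_space \<Rightarrow> 'b::chilbert_space) \<Rightarrow> bool" where
  "bounded_clinear A \<longleftrightarrow> bounded_linear A \<and> (\<forall>c x. A (c *\<^sub>C x) = c *\<^sub>C A x)"

text \<open>Meaningful (that is, unique and existing) for bounded operators.\<close>

definition cadjoint :: "('a::chilbert_space \<Rightarrow> 'b::chilbert_space) \<Rightarrow> 'b \<Rightarrow> 'a" where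
  "cadjoint A = (THE B. \<forall>x y. cinner (B x) y = cinner x (A y))"

definition unitary_op :: "('a::chilbert_space \<Rightarrow> 'a) \<Rightarrow> bool" where
  "unitary_op U \<longleftrightarrow> bounded_clinear U \<and> cadjoint U \<circ> U = id \<and> U \<circ> cadjoint U = id"

definition positive_op :: "('a::chilbert_space \<Rightarrow> 'a) \<Rightarrow> bool" where
  "positive_op A \<longleftrightarrow> bounded_clinear A \<and> (\<forall>x. cinner x (A x) \<in> \<real>\<^sub>\<ge>\<^sub>0)"

definition is_onb :: "'a::chilbert_space set \<Rightarrow> bool" where
  "is_onb E \<longleftrightarrow> (\<forall>e\<in>E. norm e = 1) \<and> (\<forall>e\<in>E. \<forall>f\<in>E. e \<noteq> f \<longrightarrow> cinner e f = 0)
     \<and> (\<forall>x. (\<forall>e\<in>E. cinner e x = 0) \<longrightarrow> x = 0)"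

definition abs_op :: "('a::chilbert_space \<Rightarrow> 'a) \<Rightarrow> 'a \<Rightarrow> 'a" where
  "abs_op T = (THE P. positive_op P \<and> P \<circ> P = cadjoint T \<circ> T)"

definition trace_class :: "('a::chilbert_space \<Rightarrow> 'a) \<Rightarrow> bool" where
  "trace_class T \<longleftrightarrow> bounded_clinear T \<and>
     (\<exists>E. is_onb E \<and> (\<lambda>e. cinner e (abs_op T e)) summable_on E)"

text \<open>For trace-class \<open>T\<close> the value does not depend on the basis.\<close>

definition tr :: "('a::chilbert_space \<Rightarrow> 'a) \<Rightarrow> complex" where
  "tr T = (\<Sum>\<^sub>\<infinity>e\<in>(SOME E. is_onb E). cinner e (T e))"

definition hilbert_schmidt :: "('a::chilbert_space \<Rightarrow> 'b::chilbert_space) \<Rightarrow> bool" where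
  "hilbert_schmidt B \<longleftrightarrow> bounded_clinear B \<and>
     (\<exists>E. is_onb E \<and> (\<lambda>e. (norm (B e))\<^sup>2) summable_on E)"

section \<open>Normal completely positive maps\<close>

text \<open>The topology on the bounded operators generated by the functionals \<open>b \<mapsto> tr (S b)\<close> with
  \<open>S\<close> trace-class.\<close>

definition ultraweak_topology :: "('a::chilbert_space \<Rightarrow> 'a) topology" where
  "ultraweak_topology = topology_generated_by
     {{b. bounded_clinear b \<and> tr (S \<circ> b) \<in> U} | S U. trace_class S \<and> open U}"

definition operator_map_linear ::
  "(('k::chilbert_space \<Rightarrow> 'k) \<Rightarrow> 'v::chilbert_space \<Rightarrow> 'v) \<Rightarrow> bool" where
  "operator_map_linear \<Phi> \<longleftrightarrow>
     (\<forall>a b \<alpha> \<beta>. bounded_clinear a \<longrightarrow> bounded_clinear b \<longrightarrow>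
        \<Phi> (\<lambda>x. \<alpha> *\<^sub>C a x + \<beta> *\<^sub>C b x) = (\<lambda>\<phi>. \<alpha> *\<^sub>C \<Phi> a \<phi> + \<beta> *\<^sub>C \<Phi> b \<phi>))"

text \<open>An \<open>n \<times> n\<close> matrix of operators is positive if its form on \<open>n\<close>-tuples of vectors is;
  complete positivity says that applying \<open>\<Phi>\<close> entrywise preserves positivity for every \<open>n\<close>.\<close>

definition positive_matrix :: "nat \<Rightarrow> (nat \<Rightarrow> nat \<Rightarrow> 'a::chilbert_space \<Rightarrow> 'a) \<Rightarrow> bool" where
  "positive_matrix n A \<longleftrightarrow>
     (\<forall>x :: nat \<Rightarrow> 'a. (\<Sum>i<n. \<Sum>j<n. cinner (x i) (A i j (x j))) \<in> \<real>\<^sub>\<ge>\<^sub>0)"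

definition normal_cp_map ::
  "(('k::chilbert_space \<Rightarrow> 'k) \<Rightarrow> 'v::chilbert_space \<Rightarrow> 'v) \<Rightarrow> bool" where
  "normal_cp_map \<Phi> \<longleftrightarrow>
     (\<forall>b. bounded_clinear b \<longrightarrow> bounded_clinear (\<Phi> b)) \<and>
     operator_map_linear \<Phi> \<and>
     (\<forall>n A. (\<forall>i<n. \<forall>j<n. bounded_clinear (A i j)) \<longrightarrow> positive_matrix n A \<longrightarrow>
        positive_matrix n (\<lambda>i j. \<Phi> (A i j))) \<and>
     continuous_map ultraweak_topology ultraweak_topology \<Phi>"

section \<open>Representations\<close>

text \<open>Groups are instances of \<^class>\<open>topological_group_add\<close>, so the group law, which need not be
  commutative, is written \<open>+\<close>, the neutral element \<open>0\<close>, and the coset \<open>gH\<close> is \<open>g +o H\<close>.\<close>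

definition strongly_continuous ::
  "('g::topological_space \<Rightarrow> 'a::chilbert_space \<Rightarrow> 'a) \<Rightarrow> bool" where
  "strongly_continuous W \<longleftrightarrow> (\<forall>x. continuous_on UNIV (\<lambda>g. W g x))"

definition unitary_rep ::
  "('g::topological_group_add \<Rightarrow> 'a::chilbert_space \<Rightarrow> 'a) \<Rightarrow> bool" where
  "unitary_rep W \<longleftrightarrow> (\<forall>g. unitary_op (W g)) \<and> (\<forall>g h. W (g + h) = W g \<circ> W h) \<and> strongly_continuous W"

definition projective_unitary_rep ::
  "('g::topological_group_add \<Rightarrow> 'a::chilbert_space \<Rightarrow> 'a) \<Rightarrow> bool" where
  "projective_unitary_rep u \<longleftrightarrow> (\<forall>g. unitary_op (u g)) \<and> strongly_continuous u \<and>
     (\<exists>m :: 'g \<Rightarrow> 'g \<Rightarrow> complex.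
        (\<forall>g h. cmod (m g h) = 1) \<and>
        (\<forall>g h k. m g h * m (g + h) k = m g (h + k) * m h k) \<and>
        (\<forall>g h x. u (g + h) x = m g h *\<^sub>C u g (u h x)))"

section \<open>Groups of type I\<close>

definition commutant :: "('a::chilbert_space \<Rightarrow> 'a) set \<Rightarrow> ('a \<Rightarrow> 'a) set" where
  "commutant S = {A. bounded_clinear A \<and> (\<forall>B\<in>S. A \<circ> B = B \<circ> A)}"

definition is_projection :: "('a::chilbert_space \<Rightarrow> 'a) \<Rightarrow> bool" where
  "is_projection P \<longleftrightarrow> bounded_clinear P \<and> P \<circ> P = P \<and> cadjoint P = P"

text \<open>A von Neumann algebra is of type I if every nonzero central projection majorizes a nonzero
  abelian projection.\<close>

definition abelian_projection_in ::
  "('a::chilbert_space \<Rightarrow> 'a) set \<Rightarrow> ('a \<Rightarrow> 'a) \<Rightarrow> bool" where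
  "abelian_projection_in M P \<longleftrightarrow> P \<in> M \<and> is_projection P \<and>
     (\<forall>A\<in>M. \<forall>B\<in>M. (P \<circ> A \<circ> P) \<circ> (P \<circ> B \<circ> P) = (P \<circ> B \<circ> P) \<circ> (P \<circ> A \<circ> P))"

definition type_I_algebra :: "('a::chilbert_space \<Rightarrow> 'a) set \<Rightarrow> bool" where
  "type_I_algebra M \<longleftrightarrow>
     (\<forall>Z \<in> M \<inter> commutant M. is_projection Z \<longrightarrow> Z \<noteq> (\<lambda>_. 0) \<longrightarrow>
        (\<exists>P. abelian_projection_in M P \<and> P \<noteq> (\<lambda>_. 0) \<and> Z \<circ> P = P))"

text \<open>The space of square-summable sequences, needed as a concrete infinite-dimensional separable
  Hilbert space.\<close>

typedef ell2 = "{f :: nat \<Rightarrow> complex. summable (\<lambda>n. (cmod (f n))\<^sup>2)}"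
  by (rule exI[of _ "\<lambda>_. 0"]) simp

setup_lifting type_definition_ell2

lemma ell2_summable_add:
  fixes f g :: "nat \<Rightarrow> complex"
  assumes "summable (\<lambda>n. (cmod (f n))\<^sup>2)" "summable (\<lambda>n. (cmod (g n))\<^sup>2)"
  shows "summable (\<lambda>n. (cmod (f n + g n))\<^sup>2)"
proof (rule summable_comparison_test')
  show "summable (\<lambda>n. 2 * (cmod (f n))\<^sup>2 + 2 * (cmod (g n))\<^sup>2)"
    using assms by (intro summable_add summable_mult)
  fix n :: nat
  have "(cmod (f n + g n))\<^sup>2 \<le> (cmod (f n) + cmod (g n))\<^sup>2"
    by (simp add: norm_triangle_ineq power_mono)
  also have "\<dots> \<le> 2 * (cmod (f n))\<^sup>2 + 2 * (cmod (g n))\<^sup>2"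
    using zero_le_power2[of "cmod (f n) - cmod (g n)"] by (simp add: power2_eq_square algebra_simps)
  finally show "norm ((cmod (f n + g n))\<^sup>2) \<le> 2 * (cmod (f n))\<^sup>2 + 2 * (cmod (g n))\<^sup>2"
    by simp
qed

lemma ell2_summable_scale:
  fixes f :: "nat \<Rightarrow> complex"
  assumes "summable (\<lambda>n. (cmod (f n))\<^sup>2)"
  shows "summable (\<lambda>n. (cmod (c * f n))\<^sup>2)"
  using summable_mult[OF assms, of "(cmod c)\<^sup>2"] by (simp add: norm_mult power_mult_distrib)

lemma ell2_summable_prod:
  fixes f g :: "nat \<Rightarrow> complex"
  assumes "summable (\<lambda>n. (cmod (f n))\<^sup>2)" "summable (\<lambda>n. (cmod (g n))\<^sup>2)"
  shows "summable (\<lambda>n. cnj (f n) * g n)"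
proof (rule summable_norm_cancel, rule summable_comparison_test')
  show "summable (\<lambda>n. (cmod (f n))\<^sup>2 + (cmod (g n))\<^sup>2)"
    using assms by (intro summable_add)
  fix n :: nat
  have "2 * (cmod (f n) * cmod (g n)) \<le> (cmod (f n))\<^sup>2 + (cmod (g n))\<^sup>2"
    using zero_le_power2[of "cmod (f n) - cmod (g n)"] by (simp add: power2_diff)
  moreover have "0 \<le> cmod (f n) * cmod (g n)" by simp
  ultimately have "cmod (f n) * cmod (g n) \<le> (cmod (f n))\<^sup>2 + (cmod (g n))\<^sup>2" by linarith
  then show "norm (norm (cnj (f n) * g n)) \<le> (cmod (f n))\<^sup>2 + (cmod (g n))\<^sup>2"
    by (simp add: norm_mult)
qed

lemma ell2_partial_bound:
  fixes f :: "nat \<Rightarrow> complex"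
  assumes "summable (\<lambda>n. (cmod (f n))\<^sup>2)"
  shows "L2_set (\<lambda>n. cmod (f n)) {..<N} \<le> sqrt (\<Sum>n. (cmod (f n))\<^sup>2)"
  unfolding L2_set_def by (intro real_sqrt_le_mono sum_le_suminf assms) auto

lemma ell2_bound_intro:
  fixes f :: "nat \<Rightarrow> complex"
  assumes "\<And>N. L2_set (\<lambda>n. cmod (f n)) {..<N} \<le> c"
  shows "summable (\<lambda>n. (cmod (f n))\<^sup>2)" "sqrt (\<Sum>n. (cmod (f n))\<^sup>2) \<le> c"
proof -
  have c: "0 \<le> c" using assms[of 0] by simp
  have le: "(\<Sum>n<N. (cmod (f n))\<^sup>2) \<le> c\<^sup>2" for N
    using assms[of N] c unfolding L2_set_def by (simp add: sqrt_le_D)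
  show s: "summable (\<lambda>n. (cmod (f n))\<^sup>2)"
    by (rule summableI_nonneg_bounded[where x = "c\<^sup>2"]) (use le in auto)
  have "(\<Sum>n. (cmod (f n))\<^sup>2) \<le> c\<^sup>2"
    by (rule suminf_le_const[OF s le])
  then show "sqrt (\<Sum>n. (cmod (f n))\<^sup>2) \<le> c"
    using c by (simp add: real_le_lsqrt sum_nonneg suminf_nonneg[OF s])
qed

instantiation ell2 :: real_normed_vector
begin

lift_definition zero_ell2 :: ell2 is "\<lambda>_. 0" by simp
lift_definition plus_ell2 :: "ell2 \<Rightarrow> ell2 \<Rightarrow> ell2" is "\<lambda>f g n. f n + g n"
  by (rule ell2_summable_add)
lift_definition uminus_ell2 :: "ell2 \<Rightarrow> ell2" is "\<lambda>f n. - f n" by simp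
lift_definition minus_ell2 :: "ell2 \<Rightarrow> ell2 \<Rightarrow> ell2" is "\<lambda>f g n. f n - g n"
proof -
  fix f g :: "nat \<Rightarrow> complex"
  assume "summable (\<lambda>n. (cmod (f n))\<^sup>2)" "summable (\<lambda>n. (cmod (g n))\<^sup>2)"
  then show "summable (\<lambda>n. (cmod (f n - g n))\<^sup>2)"
    using ell2_summable_add[of f "\<lambda>n. - g n"] by simp
qed
lift_definition scaleR_ell2 :: "real \<Rightarrow> ell2 \<Rightarrow> ell2" is "\<lambda>a f n. complex_of_real a * f n"
  by (rule ell2_summable_scale)
lift_definition norm_ell2 :: "ell2 \<Rightarrow> real" is "\<lambda>f. sqrt (\<Sum>n. (cmod (f n))\<^sup>2)" .

definition dist_ell2 :: "ell2 \<Rightarrow> ell2 \<Rightarrow> real" where "dist_ell2 x y = norm (x - y)"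
definition sgn_ell2 :: "ell2 \<Rightarrow> ell2" where "sgn_ell2 x = inverse (norm x) *\<^sub>R x"
definition uniformity_ell2 :: "(ell2 \<times> ell2) filter" where
  "uniformity_ell2 = (INF e\<in>{0<..}. principal {(x, y). dist x y < e})"
definition open_ell2 :: "ell2 set \<Rightarrow> bool" where
  "open_ell2 U = (\<forall>x\<in>U. eventually (\<lambda>(x', y). x' = x \<longrightarrow> y \<in> U) uniformity)"

instance
proof
  fix x y z :: ell2 and a b :: real and U :: "ell2 set"
  show "x + y + z = x + (y + z)" "x + y = y + x" "0 + x = x" "- x + x = 0" "x - y = x + - y"
    by (transfer, simp add: add_ac)+
  show "a *\<^sub>R (x + y) = a *\<^sub>R x + a *\<^sub>R y" "(a + b) *\<^sub>R x = a *\<^sub>R x + b *\<^sub>R x"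
    "a *\<^sub>R b *\<^sub>R x = (a * b) *\<^sub>R x" "1 *\<^sub>R x = x"
    by (transfer, simp add: algebra_simps)+
  show "dist x y = norm (x - y)" "sgn x = inverse (norm x) *\<^sub>R x"
    "(uniformity :: (ell2 \<times> ell2) filter) = (INF e\<in>{0<..}. principal {(x, y). dist x y < e})"
    "open U = (\<forall>x\<in>U. eventually (\<lambda>(x', y). x' = x \<longrightarrow> y \<in> U) uniformity)"
    by (rule dist_ell2_def sgn_ell2_def uniformity_ell2_def open_ell2_def)+
  show "norm x = 0 \<longleftrightarrow> x = 0"
    by transfer (simp add: suminf_eq_zero_iff fun_eq_iff)
  show "norm (a *\<^sub>R x) = \<bar>a\<bar> * norm x"
    by transfer (simp add: norm_mult power_mult_distrib suminf_mult real_sqrt_mult)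
  show "norm (x + y) \<le> norm x + norm y"
  proof transfer
    fix f g :: "nat \<Rightarrow> complex"
    assume f: "summable (\<lambda>n. (cmod (f n))\<^sup>2)" and g: "summable (\<lambda>n. (cmod (g n))\<^sup>2)"
    show "sqrt (\<Sum>n. (cmod (f n + g n))\<^sup>2)
        \<le> sqrt (\<Sum>n. (cmod (f n))\<^sup>2) + sqrt (\<Sum>n. (cmod (g n))\<^sup>2)"
    proof (rule ell2_bound_intro(2))
      fix N
      have "L2_set (\<lambda>n. cmod (f n + g n)) {..<N} \<le> L2_set (\<lambda>n. cmod (f n) + cmod (g n)) {..<N}"
        by (rule L2_set_mono) (auto simp: norm_triangle_ineq)
      also have "\<dots> \<le> L2_set (\<lambda>n. cmod (f n)) {..<N} + L2_set (\<lambda>n. cmod (g n)) {..<N}"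
        by (rule L2_set_triangle_ineq)
      also have "\<dots> \<le> sqrt (\<Sum>n. (cmod (f n))\<^sup>2) + sqrt (\<Sum>n. (cmod (g n))\<^sup>2)"
        by (intro add_mono ell2_partial_bound f g)
      finally show "L2_set (\<lambda>n. cmod (f n + g n)) {..<N}
        \<le> sqrt (\<Sum>n. (cmod (f n))\<^sup>2) + sqrt (\<Sum>n. (cmod (g n))\<^sup>2)" .
    qed
  qed
qed

end

lemma ell2_partial_norm: "L2_set (\<lambda>n. cmod (Rep_ell2 x n)) {..<N} \<le> norm x"
  using Rep_ell2[of x] by (simp add: norm_ell2.rep_eq ell2_partial_bound)

lemma ell2_coord_norm: "cmod (Rep_ell2 x n) \<le> norm x"
  using member_le_L2_set[of "{..<Suc n}" n "\<lambda>n. cmod (Rep_ell2 x n)"]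
    ell2_partial_norm[of x "Suc n"] by simp

instance ell2 :: banach
proof
  fix X :: "nat \<Rightarrow> ell2"
  assume C: "Cauchy X"
  have "Cauchy (\<lambda>k. Rep_ell2 (X k) n)" for n
  proof (rule CauchyI)
    fix e :: real assume "0 < e"
    from CauchyD[OF C this] obtain M where M: "\<forall>k\<ge>M. \<forall>l\<ge>M. norm (X k - X l) < e" by blast
    have "cmod (Rep_ell2 (X k) n - Rep_ell2 (X l) n) \<le> norm (X k - X l)" for k l
      using ell2_coord_norm[of "X k - X l" n] by (simp add: minus_ell2.rep_eq)
    then show "\<exists>M. \<forall>k\<ge>M. \<forall>l\<ge>M. norm (Rep_ell2 (X k) n - Rep_ell2 (X l) n) < e"
      using M by (meson le_less_trans)
  qed
  then have "\<forall>n. \<exists>l. (\<lambda>k. Rep_ell2 (X k) n) \<longlonglongrightarrow> l"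
    by (auto simp: Cauchy_convergent_iff convergent_def)
  then obtain F where F: "\<And>n. (\<lambda>k. Rep_ell2 (X k) n) \<longlonglongrightarrow> F n" by metis
  have bound: "L2_set (\<lambda>n. cmod (Rep_ell2 (X k) n - F n)) {..<N} \<le> e"
    if M: "\<forall>k\<ge>M. \<forall>l\<ge>M. norm (X k - X l) < e" and k: "k \<ge> M" for e M k N
  proof (rule tendsto_upperbound)
    show "(\<lambda>l. L2_set (\<lambda>n. cmod (Rep_ell2 (X k) n - Rep_ell2 (X l) n)) {..<N})
        \<longlonglongrightarrow> L2_set (\<lambda>n. cmod (Rep_ell2 (X k) n - F n)) {..<N}"
      unfolding L2_set_def by (intro tendsto_intros F)
    show "\<forall>\<^sub>F l in sequentially. L2_set (\<lambda>n. cmod (Rep_ell2 (X k) n - Rep_ell2 (X l) n)) {..<N} \<le> e"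
      unfolding eventually_sequentially
    proof (intro exI[of _ M] allI impI)
      fix l assume "l \<ge> M"
      then have "norm (X k - X l) < e" using M k by blast
      then show "L2_set (\<lambda>n. cmod (Rep_ell2 (X k) n - Rep_ell2 (X l) n)) {..<N} \<le> e"
        using ell2_partial_norm[of "X k - X l" N] by (simp add: minus_ell2.rep_eq)
    qed
  qed simp
  obtain M where "\<forall>k\<ge>M. \<forall>l\<ge>M. norm (X k - X l) < 1" using CauchyD[OF C, of 1] by auto
  then have "summable (\<lambda>n. (cmod (Rep_ell2 (X M) n - F n))\<^sup>2)"
    by (intro ell2_bound_intro(1)[where c = 1] bound) auto
  then have "summable (\<lambda>n. (cmod (Rep_ell2 (X M) n + (- 1) * (Rep_ell2 (X M) n - F n)))\<^sup>2)"
    using Rep_ell2[of "X M"] by (intro ell2_summable_add ell2_summable_scale) auto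
  then have F': "Rep_ell2 (Abs_ell2 F) = F" by (simp add: Abs_ell2_inverse)
  have "X \<longlonglongrightarrow> Abs_ell2 F"
  proof (rule LIMSEQ_I)
    fix e :: real assume "0 < e"
    then obtain M where M: "\<forall>k\<ge>M. \<forall>l\<ge>M. norm (X k - X l) < e / 2"
      using CauchyD[OF C, of "e / 2"] by auto
    have "norm (X k - Abs_ell2 F) \<le> e / 2" if "k \<ge> M" for k
      using ell2_bound_intro(2)[OF bound[OF M that]] by (simp add: norm_ell2.rep_eq minus_ell2.rep_eq F')
    then show "\<exists>M. \<forall>k\<ge>M. norm (X k - Abs_ell2 F) < e"
      using \<open>0 < e\<close> by (smt (verit) field_sum_of_halves)
  qed
  then show "convergent X" by (auto simp: convergent_def)
qed

instantiation ell2 :: chilbert_space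
begin

lift_definition scaleC_ell2 :: "complex \<Rightarrow> ell2 \<Rightarrow> ell2" is "\<lambda>c f n. c * f n"
  by (rule ell2_summable_scale)
lift_definition cinner_ell2 :: "ell2 \<Rightarrow> ell2 \<Rightarrow> complex" is "\<lambda>f g. \<Sum>n. cnj (f n) * g n" .

instance
proof
  fix x y z :: ell2 and a :: real and c c' :: complex
  show "c *\<^sub>C (x + y) = c *\<^sub>C x + c *\<^sub>C y" "(c + c') *\<^sub>C x = c *\<^sub>C x + c' *\<^sub>C x"
    "c *\<^sub>C c' *\<^sub>C x = (c * c') *\<^sub>C x" "a *\<^sub>R x = complex_of_real a *\<^sub>C x"
    by (transfer, simp add: algebra_simps)+
  show "cinner x y = cnj (cinner y x)"
  proof transfer
    fix f g :: "nat \<Rightarrow> complex"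
    assume "summable (\<lambda>n. (cmod (f n))\<^sup>2)" "summable (\<lambda>n. (cmod (g n))\<^sup>2)"
    then have "(\<lambda>n. cnj (g n) * f n) sums (\<Sum>n. cnj (g n) * f n)"
      by (intro summable_sums ell2_summable_prod)
    then have "(\<lambda>n. cnj (cnj (g n) * f n)) sums cnj (\<Sum>n. cnj (g n) * f n)"
      by (simp only: sums_cnj)
    then show "(\<Sum>n. cnj (f n) * g n) = cnj (\<Sum>n. cnj (g n) * f n)"
      by (simp add: sums_iff mult.commute)
  qed
  show "cinner x (y + z) = cinner x y + cinner x z"
    by transfer (simp add: distrib_left suminf_add ell2_summable_prod)
  show "cinner x (c *\<^sub>C y) = c * cinner x y"
    by transfer (simp add: mult.left_commute suminf_mult ell2_summable_prod)
  show "cinner x x = complex_of_real ((norm x)\<^sup>2)"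
  proof transfer
    fix f :: "nat \<Rightarrow> complex"
    assume s: "summable (\<lambda>n. (cmod (f n))\<^sup>2)"
    have "cnj (f n) * f n = complex_of_real ((cmod (f n))\<^sup>2)" for n
      by (metis complex_norm_square mult.commute)
    then show "(\<Sum>n. cnj (f n) * f n) = complex_of_real ((sqrt (\<Sum>n. (cmod (f n))\<^sup>2))\<^sup>2)"
      using s by (simp add: suminf_of_real suminf_nonneg)
  qed
qed

end

text \<open>A group is of type I if each of its unitary representations generates a type I von Neumann
  algebra (the bicommutant of its range). For second countable groups it suffices to consider
  separable spaces, since every representation is a direct sum of cyclic, hence separable, ones;
  and finite-dimensional spaces may be omitted, because every von Neumann algebra on such a space
  is of type I.\<close>

definition type_I_group ::
  "'g::{topological_group_add, second_countable_topology} itself \<Rightarrow> bool" where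
  "type_I_group _ \<longleftrightarrow>
     (\<forall>\<pi> :: 'g \<Rightarrow> ell2 \<Rightarrow> ell2. unitary_rep \<pi> \<longrightarrow> type_I_algebra (commutant (commutant (range \<pi>))))"

section \<open>Haar measures and homogeneous spaces\<close>

definition is_add_subgroup :: "'g::group_add set \<Rightarrow> bool" where
  "is_add_subgroup H \<longleftrightarrow> 0 \<in> H \<and> (\<forall>g\<in>H. \<forall>h\<in>H. g + h \<in> H) \<and> (\<forall>g\<in>H. - g \<in> H)"

text \<open>Left Haar measures of a closed subgroup \<open>S\<close>. Regularity is automatic, as the groups
  considered are locally compact and second countable.\<close>

definition haar_measure_on ::
  "'g::{topological_group_add, second_countable_topology, t2_space} set \<Rightarrow> 'g measure \<Rightarrow> bool" where
  "haar_measure_on S \<mu> \<longleftrightarrow>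
     sets \<mu> = sets (restrict_space borel S) \<and>
     emeasure \<mu> S \<noteq> 0 \<and>
     (\<forall>C. compact C \<longrightarrow> C \<subseteq> S \<longrightarrow> emeasure \<mu> C < \<infinity>) \<and>
     (\<forall>g\<in>S. \<forall>A\<in>sets \<mu>. emeasure \<mu> (g +o A) = emeasure \<mu> A)"

definition unimodular_group ::
  "'g::{topological_group_add, second_countable_topology, t2_space} itself \<Rightarrow> bool" where
  "unimodular_group _ \<longleftrightarrow>
     (\<forall>\<mu> :: 'g measure. haar_measure_on UNIV \<mu> \<longrightarrow>
        (\<forall>g. \<forall>A\<in>sets \<mu>. emeasure \<mu> ((\<lambda>a. a + g) ` A) = emeasure \<mu> A))"

definition cosets :: "'g::group_add set \<Rightarrow> 'g set set" where
  "cosets H = range (\<lambda>g. g +o H)"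

text \<open>The Borel \<open>\<sigma>\<close>-algebra of the quotient topology, and the action of the group on sets of cosets.\<close>

definition coset_borel :: "'g::topological_group_add set \<Rightarrow> 'g set measure" where
  "coset_borel H = sigma (cosets H) {U. U \<subseteq> cosets H \<and> open {g. g +o H \<in> U}}"

definition translate :: "'g::group_add \<Rightarrow> 'g set set \<Rightarrow> 'g set set" where
  "translate g X = (\<lambda>c. g +o c) ` X"

text \<open>A function \<open>F\<close> on the group that is constant on the coset \<open>c\<close>, viewed as a function of \<open>c\<close>.\<close>

definition on_coset :: "('g \<Rightarrow> 'a) \<Rightarrow> 'g set \<Rightarrow> 'a" where
  "on_coset F c = the_elem (F ` c)"

text \<open>The invariant measure on the cosets, normalized by
  \<open>\<integral> f d\<nu>G = \<integral> \<integral> f (gh) d\<nu>H(h) d\<nu>\<Omega>(gH)\<close>. The inner integral is constant on cosets for every \<open>f\<close>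
  because \<open>\<nu>H\<close> is left invariant.\<close>

definition coset_measure ::
  "'g::{topological_group_add, second_countable_topology, t2_space} set \<Rightarrow>
     'g measure \<Rightarrow> 'g measure \<Rightarrow> 'g set measure \<Rightarrow> bool" where
  "coset_measure H \<nu>G \<nu>H \<nu>\<Omega> \<longleftrightarrow>
     sets \<nu>\<Omega> = sets (coset_borel H) \<and>
     (\<forall>g. \<forall>X\<in>sets \<nu>\<Omega>. emeasure \<nu>\<Omega> (translate g X) = emeasure \<nu>\<Omega> X) \<and>
     (\<forall>f :: 'g \<Rightarrow> complex. integrable \<nu>G f \<longrightarrow>
        has_bochner_integral \<nu>\<Omega> (on_coset (\<lambda>g. LINT h|\<nu>H. f (g + h))) (LINT g|\<nu>G. f g))"

section \<open>Covariant instruments\<close>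

definition covariant_instruments ::
  "'g::topological_group_add set \<Rightarrow> ('g \<Rightarrow> 'k::chilbert_space \<Rightarrow> 'k) \<Rightarrow>
     ('g \<Rightarrow> 'v::chilbert_space \<Rightarrow> 'v) \<Rightarrow> (('k \<Rightarrow> 'k) \<Rightarrow> 'g set set \<Rightarrow> 'v \<Rightarrow> 'v) set" where
  "covariant_instruments H u W = {\<Gamma>.
     (\<forall>X\<in>sets (coset_borel H). normal_cp_map (\<lambda>b. \<Gamma> b X)) \<and>
     \<Gamma> id (cosets H) = id \<and>
     (\<forall>T b X. trace_class T \<longrightarrow> bounded_clinear b \<longrightarrow> range X \<subseteq> sets (coset_borel H) \<longrightarrow>
        disjoint_family X \<longrightarrow>
        (\<lambda>j::nat. tr (T \<circ> \<Gamma> b (X j))) sums tr (T \<circ> \<Gamma> b (\<Union>j. X j))) \<and>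
     (\<forall>g b X. bounded_clinear b \<longrightarrow> X \<in> sets (coset_borel H) \<longrightarrow>
        \<Gamma> (u g \<circ> b \<circ> cadjoint (u g)) (translate g X) = W g \<circ> \<Gamma> b X \<circ> cadjoint (W g))}"

end

theory Submission
  imports Defs "HOL-Complex_Analysis.Great_Picard"
begin

text \<open>
  Complete positivity and covariance are statements about the kernels
  \<open>D\<^sub>X (\<eta>, \<phi>) (\<xi>, \<psi>) = \<langle>\<phi>|\<Gamma>(|\<eta>\<rangle>\<langle>\<xi>|, X)\<psi>\<rangle>\<close> on pairs of vectors: each \<open>D\<^sub>X\<close> is positive semidefinite, and
  \<open>D\<close> at the translate \<open>gX\<close> is \<open>D\<^sub>X\<close> with \<open>(\<eta>, \<phi>)\<close> replaced by \<open>(u\<^sub>g\<^sup>* \<eta>, W(g)\<^sup>* \<phi>)\<close> in both arguments. By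
  normality the kernels determine \<open>\<Gamma>\<close>. Hence an instrument should be recoverable from the density of
  \<open>D\<close> with respect to the invariant measure at the single point \<open>H\<close> of \<open>\<Omega>\<close>, and the
  Kraus operators should be the factors of a decomposition of this positive semidefinite kernel
  into rank one kernels.

  The density exists because of square integrability. The Cauchy--Schwarz inequality for the positive
  operator \<open>\<Gamma>(I, X)\<close>, integrated along an orbit of \<open>W\<close>, gives \<open>\<Gamma>(I, X) \<le> \<nu>\<^sub>\<Omega>(X)/d\<close>
  (\<open>\<Gamma>_id_bound\<close>); unimodularity enters when the orbit integral of \<open>\<Gamma>(I, X)\<close> is evaluated by Fubini's
  theorem. So the quotients \<open>D\<^sub>X / \<nu>\<^sub>\<Omega>(X)\<close>, for \<open>X\<close> running through neighbourhoods that shrink to the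
  base point, are bounded and equicontinuous, and by separability a subsequence converges at all
  arguments at once (\<open>cp_kernel_compact\<close>). Let \<open>q\<close> be the limit. Averaging the translates of these
  neighbourhoods over an open set and applying Fubini's theorem again identifies
  \<open>\<langle>\<phi>|\<Gamma>(|\<eta>\<rangle>\<langle>\<eta>|, X)\<phi>\<rangle>\<close> with the integral over \<open>X\<close> of \<open>q\<close> transported along the group
  (\<open>density_kernel\<close>). Since the limit is taken at one point only and transported by covariance,
  no exceptional null sets arise. The neighbourhoods can be chosen invariant
  under \<open>H\<close>, so \<open>q\<close> is invariant under \<open>H\<close>, which is the relation between the Kraus operators,
  \<open>u\<^sub>h\<close> and \<open>W(h)\<close> in the conclusion.

  The kernel \<open>q\<close> is factored by the Cholesky algorithm along a dense sequence
  (\<open>psd_factorization\<close>), and the Riesz representation turns the factors into operators \<open>B\<^sub>k\<close>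
  (\<open>cpk_kraus\<close>). For rank one operators \<open>b\<close> the integral formula holds by construction. A bounded
  operator \<open>b\<close> is the limit of its compressions to finite-dimensional coordinate spaces, to which
  normality of \<open>\<Gamma>\<close> applies on one side and dominated convergence on the other
  (\<open>has_density_all\<close>). Finally, for \<open>b = I\<close> and \<open>X = \<Omega>\<close> the left-hand side is \<open>1\<close>, and square
  integrability evaluates the right-hand side to \<open>d \<Sum>\<^sub>k tr[B\<^sub>k\<^sup>* B\<^sub>k]\<close> (\<open>hilbert_schmidt_total\<close>).

  Normality and countable additivity are formulated with trace class operators, that is, with
  \<open>|T| = (T\<^sup>* T)\<^sup>1\<^sup>/\<^sup>2\<close>. To use them, one needs square roots of positive operators
  (\<open>positive_sqrt_exists\<close>, \<open>positive_sqrt_unique\<close>) and the expansion of a trace class operator into rank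
  one operators (\<open>trace_class_nuclear\<close>), for which the same Cholesky factorization is used.
\<close>


section \<open>Hilbert space preliminaries\<close>

lemma cinner_add_left: "cinner (x + y) z = cinner x z + cinner y z"
  by (metis cinner_add_right cinner_commute complex_cnj_add)

lemma cinner_scaleC_left: "cinner (c *\<^sub>C x) y = cnj c * cinner x y"
  by (metis cinner_scaleC_right cinner_commute complex_cnj_mult)

lemma cinner_scaleR_right: "cinner x (a *\<^sub>R y) = a *\<^sub>R cinner x y"
  by (simp add: scaleR_scaleC cinner_scaleC_right scaleR_conv_of_real)

lemma cinner_scaleR_left: "cinner (a *\<^sub>R x) y = a *\<^sub>R cinner x y"
  by (simp add: scaleR_scaleC cinner_scaleC_left scaleR_conv_of_real)

lemma cinner_zero_right [simp]: "cinner x 0 = 0"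
  using cinner_add_right[of x 0 0] by simp

lemma cinner_zero_left [simp]: "cinner 0 x = 0"
  using cinner_add_left[of 0 0 x] by simp

lemma cinner_minus_right: "cinner x (- y) = - cinner x y"
  using cinner_add_right[of x y "- y"] by (simp add: add_eq_0_iff)

lemma cinner_minus_left: "cinner (- x) y = - cinner x y"
  using cinner_add_left[of x "- x" y] by (simp add: add_eq_0_iff)

lemma cinner_diff_right: "cinner x (y - z) = cinner x y - cinner x z"
  using cinner_add_right[of x y "- z"] by (simp add: cinner_minus_right)

lemma cinner_diff_left: "cinner (x - y) z = cinner x z - cinner y z"
  using cinner_add_left[of x "- y" z] by (simp add: cinner_minus_left)

lemma scaleC_one [simp]: "1 *\<^sub>C x = x"
  using scaleR_scaleC[of 1 x] by simp

lemma scaleC_zero_left [simp]: "0 *\<^sub>C x = 0"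
  using scaleR_scaleC[of 0 x] by simp

lemma scaleC_zero_right [simp]: "c *\<^sub>C 0 = 0"
  using scaleC_add_right[of c 0 0] by simp

lemma scaleC_minus_one: "(- 1) *\<^sub>C x = - x"
  using scaleR_scaleC[of "- 1" x] by simp

lemma scaleC_minus_right: "c *\<^sub>C (- x) = - (c *\<^sub>C x)"
  using scaleC_add_right[of c x "- x"] by (simp add: add_eq_0_iff)

lemma scaleC_diff_right: "c *\<^sub>C (x - y) = c *\<^sub>C x - c *\<^sub>C y"
  using scaleC_add_right[of c x "- y"] by (simp add: scaleC_minus_right)

lemma cinner_sum_right: "cinner x (\<Sum>i\<in>I. f i) = (\<Sum>i\<in>I. cinner x (f i))"
  by (induction I rule: infinite_finite_induct) (auto simp: cinner_add_right)

lemma cinner_sum_left: "cinner (\<Sum>i\<in>I. f i) x = (\<Sum>i\<in>I. cinner (f i) x)"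
  by (induction I rule: infinite_finite_induct) (auto simp: cinner_add_left)

lemmas cinner_simps = cinner_add_left cinner_add_right cinner_diff_left cinner_diff_right
  cinner_minus_left cinner_minus_right cinner_scaleC_left cinner_scaleC_right
  cinner_sum_left cinner_sum_right

lemma norm_sq_cinner: "(norm x)\<^sup>2 = Re (cinner x x)"
  by (simp add: cinner_eq_norm)

lemma cinner_self_zero [simp]: "cinner x x = 0 \<longleftrightarrow> x = 0"
  by (simp add: cinner_eq_norm)

lemma cinner_eqI: "(\<And>y. cinner y x = cinner y z) \<Longrightarrow> x = z"
  using cinner_self_zero[of "x - z"] by (simp add: cinner_diff_right)

lemma cinner_eqI': "(\<And>y. cinner x y = cinner z y) \<Longrightarrow> x = z"
  by (metis cinner_commute cinner_eqI)

lemma norm_scaleC: "norm (c *\<^sub>C x) = cmod c * norm x"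
proof -
  have "cinner (c *\<^sub>C x) (c *\<^sub>C x) = (c * cnj c) * cinner x x"
    by (simp add: cinner_scaleC_left cinner_scaleC_right)
  also have "\<dots> = complex_of_real ((cmod c * norm x)\<^sup>2)"
    by (simp only: complex_norm_square[symmetric] cinner_eq_norm power_mult_distrib of_real_mult)
  finally have "cinner (c *\<^sub>C x) (c *\<^sub>C x) = complex_of_real ((cmod c * norm x)\<^sup>2)" .
  then have "(norm (c *\<^sub>C x))\<^sup>2 = (cmod c * norm x)\<^sup>2"
    unfolding cinner_eq_norm of_real_eq_iff .
  then show ?thesis by (rule power2_eq_imp_eq) auto
qed

lemma norm_add_sq: "(norm (x + y))\<^sup>2 = (norm x)\<^sup>2 + (norm y)\<^sup>2 + 2 * Re (cinner x y)"
proof -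
  have "Re (cinner y x) = Re (cinner x y)" by (subst cinner_commute) simp
  then show ?thesis by (simp add: norm_sq_cinner cinner_simps)
qed

lemma norm_diff_sq: "(norm (x - y))\<^sup>2 = (norm x)\<^sup>2 + (norm y)\<^sup>2 - 2 * Re (cinner x y)"
  using norm_add_sq[of x "- y"] by (simp add: cinner_minus_right)

lemma cinner_cauchy_schwarz: "cmod (cinner x y) \<le> norm x * norm y"
proof (cases "y = 0")
  case False
  define t where "t = cinner y x / complex_of_real ((norm y)\<^sup>2)"
  have c: "cinner y x = t * complex_of_real ((norm y)\<^sup>2)"
    using False by (simp add: t_def)
  have xy: "cinner x y = cnj t * complex_of_real ((norm y)\<^sup>2)"
    by (subst cinner_commute) (simp add: c)
  have "0 \<le> (norm (x - t *\<^sub>C y))\<^sup>2" by simp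
  also have "\<dots> = (norm x)\<^sup>2 - (cmod t)\<^sup>2 * (norm y)\<^sup>2"
  proof -
    have "Re (cinner x (t *\<^sub>C y)) = (cmod t)\<^sup>2 * (norm y)\<^sup>2"
      unfolding cinner_scaleC_right xy mult.assoc[symmetric]
      by (simp add: complex_mult_cnj cmod_power2)
    then show ?thesis
      by (simp add: norm_diff_sq norm_scaleC power_mult_distrib)
  qed
  finally have "(cmod t * norm y)\<^sup>2 \<le> (norm x)\<^sup>2" by (simp add: power_mult_distrib)
  then have "cmod t * norm y \<le> norm x"
    by (rule power2_le_imp_le) simp
  moreover have "cmod (cinner x y) = cmod t * norm y * norm y"
    by (simp add: xy norm_mult power2_eq_square)
  ultimately show ?thesis using mult_right_mono[of "cmod t * norm y" "norm x" "norm y"] by simp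
qed simp

lemma bounded_bilinear_cinner: "bounded_bilinear (cinner :: 'a::chilbert_space \<Rightarrow> 'a \<Rightarrow> complex)"
proof (rule bounded_bilinear.intro)
  show "\<exists>K. \<forall>a b. cmod (cinner (a :: 'a) b) \<le> norm a * norm b * K"
    by (rule exI[of _ 1]) (simp add: cinner_cauchy_schwarz)
qed (rule cinner_add_left cinner_add_right cinner_scaleR_left cinner_scaleR_right)+

lemma bounded_bilinear_scaleC: "bounded_bilinear (scaleC :: complex \<Rightarrow> 'a \<Rightarrow> 'a::chilbert_space)"
proof (rule bounded_bilinear.intro)
  show "\<exists>K. \<forall>a b. norm (a *\<^sub>C (b :: 'a)) \<le> norm a * norm b * K"
    by (rule exI[of _ 1]) (simp add: norm_scaleC)
  show "(r *\<^sub>R a) *\<^sub>C (b :: 'a) = r *\<^sub>R a *\<^sub>C b" "a *\<^sub>C r *\<^sub>R (b :: 'a) = r *\<^sub>R a *\<^sub>C b" for r a b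
    by (simp_all only: scaleR_scaleC scaleC_scaleC scaleR_conv_of_real mult.commute)
qed (rule scaleC_add_left scaleC_add_right)+

lemmas tendsto_cinner [tendsto_intros] = bounded_bilinear.tendsto[OF bounded_bilinear_cinner]
lemmas continuous_on_cinner [continuous_intros] = bounded_bilinear.continuous_on[OF bounded_bilinear_cinner]

subsection \<open>Bounded operators\<close>

lemma bounded_clinearI:
  assumes "\<And>x y. A (x + y) = A x + A y" "\<And>c x. A (c *\<^sub>C x) = c *\<^sub>C A x"
    "\<And>x. norm (A x) \<le> norm x * C"
  shows "bounded_clinear A"
  unfolding bounded_clinear_def
  by (intro conjI bounded_linear_intro[of A C]) (use assms in \<open>auto simp: scaleR_scaleC\<close>)

lemma bounded_clinear_bounded_linear: "bounded_clinear A \<Longrightarrow> bounded_linear A"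
  by (simp add: bounded_clinear_def)

context
  fixes A :: "'a::chilbert_space \<Rightarrow> 'b::chilbert_space"
  assumes A: "bounded_clinear A"
begin

lemma bclin_scaleC: "A (c *\<^sub>C x) = c *\<^sub>C A x"
  using A by (simp add: bounded_clinear_def)

lemma bclin_add: "A (x + y) = A x + A y"
  using A by (simp add: bounded_clinear_def linear_simps)

lemma bclin_diff: "A (x - y) = A x - A y"
  using A by (simp add: bounded_clinear_def linear_simps)

lemma bclin_zero: "A 0 = 0"
  using A by (simp add: bounded_clinear_def linear_simps)

lemma bclin_sum: "A (\<Sum>i\<in>I. f i) = (\<Sum>i\<in>I. A (f i))"
  by (induction I rule: infinite_finite_induct) (auto simp: bclin_zero bclin_add)

lemma bclin_bound: "norm (A x) \<le> onorm A * norm x"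
  using A by (simp add: bounded_clinear_def onorm)

lemma bclin_onorm_pos: "0 \<le> onorm A"
  using A by (simp add: bounded_clinear_def onorm_pos_le)

lemma bclin_tendsto: "(f \<longlongrightarrow> x) F \<Longrightarrow> ((\<lambda>t. A (f t)) \<longlongrightarrow> A x) F"
  using A bounded_linear.tendsto[of A f x F] by (simp add: bounded_clinear_def)

end

lemma bounded_clinear_id [simp]: "bounded_clinear id" "bounded_clinear (\<lambda>x. x)"
  by (auto intro!: bounded_clinearI[where C = 1])

lemma bounded_clinear_zero [simp]: "bounded_clinear (\<lambda>_. 0)"
  by (auto intro!: bounded_clinearI[where C = 1])

lemma bounded_clinear_compose:
  "bounded_clinear A \<Longrightarrow> bounded_clinear B \<Longrightarrow> bounded_clinear (\<lambda>x. A (B x))"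
  by (auto simp: bounded_clinear_def intro: bounded_linear_compose)

lemma bounded_clinear_comp [simp]:
  "bounded_clinear A \<Longrightarrow> bounded_clinear B \<Longrightarrow> bounded_clinear (A \<circ> B)"
  by (simp add: o_def bounded_clinear_compose)

lemma bounded_clinear_add:
  "bounded_clinear A \<Longrightarrow> bounded_clinear B \<Longrightarrow> bounded_clinear (\<lambda>x. A x + B x)"
  by (auto simp: bounded_clinear_def scaleC_add_right intro: bounded_linear_add)

lemma bounded_clinear_scaleC:
  assumes "bounded_clinear A" shows "bounded_clinear (\<lambda>x. c *\<^sub>C A x)"
proof (rule bounded_clinearI)
  show "norm (c *\<^sub>C A x) \<le> norm x * (cmod c * onorm A)" for x
    using mult_left_mono[OF bclin_bound[OF assms, of x], of "cmod c"]
    by (simp add: norm_scaleC mult_ac)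
qed (simp_all add: bclin_add[OF assms] bclin_scaleC[OF assms] scaleC_add_right scaleC_scaleC mult.commute)

lemma bounded_clinear_diff:
  "bounded_clinear A \<Longrightarrow> bounded_clinear B \<Longrightarrow> bounded_clinear (\<lambda>x. A x - B x)"
  by (auto simp: bounded_clinear_def scaleC_diff_right intro: bounded_linear_sub)

lemma bounded_clinear_sum:
  "(\<And>i. i \<in> I \<Longrightarrow> bounded_clinear (A i)) \<Longrightarrow> bounded_clinear (\<lambda>x. \<Sum>i\<in>I. A i x)"
  by (induction I rule: infinite_finite_induct) (auto intro!: bounded_clinear_add)

definition rank1 :: "'b::chilbert_space \<Rightarrow> 'a::chilbert_space \<Rightarrow> 'a \<Rightarrow> 'b" where
  "rank1 \<eta> \<xi> = (\<lambda>x. cinner \<xi> x *\<^sub>C \<eta>)"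

lemma bounded_clinear_rank1 [simp]: "bounded_clinear (rank1 \<eta> \<xi>)"
  by (rule bounded_clinearI[where C = "norm \<xi> * norm \<eta>"])
    (use cinner_cauchy_schwarz in \<open>auto simp: rank1_def cinner_simps scaleC_add_left scaleC_scaleC
      norm_scaleC mult.assoc[symmetric] mult.commute[of "norm _" "norm \<xi>"] intro!: mult_right_mono\<close>)

subsection \<open>The Riesz representation and adjoints\<close>

text \<open>A maximizing sequence for the real part of \<open>f\<close> on the unit ball is Cauchy by the parallelogram
  law; its limit is orthogonal to the kernel of \<open>f\<close>.\<close>

lemma riesz_representation:
  fixes f :: "'a::chilbert_space \<Rightarrow> complex"
  assumes add: "\<And>x y. f (x + y) = f x + f y" and scale: "\<And>c x. f (c *\<^sub>C x) = c * f x"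
    and bound: "\<And>x. cmod (f x) \<le> C * norm x"
  obtains z where "\<And>x. f x = cinner z x"
proof -
  have lin: "bounded_linear f"
    by (rule bounded_linear_intro[where K = C])
      (use add scale bound in \<open>auto simp: scaleR_scaleC scaleR_conv_of_real mult.commute\<close>)
  define M where "M = onorm f"
  have fM: "cmod (f x) \<le> M * norm x" for x
    unfolding M_def by (rule onorm[OF lin])
  show ?thesis
  proof (cases "M = 0")
    case True
    then have "f x = cinner 0 x" for x using fM[of x] by simp
    then show ?thesis by (rule that)
  next
    case False
    then have M: "M > 0" using onorm_pos_le[OF lin] by (simp add: M_def)
    have "\<exists>x. norm x = 1 \<and> Re (f x) > M - inverse (real (Suc n))" for n
    proof (rule ccontr)
      assume "\<not> ?thesis"
      then have c: "Re (f x) \<le> M - inverse (real (Suc n))" if "norm x = 1" for x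
        using that by force
      define b where "b = max 0 (M - inverse (real (Suc n)))"
      have "cmod (f x) \<le> b * norm x" for x
      proof (cases "f x = 0")
        case False
        then have x: "x \<noteq> 0" using bound[of x] by auto
        define y where "y = (cnj (f x) / (cmod (f x) * norm x)) *\<^sub>C x"
        have "norm y = 1" using x False by (simp add: y_def norm_scaleC norm_divide norm_mult)
        have "f y = (f x * cnj (f x)) / (cmod (f x) * norm x)"
          by (simp add: y_def scale)
        also have "\<dots> = cmod (f x) / norm x"
          using False x unfolding complex_norm_square[symmetric] by (simp add: power2_eq_square)
        finally have "Re (f y) = cmod (f x) / norm x" by simp
        with c[OF \<open>norm y = 1\<close>] have "cmod (f x) / norm x \<le> b" by (simp add: b_def)
        then show ?thesis using x by (simp add: divide_simps)
      qed (simp add: b_def)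
      then have "M \<le> b" unfolding M_def by (intro onorm_bound) (auto simp: b_def)
      moreover have "b < M" using M by (simp add: b_def)
      ultimately show False by simp
    qed
    then obtain x where x1: "\<And>n. norm (x n) = 1" and xM: "\<And>n. Re (f (x n)) > M - inverse (real (Suc n))"
      by metis
    have close: "(norm (x m - x n))\<^sup>2 \<le> 8 * inverse (real (Suc N)) / M" if "m \<ge> N" "n \<ge> N" for m n N
    proof -
      define \<epsilon> where "\<epsilon> = inverse (real (Suc N))"
      have "Re (f (x k)) > M - \<epsilon>" if "k \<ge> N" for k
        using xM[of k] that by (smt (verit) \<epsilon>_def inverse_le_iff_le of_nat_0_less_iff of_nat_mono Suc_le_mono zero_less_Suc)
      then have "2 * (M - \<epsilon>) \<le> Re (f (x m + x n))" using that by (simp add: add) (smt (verit))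
      also have "\<dots> \<le> M * norm (x m + x n)"
        using fM complex_Re_le_cmod order_trans by blast
      finally have *: "2 * (1 - \<epsilon> / M) \<le> norm (x m + x n)" using M by (simp add: field_simps)
      \<comment> \<open>Squaring the previous estimate is only possible where its left-hand side is nonnegative.\<close>
      have "4 * (1 - 2 * \<epsilon> / M) \<le> (norm (x m + x n))\<^sup>2"
      proof (cases "1 - \<epsilon> / M \<ge> 0")
        case True
        then have "(2 * (1 - \<epsilon> / M))\<^sup>2 \<le> (norm (x m + x n))\<^sup>2" using * by (intro power_mono) auto
        moreover have "(2 * (1 - \<epsilon> / M))\<^sup>2 = 4 * (1 - 2 * \<epsilon> / M) + 4 * (\<epsilon> / M)\<^sup>2"
          by (simp add: power2_eq_square algebra_simps)
        ultimately show ?thesis by (smt (verit) zero_le_power2)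
      next
        case False
        then have "4 * (1 - 2 * \<epsilon> / M) < 0" by simp
        then show ?thesis by (smt (verit) zero_le_power2)
      qed
      moreover have "(norm (x m - x n))\<^sup>2 = 4 - (norm (x m + x n))\<^sup>2"
        by (simp add: norm_diff_sq norm_add_sq x1)
      ultimately show ?thesis unfolding \<epsilon>_def[symmetric] by (simp add: algebra_simps)
    qed
    have "Cauchy x"
    proof (rule CauchyI)
      fix e :: real assume e: "e > 0"
      obtain N where N: "inverse (real (Suc N)) < e\<^sup>2 * M / 8"
        using reals_Archimedean[of "e\<^sup>2 * M / 8"] e M by auto
      have "norm (x m - x n) < e" if "m \<ge> N" "n \<ge> N" for m n
      proof -
        have "(norm (x m - x n))\<^sup>2 < e\<^sup>2"
          using close[OF that] N M by (simp add: less_divide_eq divide_less_eq) (smt (verit) mult.commute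
            divide_less_eq)
        then show ?thesis using e by (simp add: power2_less_imp_less)
      qed
      then show "\<exists>N. \<forall>m\<ge>N. \<forall>n\<ge>N. norm (x m - x n) < e" by blast
    qed
    then obtain l where l: "x \<longlonglongrightarrow> l" by (auto simp: Cauchy_convergent_iff convergent_def)
    have "(\<lambda>n. norm (x n)) \<longlonglongrightarrow> norm l" by (intro tendsto_intros l)
    then have l1: "norm l = 1" using x1 by (simp add: LIMSEQ_const_iff)
    have fl: "(\<lambda>n. f (x n)) \<longlonglongrightarrow> f l" by (rule bounded_linear.tendsto[OF lin l])
    have "M \<le> Re (f l)"
    proof (rule LIMSEQ_le)
      show "(\<lambda>n. M - inverse (real (Suc n))) \<longlonglongrightarrow> M"
        using tendsto_diff[OF tendsto_const LIMSEQ_inverse_real_of_nat, of M] by simp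
      show "(\<lambda>n. Re (f (x n))) \<longlonglongrightarrow> Re (f l)" by (intro tendsto_intros fl)
      show "\<exists>N. \<forall>n\<ge>N. M - inverse (real (Suc n)) \<le> Re (f (x n))"
        using xM less_imp_le by blast
    qed
    moreover have fl_le: "cmod (f l) \<le> M" using fM[of l] l1 by simp
    ultimately have re: "Re (f l) = M" using complex_Re_le_cmod[of "f l"] by linarith
    have "(cmod (f l))\<^sup>2 \<le> M\<^sup>2" using fl_le by (intro power_mono) auto
    then have "f l = complex_of_real M"
      using re by (intro complex_eqI) (auto simp: cmod_power2)
    have orth: "cinner l w = 0" if w: "f w = 0" for w
    proof (cases "w = 0")
      case False
      \<comment> \<open>Subtracting from \<open>l\<close> its projection onto \<open>w\<close> does not change the value of \<open>f\<close>, but would shorten \<open>l\<close>.\<close>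
      define t where "t = - (cnj (cinner l w) / (norm w)\<^sup>2)"
      have "M = cmod (f (l + t *\<^sub>C w))"
        using M by (simp add: add scale w \<open>f l = _\<close>)
      also have "\<dots> \<le> M * norm (l + t *\<^sub>C w)" by (rule fM)
      finally have "1 \<le> norm (l + t *\<^sub>C w)" using M by simp
      then have "1 \<le> (norm (l + t *\<^sub>C w))\<^sup>2" by (metis one_power2 power_mono zero_le_one)
      also have "\<dots> = 1 - (cmod (cinner l w))\<^sup>2 / (norm w)\<^sup>2"
      proof -
        have "Re (t * cinner l w) = - ((cmod (cinner l w))\<^sup>2 / (norm w)\<^sup>2)"
          by (simp add: t_def mult.commute[of "cnj _"] flip: complex_norm_square of_real_power of_real_divide)
        moreover have "(norm (t *\<^sub>C w))\<^sup>2 = (cmod (cinner l w))\<^sup>2 / (norm w)\<^sup>2"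
          using False by (simp add: t_def norm_scaleC norm_divide norm_mult power2_eq_square)
        ultimately show ?thesis by (simp add: norm_add_sq l1 cinner_scaleC_right)
      qed
      finally have "(cmod (cinner l w))\<^sup>2 / (norm w)\<^sup>2 \<le> 0" by simp
      then show ?thesis using False by (simp add: divide_le_0_iff)
    qed simp
    have "f y = cinner (complex_of_real M *\<^sub>C l) y" for y
    proof -
      have "f (y - (f y / M) *\<^sub>C l) = 0"
        using add[of "y - (f y / M) *\<^sub>C l" "(f y / M) *\<^sub>C l"] M by (simp add: scale \<open>f l = _\<close>)
      from orth[OF this] have "cinner l y = f y / M"
        by (simp add: cinner_simps cinner_eq_norm l1)
      then show ?thesis using M by (simp add: cinner_scaleC_left)
    qed
    then show ?thesis by (rule that)
  qed
qed

lemma cadjoint_exists: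
  fixes A :: "'a::chilbert_space \<Rightarrow> 'b::chilbert_space"
  assumes A: "bounded_clinear A"
  shows "cinner (cadjoint A x) y = cinner x (A y)"
proof -
  have "\<exists>z. \<forall>y. cinner x (A y) = cinner z y" for x
  proof (rule riesz_representation[of "\<lambda>y. cinner x (A y)" "norm x * onorm A"])
    fix y
    have "cmod (cinner x (A y)) \<le> norm x * norm (A y)" by (rule cinner_cauchy_schwarz)
    also have "\<dots> \<le> norm x * (onorm A * norm y)"
      by (intro mult_left_mono bclin_bound A) auto
    finally show "cmod (cinner x (A y)) \<le> norm x * onorm A * norm y" by simp
  qed (auto simp: bclin_add[OF A] bclin_scaleC[OF A] cinner_simps)
  then obtain B where B: "\<forall>x y. cinner (B x) y = cinner x (A y)" by metis
  have "\<forall>x y. cinner (cadjoint A x) y = cinner x (A y)"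
    unfolding cadjoint_def
  proof (rule theI[of "\<lambda>B. \<forall>x y. cinner (B x) y = cinner x (A y)", OF B])
    fix C assume "\<forall>x y. cinner (C x) y = cinner x (A y)"
    with B show "C = B" by (intro ext cinner_eqI') simp
  qed
  then show ?thesis by blast
qed

lemma cadjoint_right: "bounded_clinear A \<Longrightarrow> cinner x (cadjoint A y) = cinner (A x) y"
  by (metis cadjoint_exists cinner_commute)

lemma cadjoint_unique:
  assumes "bounded_clinear A" "\<And>x y. cinner (B x) y = cinner x (A y)"
  shows "cadjoint A = B"
  by (intro ext cinner_eqI') (simp add: assms cadjoint_exists)

lemma bounded_clinear_cadjoint [simp]:
  assumes A: "bounded_clinear A"
  shows "bounded_clinear (cadjoint A)"
proof (rule bounded_clinearI)
  show "cadjoint A (x + y) = cadjoint A x + cadjoint A y" for x y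
    by (rule cinner_eqI') (simp add: cadjoint_exists A cinner_simps)
  show "cadjoint A (c *\<^sub>C x) = c *\<^sub>C cadjoint A x" for c x
    by (rule cinner_eqI') (simp add: cadjoint_exists A cinner_simps)
  show "norm (cadjoint A x) \<le> norm x * onorm A" for x
  proof -
    have "(norm (cadjoint A x))\<^sup>2 = Re (cinner x (A (cadjoint A x)))"
      by (simp add: norm_sq_cinner cadjoint_exists A)
    also have "\<dots> \<le> norm x * norm (A (cadjoint A x))"
      using cinner_cauchy_schwarz complex_Re_le_cmod order_trans by blast
    also have "\<dots> \<le> norm x * (onorm A * norm (cadjoint A x))"
      by (intro mult_left_mono bclin_bound A) auto
    finally show ?thesis
      by (cases "norm (cadjoint A x) = 0") (auto simp: power2_eq_square bclin_onorm_pos A)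
  qed
qed

lemma unitary_op_cancel [simp]:
  "unitary_op U \<Longrightarrow> cadjoint U (U x) = x" "unitary_op U \<Longrightarrow> U (cadjoint U x) = x"
  by (auto simp: unitary_op_def fun_eq_iff)

lemma unitary_op_bounded [simp]: "unitary_op U \<Longrightarrow> bounded_clinear U"
  by (simp add: unitary_op_def)

lemma unitary_op_cinner: "unitary_op U \<Longrightarrow> cinner (U x) (U y) = cinner x y"
  by (metis cadjoint_exists unitary_op_bounded unitary_op_cancel(1))

lemma unitary_op_norm: "unitary_op U \<Longrightarrow> norm (U x) = norm x"
  by (smt (verit) norm_ge_zero norm_sq_cinner power2_eq_iff_nonneg unitary_op_cinner)

lemma unitary_op_cadjoint_cinner: "unitary_op U \<Longrightarrow> cinner (cadjoint U x) (cadjoint U y) = cinner x y"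
  by (simp add: cadjoint_exists)

lemma unitary_op_norm_cadjoint: "unitary_op U \<Longrightarrow> norm (cadjoint U x) = norm x"
  by (metis unitary_op_norm unitary_op_cancel(2))

section \<open>Positive semidefinite kernels\<close>

definition psd_kernel :: "('s \<Rightarrow> 's \<Rightarrow> complex) \<Rightarrow> bool" where
  "psd_kernel q \<longleftrightarrow> (\<forall>n (x :: nat \<Rightarrow> 's) a. (\<Sum>i<n. \<Sum>j<n. cnj (a i) * a j * q (x i) (x j)) \<in> \<real>\<^sub>\<ge>\<^sub>0)"

lemma psd_two:
  assumes "psd_kernel q"
  shows "cnj a * a * q s s + cnj a * b * q s t + cnj b * a * q t s + cnj b * b * q t t \<in> \<real>\<^sub>\<ge>\<^sub>0"
  using assms[unfolded psd_kernel_def, rule_format, of "\<lambda>i. if i = 0 then a else b" "\<lambda>i. if i = 0 then s else t" 2]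
  by (simp add: numeral_2_eq_2 add_ac)

lemma psd_self:
  assumes "psd_kernel q"
  shows "q s s = complex_of_real (Re (q s s))" "0 \<le> Re (q s s)"
  using psd_two[OF assms, of 1 s 0 s] by (auto simp: complex_nonneg_Reals_iff complex_eq_iff)

lemma psd_hermitian:
  assumes "psd_kernel q" shows "q t s = cnj (q s t)"
proof (rule complex_eqI)
  show "Im (q t s) = Im (cnj (q s t))"
    using psd_two[OF assms, of 1 s 1 t] psd_self(1)[OF assms, of s] psd_self(1)[OF assms, of t]
    by (auto simp: complex_nonneg_Reals_iff complex_eq_iff)
  show "Re (q t s) = Re (cnj (q s t))"
    using psd_two[OF assms, of 1 s \<i> t] psd_self(1)[OF assms, of s] psd_self(1)[OF assms, of t]
    by (auto simp: complex_nonneg_Reals_iff complex_eq_iff)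
qed

lemma psd_zero:
  assumes q: "psd_kernel q" and z: "q s s = 0" shows "q s t = 0"
proof (rule ccontr)
  assume c: "q s t \<noteq> 0"
  \<comment> \<open>With a large multiple of \<open>- q s t\<close> as coefficient of \<open>s\<close> the form would become negative.\<close>
  define r where "r = (Re (q t t) + 1) / (2 * (cmod (q s t))\<^sup>2)"
  have p: "0 \<le> Re (cnj (- of_real r * q s t) * q s t + (- of_real r * q s t) * cnj (q s t) + q t t)"
    using psd_two[OF q, of "- of_real r * q s t" s 1 t] psd_hermitian[OF q, of t s] z
    by (simp add: complex_nonneg_Reals_iff)
  have "cnj (q s t) * q s t = complex_of_real ((cmod (q s t))\<^sup>2)"
    by (metis complex_norm_square mult.commute)
  then have "cnj (- of_real r * q s t) * q s t + (- of_real r * q s t) * cnj (q s t)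
      = complex_of_real (- 2 * r) * (cnj (q s t) * q s t)"
    by (simp add: algebra_simps)
  also have "\<dots> = complex_of_real (- 2 * r * (cmod (q s t))\<^sup>2)"
    unfolding \<open>cnj (q s t) * q s t = _\<close> by simp
  finally have "0 \<le> Re (complex_of_real (- 2 * r * (cmod (q s t))\<^sup>2) + q t t)" using p by metis
  then have "0 \<le> - 2 * r * (cmod (q s t))\<^sup>2 + Re (q t t)" by simp
  moreover have "2 * r * (cmod (q s t))\<^sup>2 = Re (q t t) + 1" using c by (simp add: r_def)
  ultimately show False by simp
qed

text \<open>The Schur complement of the kernel at \<open>e\<close>. If \<open>q e e = 0\<close>, then the division by zero leaves \<open>q\<close>
  unchanged; this is the right value, since \<open>q e t\<close> vanishes for all \<open>t\<close> in that case.\<close>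

definition schur :: "('s \<Rightarrow> 's \<Rightarrow> complex) \<Rightarrow> 's \<Rightarrow> 's \<Rightarrow> 's \<Rightarrow> complex" where
  "schur q e s t = q s t - q s e * q e t / q e e"

text \<open>The form of the Schur complement is the minimum of the form of \<open>q\<close> over the coefficient of
  an additional point \<open>e\<close>.\<close>

lemma psd_schur:
  fixes q :: "'s \<Rightarrow> 's \<Rightarrow> complex"
  assumes q: "psd_kernel q" shows "psd_kernel (schur q e)"
proof (cases "q e e = 0")
  case True
  then have "schur q e = q" by (intro ext) (simp add: schur_def)
  with q show ?thesis by simp
next
  case False
  define p where "p = Re (q e e)"
  have p: "q e e = of_real p" "p > 0"
    using psd_self[OF q, of e] False by (auto simp: p_def less_le)
  show ?thesis unfolding psd_kernel_def
  proof (intro allI)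
    fix n and x :: "nat \<Rightarrow> 's" and a :: "nat \<Rightarrow> complex"
    define Q where "Q = (\<Sum>i<n. \<Sum>j<n. cnj (a i) * a j * q (x i) (x j))"
    define z where "z = (\<Sum>j<n. a j * q e (x j))"
    have z': "(\<Sum>i<n. cnj (a i) * q (x i) e) = cnj z"
      by (simp add: z_def psd_hermitian[OF q, of "x _" e])
    \<comment> \<open>The last coefficient minimizes the quadratic form.\<close>
    define b where "b = (\<lambda>i. if i < n then a i else - z / of_real p)"
    define y where "y = (\<lambda>i. if i < n then x i else e)"
    have "(\<Sum>i<Suc n. \<Sum>j<Suc n. cnj (b i) * b j * q (y i) (y j)) \<in> \<real>\<^sub>\<ge>\<^sub>0"
      by (rule q[unfolded psd_kernel_def, rule_format])
    also have "(\<Sum>i<Suc n. \<Sum>j<Suc n. cnj (b i) * b j * q (y i) (y j))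
      = Q + b n * (\<Sum>i<n. cnj (a i) * q (x i) e) + cnj (b n) * (\<Sum>j<n. a j * q e (x j))
          + cnj (b n) * b n * q e e"
    proof -
      have "(\<Sum>i<n. \<Sum>j<n. cnj (b i) * b j * q (y i) (y j)) = Q"
        by (simp add: Q_def b_def y_def)
      moreover have "(\<Sum>i<n. cnj (b i) * b n * q (y i) (y n)) = b n * (\<Sum>i<n. cnj (a i) * q (x i) e)"
        by (simp add: sum_distrib_left b_def y_def mult_ac)
      moreover have "(\<Sum>j<n. cnj (b n) * b j * q (y n) (y j)) = cnj (b n) * (\<Sum>j<n. a j * q e (x j))"
        by (simp add: sum_distrib_left b_def y_def mult_ac)
      ultimately show ?thesis by (simp add: sum.distrib y_def)
    qed
    also have "\<dots> = Q - z * cnj z / of_real p"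
    proof -
      have bn: "b n = - z / of_real p" "cnj (b n) = - cnj z / of_real p" by (simp_all add: b_def)
      have "cnj (b n) * b n * q e e = z * cnj z / of_real p"
        using p(2) by (simp add: bn p(1))
      moreover have "b n * cnj z = - (z * cnj z / of_real p)" "cnj (b n) * z = - (z * cnj z / of_real p)"
        by (simp_all add: bn)
      ultimately show ?thesis unfolding z' z_def[symmetric] by simp
    qed
    also have "\<dots> = (\<Sum>i<n. \<Sum>j<n. cnj (a i) * a j * schur q e (x i) (x j))"
    proof -
      have "z * cnj z = (\<Sum>i<n. \<Sum>j<n. (cnj (a i) * q (x i) e) * (a j * q e (x j)))"
        unfolding sum_product[symmetric] z' z_def[symmetric] by (rule mult.commute)
      then have "z * cnj z / of_real p
        = (\<Sum>i<n. \<Sum>j<n. cnj (a i) * a j * (q (x i) e * q e (x j) / q e e))"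
        by (simp add: sum_divide_distrib p(1) mult_ac)
      then show ?thesis by (simp add: Q_def schur_def right_diff_distrib sum_subtractf)
    qed
    finally show "(\<Sum>i<n. \<Sum>j<n. cnj (a i) * a j * schur q e (x i) (x j)) \<in> \<real>\<^sub>\<ge>\<^sub>0" .
  qed
qed

text \<open>Diagonal entries of the Schur complement at \<open>s\<close> are nonnegative.\<close>

lemma psd_cauchy_schwarz:
  assumes q: "psd_kernel q" shows "(cmod (q s t))\<^sup>2 \<le> Re (q s s) * Re (q t t)"
proof (cases "q s s = 0")
  case True
  then show ?thesis using psd_zero[OF q, of s t] psd_self(2)[OF q] by simp
next
  case False
  have p: "Re (q s s) > 0" using psd_self[OF q, of s] False by (metis less_le of_real_0)
  have "0 \<le> Re (schur q s t t)" using psd_self(2)[OF psd_schur[OF q]] .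
  moreover have "q t s * q s t / q s s = complex_of_real ((cmod (q s t))\<^sup>2 / Re (q s s))"
    by (subst psd_self(1)[OF q, of s], subst psd_hermitian[OF q, of t s])
      (simp add: mult.commute[of "cnj _"] flip: complex_norm_square)
  ultimately have "(cmod (q s t))\<^sup>2 / Re (q s s) \<le> Re (q t t)" by (simp add: schur_def)
  then show ?thesis using p by (simp add: divide_le_eq mult.commute)
qed

lemma schur_zero:
  assumes "psd_kernel q" shows "schur q e e t = 0"
  using psd_zero[OF assms, of e t] by (auto simp: schur_def)

primrec schur_iter :: "('s \<Rightarrow> 's \<Rightarrow> complex) \<Rightarrow> (nat \<Rightarrow> 's) \<Rightarrow> nat \<Rightarrow> 's \<Rightarrow> 's \<Rightarrow> complex" where
  "schur_iter q e 0 = q"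
| "schur_iter q e (Suc n) = schur (schur_iter q e n) (e n)"

definition cholesky :: "('s \<Rightarrow> 's \<Rightarrow> complex) \<Rightarrow> (nat \<Rightarrow> 's) \<Rightarrow> nat \<Rightarrow> 's \<Rightarrow> complex" where
  "cholesky q e n t = schur_iter q e n (e n) t / of_real (sqrt (Re (schur_iter q e n (e n) (e n))))"

lemma psd_schur_iter: "psd_kernel q \<Longrightarrow> psd_kernel (schur_iter q e n)"
  by (induction n) (auto intro: psd_schur)

text \<open>After \<open>n\<close> steps of the algorithm \<open>q\<close> is a sum of \<open>n\<close> rank one kernels and a remainder that is
  again positive semidefinite and, by the next lemma, vanishes at the first \<open>n\<close> points.\<close>

lemma cholesky_remainder:
  assumes q: "psd_kernel q"
  shows "q s t = (\<Sum>k<n. cnj (cholesky q e k s) * cholesky q e k t) + schur_iter q e n s t"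
proof (induction n)
  case (Suc n)
  let ?r = "schur_iter q e n"
  note r = psd_schur_iter[OF q, of e n]
  have "complex_of_real (sqrt (Re (?r (e n) (e n)))) * complex_of_real (sqrt (Re (?r (e n) (e n)))) = ?r (e n) (e n)"
    using psd_self[OF r, of "e n"] by (simp flip: of_real_mult)
  then have "cnj (cholesky q e n s) * cholesky q e n t = ?r s (e n) * ?r (e n) t / ?r (e n) (e n)"
    unfolding cholesky_def by (simp add: psd_hermitian[OF r, of s "e n"])
  then show ?case using Suc.IH by (simp add: schur_def)
qed simp

lemma schur_iter_zero:
  assumes q: "psd_kernel q" and k: "k < n" shows "schur_iter q e n (e k) t = 0"
  using k
proof (induction n arbitrary: t)
  case (Suc n)
  then consider "k = n" | "k < n" by linarith
  then show ?case
    by cases (simp_all add: schur_zero[OF psd_schur_iter[OF q]] schur_def[of _ _ "e k"] Suc.IH)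
qed simp

text \<open>The remainder of the Cholesky algorithm tends to zero if the sequence \<open>e\<close> is dense in the seminorm of
  \<open>q\<close>: the remainder is dominated by \<open>q\<close> and vanishes at \<open>e k\<close>, so its value at \<open>s\<close> is at most the
  square of the distance from \<open>s\<close> to \<open>e k\<close>. The predicate \<open>P\<close> records that the factors are linear
  combinations of the functions \<open>q (e k)\<close>; linearity and boundedness in the arguments are passed on in this
  way.\<close>

theorem psd_factorization:
  fixes q :: "'s \<Rightarrow> 's \<Rightarrow> complex" and e :: "nat \<Rightarrow> 's"
  assumes q: "psd_kernel q"
    and total: "\<And>s \<epsilon>. \<epsilon> > 0 \<Longrightarrow> \<exists>k. Re (q s s - q s (e k) - q (e k) s + q (e k) (e k)) < \<epsilon>"
    and P0: "\<And>k. P (q (e k))"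
    and Plin: "\<And>f g a b. P f \<Longrightarrow> P g \<Longrightarrow> P (\<lambda>t. a * f t + b * g t)"
  obtains l where "\<And>k. P (l k)" "\<And>s t. (\<lambda>k. cnj (l k s) * l k t) sums q s t"
proof
  let ?r = "schur_iter q e"
  note psd = psd_schur_iter[OF q, of e]
  have Pr: "P (?r n (e k))" for n k
  proof (induction n arbitrary: k)
    case (Suc n)
    have "?r (Suc n) (e k) = (\<lambda>t. 1 * ?r n (e k) t + (- (?r n (e k) (e n) / ?r n (e n) (e n))) * ?r n (e n) t)"
      by (intro ext) (simp add: schur_def)
    then show ?case by (simp only:) (rule Plin[OF Suc.IH Suc.IH])
  qed (simp add: P0)
  show "P (cholesky q e k)" for k
  proof -
    define c where "c = complex_of_real (sqrt (Re (?r k (e k) (e k))))"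
    have "cholesky q e k = (\<lambda>t. inverse c * ?r k (e k) t + 0 * ?r k (e k) t)"
      by (intro ext) (simp add: cholesky_def c_def divide_inverse)
    then show ?thesis by (simp only:) (rule Plin[OF Pr Pr])
  qed
  have small: "(\<lambda>n. Re (?r n s s)) \<longlonglongrightarrow> 0" for s
  proof (rule LIMSEQ_I)
    fix \<epsilon> :: real assume "\<epsilon> > 0"
    then obtain k where k: "Re (q s s - q s (e k) - q (e k) s + q (e k) (e k)) < \<epsilon>"
      using total by blast
    have "norm (Re (?r n s s) - 0) < \<epsilon>" if n: "n \<ge> Suc k" for n
    proof -
      have z: "?r n (e k) t = 0" "?r n t (e k) = 0" for t
        using schur_iter_zero[OF q, of k n e t] psd_hermitian[OF psd, of n t "e k"] n by auto
      let ?c = "\<lambda>i. cholesky q e i s - cholesky q e i (e k)"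
      have "q s s - q s (e k) - q (e k) s + q (e k) (e k) = (\<Sum>i<n. cnj (?c i) * ?c i) + ?r n s s"
      proof -
        define L where "L = cholesky q e"
        have *: "q s' t' = (\<Sum>i<n. cnj (L i s') * L i t') + ?r n s' t'" for s' t'
          unfolding L_def by (rule cholesky_remainder[OF q])
        have "(\<Sum>i<n. cnj (L i s - L i (e k)) * (L i s - L i (e k)))
          = (\<Sum>i<n. cnj (L i s) * L i s) - (\<Sum>i<n. cnj (L i s) * L i (e k))
            - (\<Sum>i<n. cnj (L i (e k)) * L i s) + (\<Sum>i<n. cnj (L i (e k)) * L i (e k))"
          by (simp add: left_diff_distrib right_diff_distrib sum_subtractf)
        then show ?thesis
          using *[of s s] *[of s "e k"] *[of "e k" s] *[of "e k" "e k"] unfolding L_def by (simp add: z)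
      qed
      also have "(\<Sum>i<n. cnj (?c i) * ?c i) = complex_of_real (\<Sum>i<n. (cmod (?c i))\<^sup>2)"
        unfolding of_real_sum complex_norm_square by (simp add: mult.commute)
      finally have "Re (?r n s s) \<le> Re (q s s - q s (e k) - q (e k) s + q (e k) (e k))"
        by (simp add: sum_nonneg)
      then show ?thesis using k psd_self(2)[OF psd, of n s] by simp
    qed
    then show "\<exists>N. \<forall>n\<ge>N. norm (Re (?r n s s) - 0) < \<epsilon>" by blast
  qed
  show "(\<lambda>k. cnj (cholesky q e k s) * cholesky q e k t) sums q s t" for s t
  proof -
    have "(\<lambda>n. sqrt (Re (?r n s s) * Re (?r n t t))) \<longlonglongrightarrow> sqrt (0 * 0)"
      by (intro tendsto_intros small)
    then have "(\<lambda>n. ?r n s t) \<longlonglongrightarrow> 0"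
      by (rule Lim_null_comparison[rotated, OF tendsto_eq_rhs])
        (auto intro!: always_eventually real_le_rsqrt psd_cauchy_schwarz psd)
    from tendsto_diff[OF tendsto_const this, of "q s t"]
    have lim: "(\<lambda>n. q s t - ?r n s t) \<longlonglongrightarrow> q s t" by simp
    show ?thesis unfolding sums_def
    proof -
      have "q s t - ?r n s t = (\<Sum>k<n. cnj (cholesky q e k s) * cholesky q e k t)" for n
        using cholesky_remainder[OF q, of s t e n] by (metis add_diff_cancel_right')
      with lim show "(\<lambda>n. \<Sum>k<n. cnj (cholesky q e k s) * cholesky q e k t) \<longlonglongrightarrow> q s t" by simp
    qed
  qed
qed

section \<open>Orthonormal bases\<close>

definition orthonormal :: "'a::chilbert_space set \<Rightarrow> bool" where
  "orthonormal E \<longleftrightarrow> (\<forall>e\<in>E. norm e = 1) \<and> (\<forall>e\<in>E. \<forall>f\<in>E. e \<noteq> f \<longrightarrow> cinner e f = 0)"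

lemma orthonormal_subset: "orthonormal E \<Longrightarrow> F \<subseteq> E \<Longrightarrow> orthonormal F"
  by (auto simp: orthonormal_def)

lemma is_onb_orthonormal: "is_onb E \<Longrightarrow> orthonormal E"
  by (simp add: is_onb_def orthonormal_def)

lemma onb_exists: "\<exists>E :: 'a::chilbert_space set. is_onb E"
proof -
  have "\<exists>M\<in>{E :: 'a set. orthonormal E}. \<forall>X\<in>{E. orthonormal E}. M \<subseteq> X \<longrightarrow> X = M"
  proof (rule subset_Zorn')
    fix C :: "'a set set" assume C: "subset.chain {E. orthonormal E} C"
    then have tot: "X \<subseteq> Y \<or> Y \<subseteq> X" if "X \<in> C" "Y \<in> C" for X Y
      using that by (auto simp: subset.chain_def)
    show "\<Union> C \<in> {E. orthonormal E}" unfolding orthonormal_def mem_Collect_eq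
    proof (intro conjI ballI impI)
      fix e f assume "e \<in> \<Union> C" "f \<in> \<Union> C" "e \<noteq> f"
      then obtain X where "X \<in> C" "e \<in> X" "f \<in> X" using tot by blast
      then show "cinner e f = 0" using C \<open>e \<noteq> f\<close> by (auto simp: subset.chain_def orthonormal_def)
    qed (use C in \<open>auto simp: subset.chain_def orthonormal_def\<close>)
  qed
  then obtain M :: "'a set" where M: "orthonormal M" and max: "\<And>X. orthonormal X \<Longrightarrow> M \<subseteq> X \<Longrightarrow> X = M"
    by blast
  have "x = 0" if x: "\<forall>e\<in>M. cinner e x = 0" for x
  proof (rule ccontr)
    assume nz: "x \<noteq> 0"
    let ?y = "(1 / norm x) *\<^sub>R x"
    have xe: "cinner x e = 0" if "e \<in> M" for e using x that by (metis cinner_commute complex_cnj_zero)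
    have "orthonormal (insert ?y M)"
      using M nz x xe by (auto simp: orthonormal_def cinner_scaleR_left cinner_scaleR_right)
    then have "?y \<in> M" using max by blast
    with x have "cinner ?y x = 0" by blast
    then show False using nz by (simp add: cinner_scaleR_left)
  qed
  then show ?thesis using M by (auto simp: is_onb_def orthonormal_def)
qed

definition proj_on :: "'a::chilbert_space set \<Rightarrow> 'a \<Rightarrow> 'a" where
  "proj_on F x = (\<Sum>e\<in>F. cinner e x *\<^sub>C e)"

lemma orthonormal_cinner:
  "orthonormal E \<Longrightarrow> e \<in> E \<Longrightarrow> f \<in> E \<Longrightarrow> cinner e f = (if e = f then 1 else 0)"
  by (auto simp: orthonormal_def cinner_eq_norm)

lemma cinner_proj_on:
  assumes "orthonormal F" "finite F"
  shows "cinner (proj_on F x) (proj_on F y) = cinner x (proj_on F y)"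
    "cinner (proj_on F x) y = cinner x (proj_on F y)"
proof -
  have *: "cinner (proj_on F x) y = cinner x (proj_on F y)" for y
    unfolding proj_on_def cinner_simps
    by (rule sum.cong) (auto simp: mult.commute intro: cinner_commute[symmetric])
  show "cinner (proj_on F x) y = cinner x (proj_on F y)" by (rule *)
  have "proj_on F (proj_on F y) = proj_on F y"
  proof -
    have "cinner e (proj_on F y) = cinner e y" if "e \<in> F" for e
      using that assms by (simp add: proj_on_def cinner_simps orthonormal_cinner if_distrib sum.delta cong: if_cong)
    then show ?thesis unfolding proj_on_def[of F "proj_on F y"] by (simp add: proj_on_def)
  qed
  then show "cinner (proj_on F x) (proj_on F y) = cinner x (proj_on F y)" by (simp add: *)
qed

lemma bounded_clinear_proj_on [simp]: "bounded_clinear (proj_on F)"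
proof -
  have "proj_on F = (\<lambda>x. \<Sum>e\<in>F. rank1 e e x)" by (simp add: proj_on_def rank1_def fun_eq_iff)
  then show ?thesis by (auto intro: bounded_clinear_sum)
qed

text \<open>Pythagoras for the projection onto the span of \<open>F\<close>; Bessel's inequality and the convergence of
  orthogonal expansions follow from it.\<close>

lemma norm_diff_proj_on:
  assumes "orthonormal F" "finite F"
  shows "(norm (x - proj_on F x))\<^sup>2 = (norm x)\<^sup>2 - (\<Sum>e\<in>F. (cmod (cinner e x))\<^sup>2)"
proof -
  have "cinner x (proj_on F x) = complex_of_real (\<Sum>e\<in>F. (cmod (cinner e x))\<^sup>2)"
    unfolding proj_on_def cinner_sum_right cinner_scaleC_right of_real_sum complex_norm_square
    by (rule sum.cong) (auto intro: cinner_commute)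
  moreover have "(norm (proj_on F x))\<^sup>2 = Re (cinner x (proj_on F x))"
    using cinner_proj_on(1)[OF assms, of x x] by (simp add: norm_sq_cinner)
  ultimately show ?thesis by (simp add: norm_diff_sq)
qed

lemma norm_proj_on_le:
  assumes "orthonormal F" "finite F" shows "norm (proj_on F x) \<le> norm x"
proof -
  have "(norm (proj_on F x))\<^sup>2 = Re (cinner x (proj_on F x))"
    using cinner_proj_on(1)[OF assms, of x x] by (simp add: norm_sq_cinner)
  also have "\<dots> \<le> norm x * norm (proj_on F x)"
    using cinner_cauchy_schwarz complex_Re_le_cmod order_trans by blast
  finally show ?thesis
    by (cases "norm (proj_on F x) = 0") (auto simp: power2_eq_square)
qed

lemma bessel:
  assumes "orthonormal F" "finite F"
  shows "(\<Sum>e\<in>F. (cmod (cinner e x))\<^sup>2) \<le> (norm x)\<^sup>2"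
  using norm_diff_proj_on[OF assms, of x] zero_le_power2[of "norm (x - proj_on F x)"] by linarith

lemma bessel_summable:
  assumes "orthonormal E" shows "(\<lambda>e. (cmod (cinner e x))\<^sup>2) summable_on E"
    "(\<Sum>\<^sub>\<infinity>e\<in>E. (cmod (cinner e x))\<^sup>2) \<le> (norm x)\<^sup>2"
proof -
  show s: "(\<lambda>e. (cmod (cinner e x))\<^sup>2) summable_on E"
    by (rule nonneg_bdd_above_summable_on)
      (use assms in \<open>auto intro!: bdd_aboveI[where M = "(norm x)\<^sup>2"] bessel intro: orthonormal_subset\<close>)
  show "(\<Sum>\<^sub>\<infinity>e\<in>E. (cmod (cinner e x))\<^sup>2) \<le> (norm x)\<^sup>2"
    by (rule infsum_le_finite_sums[OF s]) (use assms in \<open>auto intro!: bessel intro: orthonormal_subset\<close>)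
qed

lemma mult_le_half_squares: "a * b \<le> (a\<^sup>2 + b\<^sup>2) / (2::real)"
  using zero_le_power2[of "a - b"] by (simp add: power2_diff)

lemma cinner_product_summable:
  assumes E: "orthonormal E"
  shows "(\<lambda>e. cmod (cinner x e) * cmod (cinner e y)) summable_on E"
proof (rule summable_on_comparison_test)
  show "(\<lambda>e. ((cmod (cinner e x))\<^sup>2 + (cmod (cinner e y))\<^sup>2) * (1 / 2)) summable_on E"
    by (intro summable_on_cmult_left summable_on_add bessel_summable E)
  show "cmod (cinner x e) * cmod (cinner e y) \<le> ((cmod (cinner e x))\<^sup>2 + (cmod (cinner e y))\<^sup>2) * (1 / 2)" for e
    using mult_le_half_squares[of "cmod (cinner e x)" "cmod (cinner e y)"]
    by (simp add: cinner_commute[of x e])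
qed auto

text \<open>The functional \<open>y \<mapsto> \<Sum> \<langle>x|e\<rangle>\<langle>e|y\<rangle>\<close> is represented by a vector with the same coordinates as \<open>x\<close>.\<close>

theorem parseval:
  fixes E :: "'a::chilbert_space set"
  assumes E: "is_onb E"
  shows "((\<lambda>e. cinner x e * cinner e y) has_sum cinner x y) E"
proof -
  note on = is_onb_orthonormal[OF E]
  define f where "f y = (\<Sum>\<^sub>\<infinity>e\<in>E. cinner x e * cinner e y)" for y
  have s: "(\<lambda>e. cinner x e * cinner e y) summable_on E" for y
    by (rule abs_summable_summable) (use cinner_product_summable[OF on] in \<open>simp add: norm_mult\<close>)
  obtain z where z: "\<And>y. f y = cinner z y"
  proof (rule riesz_representation[of f "norm x"])
    show "f (y + y') = f y + f y'" for y y'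
      unfolding f_def by (simp add: cinner_add_right distrib_left infsum_add s)
    show "f (c *\<^sub>C y) = c * f y" for c y
      unfolding f_def by (simp add: cinner_scaleC_right mult.left_commute infsum_cmult_right' s)
    show "cmod (f y) \<le> norm x * norm y" for y
    proof -
      have "((\<lambda>F. \<Sum>e\<in>F. cinner x e * cinner e y) \<longlongrightarrow> f y) (finite_subsets_at_top E)"
        unfolding f_def by (rule infsum_tendsto[OF s])
      then have "((\<lambda>F. cmod (\<Sum>e\<in>F. cinner x e * cinner e y)) \<longlongrightarrow> cmod (f y)) (finite_subsets_at_top E)"
        by (rule tendsto_norm)
      then show ?thesis
      proof (rule tendsto_upperbound)
        show "\<forall>\<^sub>F F in finite_subsets_at_top E. cmod (\<Sum>e\<in>F. cinner x e * cinner e y) \<le> norm x * norm y"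
        proof (rule eventually_finite_subsets_at_top_weakI)
          fix F assume F: "finite F" "F \<subseteq> E"
          have "(\<Sum>e\<in>F. cinner x e * cinner e y) = cinner x (proj_on F y)"
            by (simp add: proj_on_def cinner_simps mult.commute)
          also have "cmod \<dots> \<le> norm x * norm (proj_on F y)" by (rule cinner_cauchy_schwarz)
          also have "\<dots> \<le> norm x * norm y"
            using F on by (intro mult_left_mono norm_proj_on_le) (auto intro: orthonormal_subset)
          finally show "cmod (\<Sum>e\<in>F. cinner x e * cinner e y) \<le> norm x * norm y" .
        qed
      qed simp
    qed
  qed (blast intro: that)
  have "cinner e (z - x) = 0" if e: "e \<in> E" for e
  proof -
    have "f e = (\<Sum>\<^sub>\<infinity>e'\<in>{e}. cinner x e' * cinner e' e)"
      unfolding f_def by (rule infsum_cong_neutral) (use e on in \<open>auto simp: orthonormal_cinner\<close>)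
    also have "\<dots> = cinner x e" using e on by (simp add: orthonormal_cinner)
    finally have "cinner z e = cinner x e" using z by simp
    then show ?thesis by (metis cinner_commute cinner_diff_right right_minus_eq)
  qed
  then have "z = x" using E unfolding is_onb_def by (metis right_minus_eq)
  then show ?thesis using s[of y] z[of y] by (simp add: f_def has_sum_iff)
qed

lemma parseval_norm:
  assumes E: "is_onb E" shows "((\<lambda>e. (cmod (cinner e x))\<^sup>2) has_sum (norm x)\<^sup>2) E"
proof -
  have *: "cinner x e * cinner e x = complex_of_real ((cmod (cinner e x))\<^sup>2)" for e
    by (metis cinner_commute complex_norm_square mult.commute)
  show ?thesis
    using parseval[OF E, of x x] by (simp only: * cinner_eq_norm has_sum_of_real_iff)
qed

text \<open>Each \<open>e\<close> has a nonzero coordinate in some element of a countable dense set, and each element has only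
  countably many nonzero coordinates.\<close>

lemma onb_countable:
  fixes E :: "'a::chilbert_space set"
  assumes E: "is_onb E" and sep: "separable_space (euclidean :: 'a topology)"
  shows "countable E"
proof -
  from sep obtain D :: "'a set" where D: "countable D" "closure D = UNIV"
    by (auto simp: separable_space_def)
  have "E \<subseteq> (\<Union>x\<in>D. {e\<in>E. (cmod (cinner e x))\<^sup>2 \<noteq> 0})"
  proof
    fix e assume e: "e \<in> E"
    then have e1: "norm e = 1" using E by (simp add: is_onb_def)
    obtain x where x: "x \<in> D" "dist x e < 1"
      using D(2) by (metis UNIV_I closure_approachable zero_less_one)
    have "cinner e x \<noteq> 0"
    proof
      assume "cinner e x = 0"
      then have "cinner e (e - x) = 1" by (simp add: cinner_simps cinner_eq_norm e1)
      then show False using cinner_cauchy_schwarz[of e "e - x"] x(2) e1 by (simp add: dist_norm norm_minus_commute)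
    qed
    with x e show "e \<in> (\<Union>x\<in>D. {e\<in>E. (cmod (cinner e x))\<^sup>2 \<noteq> 0})" by auto
  qed
  moreover have "countable (\<Union>x\<in>D. {e\<in>E. (cmod (cinner e x))\<^sup>2 \<noteq> 0})"
    using D(1) summable_countable_real[OF bessel_summable(1)[OF is_onb_orthonormal[OF E]]]
    by (intro countable_UN) auto
  ultimately show ?thesis by (rule countable_subset)
qed

text \<open>Turns the filter of finite subsets into a sequence; dominated convergence and normality are used
  along sequences.\<close>

definition exhaust :: "'a set \<Rightarrow> nat \<Rightarrow> 'a set" where
  "exhaust E n = {e\<in>E. to_nat_on E e < n}"

lemma exhaust_filterlim:
  assumes "countable E"
  shows "finite (exhaust E n)" "exhaust E n \<subseteq> E" "filterlim (exhaust E) (finite_subsets_at_top E) sequentially"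
proof -
  have inj: "inj_on (to_nat_on E) E" using assms by (rule inj_on_to_nat_on)
  show fin: "finite (exhaust E n)" for n
  proof (rule inj_on_finite)
    show "inj_on (to_nat_on E) (exhaust E n)" by (rule inj_on_subset[OF inj]) (auto simp: exhaust_def)
    show "to_nat_on E ` exhaust E n \<subseteq> {..<n}" by (auto simp: exhaust_def)
  qed simp
  show sub: "exhaust E n \<subseteq> E" for n by (auto simp: exhaust_def)
  show "filterlim (exhaust E) (finite_subsets_at_top E) sequentially"
    unfolding filterlim_finite_subsets_at_top
  proof (intro allI impI)
    fix X assume X: "finite X \<and> X \<subseteq> E"
    define N where "N = Suc (Max (insert 0 (to_nat_on E ` X)))"
    have "X \<subseteq> exhaust E n" if "n \<ge> N" for n
    proof
      fix x assume x: "x \<in> X"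
      then have "to_nat_on E x \<le> Max (insert 0 (to_nat_on E ` X))" using X by (intro Max_ge) auto
      then have "to_nat_on E x < n" using that unfolding N_def by linarith
      then show "x \<in> exhaust E n" using x X by (auto simp: exhaust_def)
    qed
    then show "\<forall>\<^sub>F n in sequentially. finite (exhaust E n) \<and> X \<subseteq> exhaust E n \<and> exhaust E n \<subseteq> E"
      unfolding eventually_sequentially using fin sub by blast
  qed
qed

lemma proj_exhaust_tendsto:
  assumes E: "is_onb E" and c: "countable E"
  shows "(\<lambda>n. proj_on (exhaust E n) x) \<longlonglongrightarrow> x"
proof -
  have "(\<lambda>n. \<Sum>e\<in>exhaust E n. (cmod (cinner e x))\<^sup>2) \<longlonglongrightarrow> (norm x)\<^sup>2"
    using parseval_norm[OF E, of x] exhaust_filterlim(3)[OF c] unfolding has_sum_def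
    by (rule filterlim_compose)
  from tendsto_diff[OF tendsto_const this, of "(norm x)\<^sup>2"]
  have "(\<lambda>n. (norm (x - proj_on (exhaust E n) x))\<^sup>2) \<longlonglongrightarrow> 0"
    using exhaust_filterlim[OF c] orthonormal_subset[OF is_onb_orthonormal[OF E]]
    by (simp add: norm_diff_proj_on)
  from tendsto_real_sqrt[OF this] have "(\<lambda>n. norm (x - proj_on (exhaust E n) x)) \<longlonglongrightarrow> 0" by simp
  then have "(\<lambda>n. x - proj_on (exhaust E n) x) \<longlonglongrightarrow> 0" by (rule tendsto_norm_zero_cancel)
  from tendsto_diff[OF tendsto_const this, of x] show ?thesis by simp
qed

section \<open>Positive operators and their square roots\<close>

lemma positive_op_bounded: "positive_op A \<Longrightarrow> bounded_clinear A"
  by (simp add: positive_op_def)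

lemma positive_op_psd:
  fixes A :: "'a::chilbert_space \<Rightarrow> 'a"
  assumes A: "positive_op A" shows "psd_kernel (\<lambda>x y. cinner x (A y))"
  unfolding psd_kernel_def
proof (intro allI)
  fix n and x :: "nat \<Rightarrow> 'a" and a :: "nat \<Rightarrow> complex"
  let ?v = "\<Sum>i<n. a i *\<^sub>C x i"
  have "A ?v = (\<Sum>j<n. a j *\<^sub>C A (x j))"
    by (simp add: bclin_sum[OF positive_op_bounded[OF A]] bclin_scaleC[OF positive_op_bounded[OF A]])
  then have "cinner ?v (A ?v) = (\<Sum>i<n. \<Sum>j<n. cnj (a i) * a j * cinner (x i) (A (x j)))"
    by (simp add: cinner_sum_left cinner_scaleC_left cinner_scaleC_right sum_distrib_left mult.assoc)
      (simp add: cinner_sum_right cinner_scaleC_right sum_distrib_left)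
  then show "(\<Sum>i<n. \<Sum>j<n. cnj (a i) * a j * cinner (x i) (A (x j))) \<in> \<real>\<^sub>\<ge>\<^sub>0"
    using A by (metis positive_op_def)
qed

lemma positive_op_selfadjoint:
  assumes "positive_op A" shows "cinner (A x) y = cinner x (A y)"
  using psd_hermitian[OF positive_op_psd[OF assms], of x y] by (metis cinner_commute)

lemma positive_op_Re: "positive_op A \<Longrightarrow> 0 \<le> Re (cinner x (A x))"
  by (simp add: positive_op_def complex_nonneg_Reals_iff)

lemma positive_op_real: "positive_op A \<Longrightarrow> cinner x (A x) = complex_of_real (Re (cinner x (A x)))"
  using psd_self(1)[OF positive_op_psd] .

lemma positive_op_zero:
  assumes A: "positive_op A" and z: "cinner x (A x) = 0" shows "A x = 0"
  using psd_zero[OF positive_op_psd[OF A], of x] z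
  by (intro cinner_eqI') (simp add: positive_op_selfadjoint[OF A])

text \<open>The Cauchy--Schwarz inequality of the form \<open>\<langle>x|Ay\<rangle>\<close>, applied to \<open>x\<close> and \<open>Ax\<close>.\<close>

lemma positive_op_contraction:
  assumes A: "positive_op A" and le: "\<And>x. Re (cinner x (A x)) \<le> (norm x)\<^sup>2"
  shows "norm (A x) \<le> norm x"
proof -
  have "((norm (A x))\<^sup>2)\<^sup>2 = (cmod (cinner (A x) (A x)))\<^sup>2"
    by (simp add: cinner_eq_norm norm_power)
  also have "\<dots> \<le> Re (cinner (A x) (A (A x))) * Re (cinner x (A x))"
    by (rule psd_cauchy_schwarz[OF positive_op_psd[OF A]])
  also have "\<dots> \<le> (norm (A x))\<^sup>2 * (norm x)\<^sup>2"
    by (rule mult_mono[OF le le]) (simp_all add: positive_op_Re[OF A])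
  finally have le4: "(norm (A x))\<^sup>2 * (norm (A x))\<^sup>2 \<le> (norm (A x))\<^sup>2 * (norm x)\<^sup>2"
    by (simp add: power2_eq_square)
  show ?thesis
  proof (cases "A x = 0")
    case False
    then have "0 < (norm (A x))\<^sup>2" by simp
    from mult_left_le_imp_le[OF le4 this]
    show ?thesis by (rule power2_le_imp_le) simp
  qed simp
qed

lemma positive_op_cadjoint_comp:
  assumes "bounded_clinear S" shows "positive_op (cadjoint S \<circ> S)"
  unfolding positive_op_def
  using assms by (simp add: cadjoint_right cinner_eq_norm complex_nonneg_Reals_iff)

text \<open>The Taylor coefficients of \<open>sqrt (1 - t)\<close>.\<close>

definition sqrt_coeff :: "nat \<Rightarrow> real" where
  "sqrt_coeff k = (1/2 gchoose k) * (- 1) ^ k"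

lemma gchoose_Suc_signed:
  "((a::real) gchoose Suc k) * (- 1) ^ Suc k = ((a gchoose k) * (- 1) ^ k) * ((real k - a) / (real k + 1))"
proof -
  have "real (Suc k) * (a gchoose Suc k) = (a - real k) * (a gchoose k)"
    using gbinomial_mult_1[of a k] by (simp add: left_diff_distrib)
  then have "a gchoose Suc k = (a - real k) * (a gchoose k) / (real k + 1)"
    by (simp add: field_simps)
  then have "(a gchoose Suc k) * (- 1) ^ Suc k = (a - real k) * (a gchoose k) / (real k + 1) * (- 1) ^ Suc k"
    by (rule arg_cong)
  also have "\<dots> = ((a gchoose k) * (- 1) ^ k) * ((real k - a) / (real k + 1))"
    by (simp add: minus_divide_left left_diff_distrib right_diff_distrib mult_ac)
  finally show ?thesis .
qed

lemma sqrt_coeff_0 [simp]: "sqrt_coeff 0 = 1" and sqrt_coeff_1: "sqrt_coeff (Suc 0) = - 1 / 2"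
  by (simp_all add: sqrt_coeff_def)

lemma sqrt_coeff_nonpos: "sqrt_coeff (Suc k) \<le> 0"
proof (induction k)
  case (Suc k)
  have "sqrt_coeff (Suc (Suc k)) = sqrt_coeff (Suc k) * ((real (Suc k) - 1/2) / (real (Suc k) + 1))"
    unfolding sqrt_coeff_def by (rule gchoose_Suc_signed)
  moreover have "0 \<le> (real (Suc k) - 1/2) / (real (Suc k) + 1)" by simp
  ultimately show ?case using Suc.IH by (simp only: mult_nonpos_nonneg)
qed (simp add: sqrt_coeff_1)

text \<open>The partial sums are, up to sign, binomial coefficients of \<open>- 1/2\<close>. As all coefficients but
  the first are nonpositive, this gives both absolute summability and the positivity of the square root.\<close>

lemma sqrt_coeff_sum: "0 \<le> (\<Sum>k\<le>n. sqrt_coeff k)"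
proof -
  have "0 \<le> ((- 1/2 :: real) gchoose n) * (- 1) ^ n"
  proof (induction n)
    case (Suc n)
    have "0 \<le> (real n - (- 1/2)) / (real n + 1)" by simp
    then show ?case unfolding gchoose_Suc_signed using Suc.IH by (rule mult_nonneg_nonneg[rotated])
  qed simp
  then show ?thesis
    unfolding sqrt_coeff_def gbinomial_sum_lower_neg by (simp add: mult.commute)
qed

lemma sqrt_coeff_summable: "(\<lambda>k. norm (sqrt_coeff k)) summable_on UNIV"
proof -
  have "(\<Sum>k<n. norm (sqrt_coeff k)) \<le> 2" for n
  proof (cases n)
    case (Suc m)
    have "(\<Sum>k<n. norm (sqrt_coeff k)) = 1 + (\<Sum>k<m. norm (sqrt_coeff (Suc k)))"
      unfolding Suc sum.lessThan_Suc_shift by simp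
    also have "\<dots> = 1 - (\<Sum>k<m. sqrt_coeff (Suc k))"
      using sqrt_coeff_nonpos by (simp add: sum_negf)
    also have "\<dots> = 2 - (\<Sum>k<n. sqrt_coeff k)"
      unfolding Suc sum.lessThan_Suc_shift by simp
    also have "\<dots> \<le> 2" using sqrt_coeff_sum[of m] Suc by (simp add: lessThan_Suc_atMost)
    finally show ?thesis .
  qed simp
  then have "summable (\<lambda>k. norm (sqrt_coeff k))"
    by (intro summableI_nonneg_bounded) auto
  then show ?thesis by (simp add: summable_on_UNIV_nonneg_real_iff)
qed

lemma sqrt_coeff_convolution:
  "(\<Sum>j\<le>n. sqrt_coeff j * sqrt_coeff (n - j)) = (if n = 0 then 1 else if n = 1 then - 1 else 0)"
proof -
  have "(\<Sum>j\<le>n. sqrt_coeff j * sqrt_coeff (n - j)) = (\<Sum>j\<le>n. (1/2 gchoose j) * (1/2 gchoose (n - j))) * (- 1) ^ n"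
    unfolding sqrt_coeff_def sum_distrib_right
  proof (rule sum.cong)
    fix j assume "j \<in> {..n}"
    then have "(- 1 :: real) ^ n = (- 1) ^ j * (- 1) ^ (n - j)" by (simp flip: power_add)
    then show "(1/2 gchoose j) * (- 1) ^ j * ((1/2 gchoose (n - j)) * (- 1) ^ (n - j))
      = (1/2 gchoose j) * (1/2 gchoose (n - j)) * (- 1 :: real) ^ n" by simp
  qed simp
  also have "\<dots> = (1 gchoose n) * (- 1) ^ n"
    using gbinomial_Vandermonde[of "1/2 :: real" "1/2" n] by (simp add: atLeast0AtMost)
  also have "(1 :: real) gchoose n = of_nat (1 choose n)"
    by (metis binomial_gbinomial of_nat_1)
  finally show ?thesis by (cases n) (auto simp: binomial_eq_0)
qed

text \<open>The square root of \<open>1 - B\<close>. For a contraction \<open>B\<close> the series converges in norm, because its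
  coefficients are absolutely summable.\<close>

definition sqrt_series :: "('a::chilbert_space \<Rightarrow> 'a) \<Rightarrow> 'a \<Rightarrow> 'a" where
  "sqrt_series B x = (\<Sum>\<^sub>\<infinity>k. sqrt_coeff k *\<^sub>R (B ^^ k) x)"

context
  fixes B :: "'a::chilbert_space \<Rightarrow> 'a"
  assumes B: "positive_op B" and contr: "\<And>x. Re (cinner x (B x)) \<le> (norm x)\<^sup>2"
begin

lemma iter_bounded: "bounded_clinear (B ^^ k)"
proof (induction k)
  case (Suc k)
  then show ?case unfolding funpow.simps by (rule bounded_clinear_comp[OF positive_op_bounded[OF B]])
qed simp

lemma iter_norm: "norm ((B ^^ k) x) \<le> norm x"
  by (induction k) (auto intro: order_trans positive_op_contraction[OF B contr])

lemma iter_selfadjoint: "cinner ((B ^^ k) x) y = cinner x ((B ^^ k) y)"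
  by (induction k arbitrary: x y) (auto simp: positive_op_selfadjoint[OF B] funpow_swap1)

lemma sqrt_series_has_sum: "((\<lambda>k. sqrt_coeff k *\<^sub>R (B ^^ k) x) has_sum sqrt_series B x) UNIV"
proof -
  have "(\<lambda>k. norm (sqrt_coeff k *\<^sub>R (B ^^ k) x)) summable_on UNIV"
  proof (rule summable_on_comparison_test)
    show "(\<lambda>k. norm (sqrt_coeff k) * norm x) summable_on UNIV"
      by (rule summable_on_cmult_left[OF sqrt_coeff_summable])
    show "norm (sqrt_coeff k *\<^sub>R (B ^^ k) x) \<le> norm (sqrt_coeff k) * norm x" for k
      by (simp add: mult_left_mono iter_norm)
  qed simp
  then show ?thesis unfolding sqrt_series_def by (rule has_sum_infsum[OF abs_summable_summable])
qed

lemma sqrt_series_commute: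
  assumes Q: "bounded_clinear Q" and c: "\<And>x. Q (B x) = B (Q x)"
  shows "Q (sqrt_series B x) = sqrt_series B (Q x)"
proof -
  have "Q ((B ^^ k) x) = (B ^^ k) (Q x)" for k by (induction k) (auto simp: c)
  moreover have "bounded_linear Q" using Q by (simp add: bounded_clinear_def)
  ultimately have "((\<lambda>k. sqrt_coeff k *\<^sub>R (B ^^ k) (Q x)) has_sum Q (sqrt_series B x)) UNIV"
    using has_sum_bounded_linear[OF _ sqrt_series_has_sum, of Q x] by (simp add: linear_simps)
  then show ?thesis using sqrt_series_has_sum has_sum_unique by blast
qed

lemma sqrt_series_positive: "positive_op (sqrt_series B)"
proof -
  have sums: "(\<lambda>k. sqrt_coeff k *\<^sub>R (B ^^ k) x) sums sqrt_series B x" for x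
    by (rule has_sum_imp_sums[OF sqrt_series_has_sum])
  have "bounded_clinear (sqrt_series B)"
  proof (rule bounded_clinearI)
    show "sqrt_series B (x + y) = sqrt_series B x + sqrt_series B y" for x y
    proof (rule sums_unique2[OF sums])
      show "(\<lambda>k. sqrt_coeff k *\<^sub>R (B ^^ k) (x + y)) sums (sqrt_series B x + sqrt_series B y)"
        unfolding bclin_add[OF iter_bounded] scaleR_add_right by (rule sums_add[OF sums sums])
    qed
    show "sqrt_series B (c *\<^sub>C x) = c *\<^sub>C sqrt_series B x" for c x
    proof (rule sqrt_series_commute[symmetric])
      show "bounded_clinear (\<lambda>x. c *\<^sub>C x)" using bounded_clinear_scaleC[of "\<lambda>x. x" c] by simp
    qed (simp add: bclin_scaleC[OF positive_op_bounded[OF B]])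
    show "norm (sqrt_series B x) \<le> norm x * (\<Sum>\<^sub>\<infinity>k. norm (sqrt_coeff k))" for x
    proof (rule norm_infsum_le[OF sqrt_series_has_sum])
      show "((\<lambda>k. norm x * norm (sqrt_coeff k)) has_sum norm x * (\<Sum>\<^sub>\<infinity>k. norm (sqrt_coeff k))) UNIV"
        by (intro has_sum_cmult_right has_sum_infsum sqrt_coeff_summable)
      show "norm (sqrt_coeff k *\<^sub>R (B ^^ k) x) \<le> norm x * norm (sqrt_coeff k)" for k
        using mult_left_mono[OF iter_norm[of k x], of "\<bar>sqrt_coeff k\<bar>"] by (simp add: mult.commute)
    qed
  qed
  moreover have "cinner x (sqrt_series B x) \<in> \<real>\<^sub>\<ge>\<^sub>0" for x
  proof -
    define \<beta> where "\<beta> k = Re (cinner x ((B ^^ k) x))" for k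
    have real: "cinner x ((B ^^ k) x) = complex_of_real (\<beta> k)" for k
    proof -
      have "cinner x ((B ^^ k) x) = cnj (cinner x ((B ^^ k) x))"
        by (metis cinner_commute iter_selfadjoint)
      then show ?thesis unfolding \<beta>_def by (simp add: complex_eq_iff)
    qed
    have \<beta>: "\<beta> k \<le> (norm x)\<^sup>2" for k
    proof -
      have "\<beta> k \<le> cmod (cinner x ((B ^^ k) x))" unfolding \<beta>_def by (rule complex_Re_le_cmod)
      also have "\<dots> \<le> norm x * norm ((B ^^ k) x)" by (rule cinner_cauchy_schwarz)
      also have "\<dots> \<le> norm x * norm x" by (intro mult_left_mono iter_norm) simp
      finally show ?thesis by (simp add: power2_eq_square)
    qed
    have "(\<lambda>n. cinner x (\<Sum>k\<le>n. sqrt_coeff k *\<^sub>R (B ^^ k) x)) \<longlonglongrightarrow> cinner x (sqrt_series B x)"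
      using sums[of x] unfolding sums_def_le by (intro tendsto_intros)
    moreover have "cinner x (\<Sum>k\<le>n. sqrt_coeff k *\<^sub>R (B ^^ k) x) = complex_of_real (\<Sum>k\<le>n. sqrt_coeff k * \<beta> k)" for n
      by (simp add: cinner_sum_right cinner_scaleR_right real scaleR_conv_of_real)
    ultimately have lim: "(\<lambda>n. complex_of_real (\<Sum>k\<le>n. sqrt_coeff k * \<beta> k)) \<longlonglongrightarrow> cinner x (sqrt_series B x)"
      by simp
    \<comment> \<open>Replacing \<open>\<beta> k\<close> by the larger \<open>\<beta> 0\<close> decreases the sum, as only \<open>sqrt_coeff 0\<close> is positive.\<close>
    have nonneg: "0 \<le> (\<Sum>k\<le>n. sqrt_coeff k * \<beta> k)" for n
    proof -
      have "0 \<le> (\<Sum>k\<le>n. sqrt_coeff k) * (norm x)\<^sup>2" by (simp add: sqrt_coeff_sum)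
      also have "\<dots> = (\<Sum>k\<le>n. sqrt_coeff k * (norm x)\<^sup>2)" by (rule sum_distrib_right)
      also have "\<dots> \<le> (\<Sum>k\<le>n. sqrt_coeff k * \<beta> k)"
      proof (rule sum_mono)
        fix k
        show "sqrt_coeff k * (norm x)\<^sup>2 \<le> sqrt_coeff k * \<beta> k"
        proof (cases k)
          case 0
          then show ?thesis by (simp add: \<beta>_def norm_sq_cinner)
        next
          case (Suc j)
          show ?thesis unfolding Suc
            by (rule mult_left_mono_neg[OF \<beta> sqrt_coeff_nonpos])
        qed
      qed
      finally show ?thesis .
    qed
    show ?thesis
      by (rule Lim_in_closed_set[OF closed_nonneg_Reals_complex _ _ lim])
        (simp_all add: complex_nonneg_Reals_iff nonneg del: of_real_sum of_real_mult)
  qed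
  ultimately show ?thesis by (simp add: positive_op_def)
qed

text \<open>The Cauchy product of the series with itself, by the Vandermonde identity for the coefficients.\<close>

lemma sqrt_series_square: "sqrt_series B (sqrt_series B x) = x - B x"
proof -
  define f where "f = (\<lambda>(j, k). (sqrt_coeff j * sqrt_coeff k) *\<^sub>R (B ^^ (j + k)) x)"
  have "(\<lambda>(j, k). norm (sqrt_coeff j) * norm (sqrt_coeff k)) summable_on UNIV \<times> UNIV"
  proof (rule summable_on_SigmaI[where g = "\<lambda>j. norm (sqrt_coeff j) * (\<Sum>\<^sub>\<infinity>k. norm (sqrt_coeff k))"])
    show "((\<lambda>k. case (j, k) of (j, k) \<Rightarrow> norm (sqrt_coeff j) * norm (sqrt_coeff k))
        has_sum norm (sqrt_coeff j) * (\<Sum>\<^sub>\<infinity>k. norm (sqrt_coeff k))) UNIV" for j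
      by (simp, intro has_sum_cmult_right has_sum_infsum) (use sqrt_coeff_summable in simp)
    show "(\<lambda>j. norm (sqrt_coeff j) * (\<Sum>\<^sub>\<infinity>k. norm (sqrt_coeff k))) summable_on UNIV"
      by (rule summable_on_cmult_left[OF sqrt_coeff_summable])
  qed auto
  then have "(\<lambda>p. (case p of (j, k) \<Rightarrow> norm (sqrt_coeff j) * norm (sqrt_coeff k)) * norm x) summable_on UNIV \<times> UNIV"
    by (rule summable_on_cmult_left)
  then have "(\<lambda>p. norm (f p)) summable_on UNIV \<times> UNIV"
  proof (rule summable_on_comparison_test)
    show "norm (f p) \<le> (case p of (j, k) \<Rightarrow> norm (sqrt_coeff j) * norm (sqrt_coeff k)) * norm x" for p
      by (cases p) (simp add: f_def abs_mult mult_left_mono iter_norm)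
  qed simp
  then have fs: "f summable_on UNIV \<times> UNIV" by (rule abs_summable_summable)
  have inner: "(\<Sum>\<^sub>\<infinity>k. f (j, k)) = sqrt_coeff j *\<^sub>R (B ^^ j) (sqrt_series B x)" for j
  proof (rule infsumI)
    have "bounded_linear (\<lambda>y. sqrt_coeff j *\<^sub>R (B ^^ j) y)"
      by (intro bounded_linear_const_scaleR bounded_clinear_bounded_linear iter_bounded)
    from has_sum_bounded_linear[OF this sqrt_series_has_sum, of x]
    show "((\<lambda>k. f (j, k)) has_sum sqrt_coeff j *\<^sub>R (B ^^ j) (sqrt_series B x)) UNIV"
      using bounded_clinear_bounded_linear[OF iter_bounded, of j]
      by (simp add: f_def linear_simps funpow_add)
  qed
  have bij: "bij_betw (\<lambda>(n, j). (j, n - j)) (SIGMA n:UNIV. {..n}) (UNIV \<times> (UNIV :: nat set))"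
    by (rule bij_betw_byWitness[where f' = "\<lambda>(j, k). (j + k, j)"]) auto
  have "sqrt_series B (sqrt_series B x) = (\<Sum>\<^sub>\<infinity>j. \<Sum>\<^sub>\<infinity>k. f (j, k))"
    unfolding inner by (simp add: sqrt_series_def)
  also have "\<dots> = infsum f (UNIV \<times> UNIV)"
    by (rule infsum_Sigma_banach[OF fs])
  also have "\<dots> = infsum (\<lambda>p. f ((\<lambda>(n, j). (j, n - j)) p)) (SIGMA n:UNIV. {..n})"
    by (rule infsum_reindex_bij_betw[OF bij, symmetric])
  also have "\<dots> = (\<Sum>\<^sub>\<infinity>n. \<Sum>\<^sub>\<infinity>j\<in>{..n}. f (j, n - j))"
  proof -
    have "(\<lambda>p. f ((\<lambda>(n, j). (j, n - j)) p)) summable_on (SIGMA n:UNIV. {..n})"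
      using fs unfolding summable_on_reindex_bij_betw[OF bij] .
    from infsum_Sigma_banach[OF this] show ?thesis by simp
  qed
  also have "\<dots> = (\<Sum>\<^sub>\<infinity>n. (if n = 0 then 1 else if n = 1 then - 1 else 0) *\<^sub>R (B ^^ n) x)"
    by (rule infsum_cong) (simp add: f_def flip: scaleR_sum_left sqrt_coeff_convolution)
  also have "\<dots> = (\<Sum>\<^sub>\<infinity>n\<in>{0, 1::nat}. (if n = 0 then 1 else if n = 1 then - 1 else 0) *\<^sub>R (B ^^ n) x)"
    by (rule infsum_cong_neutral) auto
  also have "\<dots> = x - B x" by simp
  finally show ?thesis .
qed

end

text \<open>Scaling reduces this to \<open>A = 1 - B\<close> with a positive contraction \<open>B\<close>. Being a limit of polynomials in
  \<open>A\<close>, the square root commutes with everything that commutes with \<open>A\<close>; uniqueness depends on this.\<close>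

theorem positive_sqrt_exists:
  fixes A :: "'a::chilbert_space \<Rightarrow> 'a"
  assumes A: "positive_op A"
  obtains P where "positive_op P" "P \<circ> P = A"
    "\<And>Q. bounded_clinear Q \<Longrightarrow> Q \<circ> A = A \<circ> Q \<Longrightarrow> Q \<circ> P = P \<circ> Q"
proof -
  note bA = positive_op_bounded[OF A]
  \<comment> \<open>Adding \<open>1\<close> makes the scaling factor positive even for \<open>A = 0\<close>.\<close>
  define c where "c = onorm A + 1"
  have c: "c > 0" using bclin_onorm_pos[OF bA] by (simp add: c_def)
  define B where "B = (\<lambda>x. x - complex_of_real (1 / c) *\<^sub>C A x)"
  have BA: "A x = complex_of_real c *\<^sub>C (x - B x)" for x
    using c by (simp add: B_def scaleC_scaleC)
  have form: "cinner x (B x) = complex_of_real ((norm x)\<^sup>2 - Re (cinner x (A x)) / c)" for x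
    by (subst of_real_diff, subst of_real_divide, subst positive_op_real[OF A, symmetric])
      (simp add: B_def cinner_diff_right cinner_scaleC_right cinner_eq_norm)
  have le: "Re (cinner x (A x)) / c \<le> (norm x)\<^sup>2" for x
  proof -
    have "Re (cinner x (A x)) \<le> norm x * norm (A x)"
      using cinner_cauchy_schwarz complex_Re_le_cmod order_trans by blast
    also have "\<dots> \<le> norm x * (onorm A * norm x)"
      by (intro mult_left_mono bclin_bound[OF bA]) simp
    also have "\<dots> \<le> c * (norm x)\<^sup>2" by (simp add: c_def power2_eq_square algebra_simps)
    finally show ?thesis using c by (simp add: divide_le_eq mult.commute)
  qed
  have B: "positive_op B" unfolding positive_op_def
  proof (intro conjI allI)
    show "bounded_clinear B" unfolding B_def
      by (intro bounded_clinear_diff bounded_clinear_scaleC bA bounded_clinear_id)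
    show "cinner x (B x) \<in> \<real>\<^sub>\<ge>\<^sub>0" for x using le[of x] by (simp add: form complex_nonneg_Reals_iff)
  qed
  have Bc: "Re (cinner x (B x)) \<le> (norm x)\<^sup>2" for x
    using positive_op_Re[OF A, of x] c by (simp add: form)
  note R = sqrt_series_positive[OF B Bc]
  define P where "P = (\<lambda>x. complex_of_real (sqrt c) *\<^sub>C sqrt_series B x)"
  show ?thesis
  proof
    show "positive_op P" unfolding positive_op_def
    proof (intro conjI allI)
      show "bounded_clinear P" unfolding P_def
        by (intro bounded_clinear_scaleC positive_op_bounded[OF R])
      show "cinner x (P x) \<in> \<real>\<^sub>\<ge>\<^sub>0" for x
        using positive_op_Re[OF R, of x] positive_op_real[OF R, of x] c
        by (simp add: P_def cinner_scaleC_right complex_nonneg_Reals_iff complex_eq_iff)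
    qed
    show "P \<circ> P = A"
    proof
      fix x
      have "(P \<circ> P) x = complex_of_real (sqrt c * sqrt c) *\<^sub>C (x - B x)"
        unfolding of_real_mult by (simp add: P_def bclin_scaleC[OF positive_op_bounded[OF R]] scaleC_scaleC
            sqrt_series_square[OF B Bc])
      then show "(P \<circ> P) x = A x" using c BA by simp
    qed
    fix Q :: "'a \<Rightarrow> 'a" assume Q: "bounded_clinear Q" and QA: "Q \<circ> A = A \<circ> Q"
    have "Q (B x) = B (Q x)" for x
      using fun_cong[OF QA, of x] by (simp add: B_def bclin_diff[OF Q] bclin_scaleC[OF Q])
    from sqrt_series_commute[OF B Bc Q this] show "Q \<circ> P = P \<circ> Q"
      by (intro ext) (simp add: P_def bclin_scaleC[OF Q])
  qed
qed

text \<open>Two commuting square roots \<open>S\<close> and \<open>R\<close> satisfy \<open>(S + R)(S - R) = 0\<close>. On the range of \<open>S - R\<close> both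
  positive operators therefore vanish, and so does \<open>(S - R)\<^sup>2\<close>.\<close>

lemma positive_sqrt_unique:
  fixes P :: "'a::chilbert_space \<Rightarrow> 'a"
  assumes P: "positive_op P" and Q: "positive_op Q" and PQ: "P \<circ> P = Q \<circ> Q"
  shows "P = Q"
proof -
  have A: "positive_op (Q \<circ> Q)" unfolding positive_op_def
    using Q by (auto simp: positive_op_bounded positive_op_selfadjoint[symmetric] cinner_eq_norm complex_nonneg_Reals_iff)
  obtain R where R: "positive_op R" "R \<circ> R = Q \<circ> Q"
    and comm: "\<And>S. bounded_clinear S \<Longrightarrow> S \<circ> (Q \<circ> Q) = (Q \<circ> Q) \<circ> S \<Longrightarrow> S \<circ> R = R \<circ> S"
    using positive_sqrt_exists[OF A] by blast
  have eq: "S = R" if S: "positive_op S" and SS: "S \<circ> S = Q \<circ> Q" for S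
  proof
    fix x
    note bS = positive_op_bounded[OF S] and bR = positive_op_bounded[OF R(1)]
    have "S \<circ> (Q \<circ> Q) = (Q \<circ> Q) \<circ> S" unfolding SS[symmetric] by (simp add: o_assoc)
    then have SR: "S (R x) = R (S x)" for x using comm[OF bS] by (metis comp_apply)
    have S2: "S (S x) = R (R x)" for x using SS R(2) by (metis comp_apply)
    define y where "y = S x - R x"
    have "S y + R y = 0"
      by (simp add: y_def bclin_diff[OF bS] bclin_diff[OF bR] SR S2)
    then have "cinner y (S y) + cinner y (R y) = 0"
      by (metis cinner_add_right cinner_zero_right)
    then have "Re (cinner y (S y)) + Re (cinner y (R y)) = 0"
      by (metis plus_complex.sel(1) zero_complex.sel(1))
    then have "Re (cinner y (S y)) = 0" "Re (cinner y (R y)) = 0"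
      using positive_op_Re[OF S, of y] positive_op_Re[OF R(1), of y] by linarith+
    then have "S y = 0" "R y = 0"
      using positive_op_real[OF S, of y] positive_op_real[OF R(1), of y]
      by (auto intro: positive_op_zero[OF S] positive_op_zero[OF R(1)])
    then have "cinner y y = 0"
      unfolding y_def cinner_diff_left[of "S x"] positive_op_selfadjoint[OF S] positive_op_selfadjoint[OF R(1)]
      by simp
    then show "S x = R x" by (simp add: y_def)
  qed
  from eq[OF P PQ] eq[OF Q refl] show ?thesis by simp
qed

lemma abs_op_props:
  assumes "bounded_clinear T"
  shows "positive_op (abs_op T) \<and> abs_op T \<circ> abs_op T = cadjoint T \<circ> T"
proof -
  obtain P where "positive_op P" "P \<circ> P = cadjoint T \<circ> T"
    using positive_sqrt_exists[OF positive_op_cadjoint_comp[OF assms]] by blast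
  then show ?thesis unfolding abs_op_def
    by (intro theI[of "\<lambda>P. positive_op P \<and> P \<circ> P = cadjoint T \<circ> T" P]) (auto intro: positive_sqrt_unique)
qed

lemma norm_abs_op:
  assumes T: "bounded_clinear T" shows "norm (abs_op T x) = norm (T x)"
proof -
  from abs_op_props[OF T] have p: "positive_op (abs_op T)" and sq: "abs_op T (abs_op T x) = cadjoint T (T x)"
    by (auto simp: fun_eq_iff)
  have "(norm (abs_op T x))\<^sup>2 = (norm (T x))\<^sup>2"
    by (simp add: norm_sq_cinner positive_op_selfadjoint[OF p] sq cadjoint_right[OF T])
  then show ?thesis by (rule power2_eq_imp_eq) auto
qed

lemma abs_op_positive:
  assumes A: "positive_op A" shows "abs_op A = A"
proof (rule positive_sqrt_unique)
  have "cadjoint A = A"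
    by (rule cadjoint_unique) (simp_all add: positive_op_bounded[OF A] positive_op_selfadjoint[OF A])
  then show "abs_op A \<circ> abs_op A = A \<circ> A" using abs_op_props[OF positive_op_bounded[OF A]] by simp
qed (use A abs_op_props[OF positive_op_bounded[OF A]] in auto)

section \<open>Trace class operators and the ultraweak topology\<close>

lemma separable_dense_sequence:
  assumes "separable_space (euclidean :: 'a::metric_space topology)"
  obtains e :: "nat \<Rightarrow> 'a::metric_space" where "\<And>x \<epsilon>. \<epsilon> > 0 \<Longrightarrow> \<exists>k. dist (e k) x < \<epsilon>"
proof -
  from assms obtain D :: "'a set" where D: "countable D" "closure D = UNIV"
    by (auto simp: separable_space_def)
  then have "D \<noteq> {}" by auto
  show ?thesis
  proof (rule that[of "from_nat_into D"])
    fix x :: 'a and \<epsilon> :: real assume "\<epsilon> > 0"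
    then obtain y where "y \<in> D" "dist y x < \<epsilon>"
      using D(2) by (metis UNIV_I closure_approachable)
    then show "\<exists>k. dist (from_nat_into D k) x < \<epsilon>"
      using from_nat_into_surj[OF D(1)] by metis
  qed
qed

lemma rank1_apply: "rank1 \<eta> \<xi> x = cinner \<xi> x *\<^sub>C \<eta>"
  by (simp add: rank1_def)

lemma positive_rank1: "positive_op (rank1 \<phi> \<phi>)"
proof -
  have "cinner x (rank1 \<phi> \<phi> x) = complex_of_real ((cmod (cinner \<phi> x))\<^sup>2)" for x
    unfolding rank1_apply cinner_scaleC_right complex_norm_square by (metis cinner_commute)
  then show ?thesis by (simp add: positive_op_def complex_nonneg_Reals_iff)
qed

lemma trace_class_rank1:
  fixes \<phi> :: "'a::chilbert_space"
  shows "trace_class (rank1 \<phi> \<phi>)"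
proof -
  obtain E :: "'a set" where E: "is_onb E" using onb_exists by blast
  have "(\<lambda>e. cinner \<phi> e * cinner e \<phi>) summable_on E"
    using parseval[OF E] by (auto simp: summable_on_def)
  then have "(\<lambda>e. cinner e (abs_op (rank1 \<phi> \<phi>) e)) summable_on E"
    by (simp add: abs_op_positive[OF positive_rank1] rank1_apply cinner_scaleC_right)
  with E show ?thesis by (auto simp: trace_class_def)
qed

lemma tr_rank1_comp:
  fixes A :: "'a::chilbert_space \<Rightarrow> 'a"
  assumes A: "bounded_clinear A" shows "tr (rank1 \<phi> \<psi> \<circ> A) = cinner \<psi> (A \<phi>)"
proof -
  have E: "is_onb (SOME E :: 'a set. is_onb E)" using onb_exists by (rule someI_ex)
  have "tr (rank1 \<phi> \<psi> \<circ> A) = (\<Sum>\<^sub>\<infinity>e\<in>(SOME E. is_onb E). cinner (cadjoint A \<psi>) e * cinner e \<phi>)"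
    by (simp add: tr_def rank1_apply cinner_scaleC_right cadjoint_exists[OF A])
  also have "\<dots> = cinner (cadjoint A \<psi>) \<phi>"
    by (rule infsumI[OF parseval[OF E]])
  finally show ?thesis by (simp add: cadjoint_exists[OF A])
qed

lemma sum_has_sum_finite:
  fixes f :: "'i \<Rightarrow> 'a \<Rightarrow> 'b::real_normed_vector"
  assumes "\<And>i. i \<in> I \<Longrightarrow> (f i has_sum s i) A"
  shows "((\<lambda>x. \<Sum>i\<in>I. f i x) has_sum (\<Sum>i\<in>I. s i)) A"
  using assms by (induction I rule: infinite_finite_induct) (auto intro: has_sum_add)

text \<open>The Cholesky factors of \<open>|T|\<close> are vectors \<open>l k = |T| (g k)\<close>. As \<open>|T| x\<close> and \<open>T x\<close> have the same
  norm, replacing \<open>|T|\<close> by \<open>T\<close> throughout gives an expansion of \<open>T\<close>, with \<open>m k = T (g k)\<close>, without a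
  polar decomposition. The sum of the squared norms is the trace of \<open>|T|\<close>.\<close>

lemma trace_class_nuclear:
  fixes T :: "'a::chilbert_space \<Rightarrow> 'a"
  assumes sep: "separable_space (euclidean :: 'a topology)" and T: "trace_class T"
  obtains l m :: "nat \<Rightarrow> 'a" where "summable (\<lambda>k. (norm (l k))\<^sup>2)" "\<And>k. norm (m k) = norm (l k)"
    "\<And>y. (\<lambda>k. cinner (l k) y *\<^sub>C m k) sums T y"
proof -
  from T obtain E where bT: "bounded_clinear T" and E: "is_onb E"
    and s: "(\<lambda>e. cinner e (abs_op T e)) summable_on E" by (auto simp: trace_class_def)
  define P where "P = abs_op T"
  have P: "positive_op P" using abs_op_props[OF bT] by (simp add: P_def)
  note bP = positive_op_bounded[OF P]
  obtain e :: "nat \<Rightarrow> 'a" where e: "\<And>x \<epsilon>. \<epsilon> > 0 \<Longrightarrow> \<exists>k. dist (e k) x < \<epsilon>"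
    using separable_dense_sequence[OF sep] by blast
  let ?q = "\<lambda>x y. cinner x (P y)"
  obtain l' where l': "\<And>k. \<exists>g. \<forall>y. l' k y = cinner (P g) y"
    and sums: "\<And>x y. (\<lambda>k. cnj (l' k x) * l' k y) sums ?q x y"
  proof (rule psd_factorization[of ?q e "\<lambda>f. \<exists>g. \<forall>y. f y = cinner (P g) y"])
    show "psd_kernel ?q" by (rule positive_op_psd[OF P])
    show "\<exists>k. Re (?q s s - ?q s (e k) - ?q (e k) s + ?q (e k) (e k)) < \<epsilon>" if "\<epsilon> > 0" for s \<epsilon>
    proof -
      define c where "c = onorm P + 1"
      have c: "c > 0" using bclin_onorm_pos[OF bP] by (simp add: c_def)
      have "sqrt (\<epsilon> / c) > 0" using that c by simp
      then obtain k where k: "dist (e k) s < sqrt (\<epsilon> / c)" using e by blast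
      let ?v = "s - e k"
      have "?q s s - ?q s (e k) - ?q (e k) s + ?q (e k) (e k) = cinner ?v (P ?v)"
        by (simp add: cinner_diff_left cinner_diff_right bclin_diff[OF bP])
      also have "Re \<dots> \<le> norm ?v * norm (P ?v)"
        using cinner_cauchy_schwarz complex_Re_le_cmod order_trans by blast
      also have "\<dots> \<le> norm ?v * (onorm P * norm ?v)" by (intro mult_left_mono bclin_bound bP) simp
      also have "\<dots> \<le> c * (norm ?v)\<^sup>2" by (simp add: c_def power2_eq_square distrib_right)
      also have "\<dots> < c * (sqrt (\<epsilon> / c))\<^sup>2"
        using k c by (intro mult_strict_left_mono power_strict_mono) (auto simp: dist_norm norm_minus_commute)
      also have "\<dots> = \<epsilon>" using c that by simp
      finally show ?thesis by blast
    qed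
    show "\<exists>g. \<forall>y. cinner (e k) (P y) = cinner (P g) y" for k
      by (rule exI[of _ "e k"]) (simp add: positive_op_selfadjoint[OF P])
    show "\<exists>g. \<forall>y. a * f1 y + b * f2 y = cinner (P g) y"
      if f: "\<exists>g. \<forall>y. f1 y = cinner (P g) y" "\<exists>g. \<forall>y. f2 y = cinner (P g) y" for f1 f2 a b
    proof -
      from f obtain g1 g2 where "\<forall>y. f1 y = cinner (P g1) y" "\<forall>y. f2 y = cinner (P g2) y" by blast
      then show ?thesis
        by (intro exI[of _ "cnj a *\<^sub>C g1 + cnj b *\<^sub>C g2"])
          (simp add: bclin_add[OF bP] bclin_scaleC[OF bP] cinner_add_left cinner_scaleC_left)
    qed
  qed (blast intro: that)
  from l' obtain g where g: "\<And>k y. l' k y = cinner (P (g k)) y" by metis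
  define l where "l k = P (g k)" for k
  define m where "m k = T (g k)" for k
  have lsums: "(\<lambda>k. cinner x (l k) * cinner (l k) y) sums cinner x (P y)" for x y
    using sums[of x y] by (simp add: g l_def flip: cinner_commute)
  have nm: "norm (m k) = norm (l k)" for k
    by (simp add: l_def m_def P_def norm_abs_op[OF bT])
  have bound: "(\<Sum>k<n. (norm (l k))\<^sup>2) \<le> (\<Sum>\<^sub>\<infinity>e\<in>E. Re (cinner e (P e)))" for n
  proof (rule has_sum_mono)
    show "((\<lambda>e. \<Sum>k<n. (cmod (cinner e (l k)))\<^sup>2) has_sum (\<Sum>k<n. (norm (l k))\<^sup>2)) E"
      by (intro sum_has_sum_finite parseval_norm E)
    show "((\<lambda>e. Re (cinner e (P e))) has_sum (\<Sum>\<^sub>\<infinity>e\<in>E. Re (cinner e (P e)))) E"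
      using s by (intro has_sum_infsum summable_on_Re) (simp add: P_def)
    show "(\<Sum>k<n. (cmod (cinner e (l k)))\<^sup>2) \<le> Re (cinner e (P e))" for e
    proof -
      have *: "cinner e (l k) * cinner (l k) e = complex_of_real ((cmod (cinner e (l k)))\<^sup>2)" for k
        by (metis cinner_commute complex_norm_square)
      have "(\<lambda>k. Re (complex_of_real ((cmod (cinner e (l k)))\<^sup>2))) sums Re (cinner e (P e))"
        using sums_Re[OF lsums[of e e]] unfolding * .
      then have "(\<lambda>k. (cmod (cinner e (l k)))\<^sup>2) sums Re (cinner e (P e))" by simp
      then show ?thesis
        using sum_le_suminf[of "\<lambda>k. (cmod (cinner e (l k)))\<^sup>2" "{..<n}"] by (simp add: sums_iff)
    qed
  qed
  then have sl: "summable (\<lambda>k. (norm (l k))\<^sup>2)"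
    by (intro summableI_nonneg_bounded) auto
  have "(\<lambda>k. cinner (l k) y *\<^sub>C m k) sums T y" for y
  proof -
    have "summable (\<lambda>k. norm (cinner (l k) y *\<^sub>C l k))"
    proof (rule summable_comparison_test')
      show "summable (\<lambda>k. (norm (l k))\<^sup>2 * norm y)" by (rule summable_mult2[OF sl])
      show "norm (norm (cinner (l k) y *\<^sub>C l k)) \<le> (norm (l k))\<^sup>2 * norm y" for k
        using mult_right_mono[OF cinner_cauchy_schwarz[of "l k" y], of "norm (l k)"]
        by (simp add: norm_scaleC power2_eq_square mult_ac)
    qed
    then have "summable (\<lambda>k. cinner (l k) y *\<^sub>C l k)" by (rule summable_norm_cancel)
    then obtain z where z: "(\<lambda>k. cinner (l k) y *\<^sub>C l k) sums z" by (auto simp: summable_def)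
    have "cinner x z = cinner x (P y)" for x
    proof -
      have "(\<lambda>k. cinner x (cinner (l k) y *\<^sub>C l k)) sums cinner x z"
        by (rule bounded_linear.sums[OF bounded_bilinear.bounded_linear_right[OF bounded_bilinear_cinner] z])
      then have "(\<lambda>k. cinner x (l k) * cinner (l k) y) sums cinner x z"
        by (simp add: cinner_scaleC_right mult.commute)
      with lsums[of x y] show ?thesis by (rule sums_unique2[symmetric])
    qed
    then have "z = P y" by (rule cinner_eqI)
    have diff: "norm ((\<Sum>k<n. cinner (l k) y *\<^sub>C m k) - T y) = norm ((\<Sum>k<n. cinner (l k) y *\<^sub>C l k) - P y)" for n
    proof -
      have "(\<Sum>k<n. cinner (l k) y *\<^sub>C m k) - T y = T ((\<Sum>k<n. cinner (l k) y *\<^sub>C g k) - y)"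
        by (simp add: m_def bclin_diff[OF bT] bclin_sum[OF bT] bclin_scaleC[OF bT])
      moreover have "(\<Sum>k<n. cinner (l k) y *\<^sub>C l k) - P y = P ((\<Sum>k<n. cinner (l k) y *\<^sub>C g k) - y)"
        by (simp add: l_def bclin_diff[OF bP] bclin_sum[OF bP] bclin_scaleC[OF bP])
      ultimately show ?thesis by (simp add: P_def norm_abs_op[OF bT])
    qed
    have "(\<lambda>n. (\<Sum>k<n. cinner (l k) y *\<^sub>C l k) - P y) \<longlonglongrightarrow> 0"
      using z unfolding \<open>z = P y\<close> sums_def by (simp add: LIM_zero_iff)
    then have "(\<lambda>n. norm ((\<Sum>k<n. cinner (l k) y *\<^sub>C l k) - P y)) \<longlonglongrightarrow> 0"
      by (rule tendsto_norm_zero)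
    then have "(\<lambda>n. norm ((\<Sum>k<n. cinner (l k) y *\<^sub>C m k) - T y)) \<longlonglongrightarrow> 0"
      by (simp only: diff)
    then have "(\<lambda>n. (\<Sum>k<n. cinner (l k) y *\<^sub>C m k) - T y) \<longlonglongrightarrow> 0"
      by (rule tendsto_norm_zero_cancel)
    then show ?thesis unfolding sums_def by (simp add: LIM_zero_iff)
  qed
  with sl nm show ?thesis using that by blast
qed

text \<open>Summing the expansion over the basis first is Parseval's identity for each term.\<close>

lemma tr_nuclear:
  fixes T :: "'a::chilbert_space \<Rightarrow> 'a"
  assumes l: "summable (\<lambda>k. (norm (l k))\<^sup>2)" and m: "\<And>k. norm (m k) = norm (l k)"
    and T: "\<And>y. (\<lambda>k. cinner (l k) y *\<^sub>C m k) sums T y" and b: "bounded_clinear b"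
  shows "(\<lambda>k. cinner (l k) (b (m k))) sums tr (T \<circ> b)"
proof -
  define E where "E = (SOME E :: 'a set. is_onb E)"
  have E: "is_onb E" unfolding E_def using onb_exists by (rule someI_ex)
  note on = is_onb_orthonormal[OF E]
  define l' where "l' k = cadjoint b (l k)" for k
  define f where "f = (\<lambda>k e. cinner (l' k) e * cinner e (m k))"
  have fk: "(f k has_sum cinner (l k) (b (m k))) E" for k
    using parseval[OF E, of "l' k" "m k"] by (simp add: f_def l'_def cadjoint_exists[OF b])
  have le: "(\<Sum>\<^sub>\<infinity>e\<in>E. norm (f k e)) \<le> ((onorm (cadjoint b))\<^sup>2 + 1) * (norm (l k))\<^sup>2" for k
  proof -
    have s1: "((\<lambda>e. (cmod (cinner e (l' k)))\<^sup>2 + (cmod (cinner e (m k)))\<^sup>2) has_sum ((norm (l' k))\<^sup>2 + (norm (m k))\<^sup>2)) E"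
      by (intro has_sum_add parseval_norm E)
    have s2: "((\<lambda>e. norm (f k e)) has_sum (\<Sum>\<^sub>\<infinity>e\<in>E. norm (f k e))) E"
      using cinner_product_summable[OF on, of "l' k" "m k"] by (intro has_sum_infsum) (simp add: f_def norm_mult)
    have "(\<Sum>\<^sub>\<infinity>e\<in>E. norm (f k e)) \<le> (norm (l' k))\<^sup>2 + (norm (m k))\<^sup>2"
    proof (rule has_sum_mono[OF s2 s1])
      fix e
      have "norm (f k e) = cmod (cinner e (l' k)) * cmod (cinner e (m k))"
        by (simp add: f_def norm_mult cinner_commute[of "l' k" e])
      then show "norm (f k e) \<le> (cmod (cinner e (l' k)))\<^sup>2 + (cmod (cinner e (m k)))\<^sup>2"
        using mult_le_half_squares[of "cmod (cinner e (l' k))" "cmod (cinner e (m k))"]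
        by (rule ord_eq_le_trans[OF _ order_trans]) simp
    qed
    also have "(norm (l' k))\<^sup>2 \<le> (onorm (cadjoint b) * norm (l k))\<^sup>2"
      unfolding l'_def by (intro power_mono bclin_bound bounded_clinear_cadjoint b) simp
    finally show ?thesis by (simp add: m power_mult_distrib distrib_right)
  qed
  have "(\<lambda>(k, e). norm (f k e)) summable_on UNIV \<times> E"
  proof (rule summable_on_SigmaI[where g = "\<lambda>k. \<Sum>\<^sub>\<infinity>e\<in>E. norm (f k e)"])
    show "((\<lambda>e. case (k, e) of (k, e) \<Rightarrow> norm (f k e)) has_sum (\<Sum>\<^sub>\<infinity>e\<in>E. norm (f k e))) E" for k
      using cinner_product_summable[OF on, of "l' k" "m k"] by (simp, intro has_sum_infsum) (simp add: f_def norm_mult)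
    have "(\<lambda>k. ((onorm (cadjoint b))\<^sup>2 + 1) * (norm (l k))\<^sup>2) summable_on UNIV"
      unfolding summable_on_UNIV_nonneg_real_iff[OF mult_nonneg_nonneg[OF add_nonneg_nonneg[OF zero_le_power2 zero_le_one] zero_le_power2]]
      by (rule summable_mult[OF l])
    then show "(\<lambda>k. \<Sum>\<^sub>\<infinity>e\<in>E. norm (f k e)) summable_on UNIV"
      by (rule summable_on_comparison_test) (auto simp: le infsum_nonneg)
  qed auto
  then have "(\<lambda>p. norm ((\<lambda>(k, e). f k e) p)) summable_on UNIV \<times> E"
    by (rule summable_on_cong[THEN iffD1, rotated]) auto
  then have fs: "(\<lambda>(k, e). f k e) summable_on UNIV \<times> E" by (rule abs_summable_summable)
  have "(\<Sum>\<^sub>\<infinity>k. f k e) = cinner e (T (b e))" if e: "e \<in> E" for e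
  proof -
    have "(\<lambda>k. f k e) sums cinner e (T (b e))"
      using bounded_linear.sums[OF bounded_bilinear.bounded_linear_right[OF bounded_bilinear_cinner] T[of "b e"], of e]
      by (simp add: f_def l'_def cadjoint_exists[OF b] cinner_scaleC_right)
    moreover have "(\<lambda>k. f k e) summable_on UNIV"
    proof -
      have "(\<lambda>(e, k). f k e) summable_on E \<times> UNIV" using fs by (subst summable_on_swap) (simp add: case_prod_beta)
      then show ?thesis using summable_on_SigmaD1[of "\<lambda>e k. f k e" E "\<lambda>_. UNIV" e] e by simp
    qed
    ultimately show ?thesis using has_sum_imp_sums has_sum_infsum sums_unique2 by blast
  qed
  then have "tr (T \<circ> b) = (\<Sum>\<^sub>\<infinity>e\<in>E. \<Sum>\<^sub>\<infinity>k. f k e)"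
    unfolding tr_def E_def[symmetric] by (intro infsum_cong) simp
  also have "\<dots> = (\<Sum>\<^sub>\<infinity>k. \<Sum>\<^sub>\<infinity>e\<in>E. f k e)"
    by (rule infsum_swap_banach[OF fs, symmetric])
  also have "\<dots> = (\<Sum>\<^sub>\<infinity>k. cinner (l k) (b (m k)))"
    by (simp add: infsumI[OF fk])
  finally have tr: "tr (T \<circ> b) = (\<Sum>\<^sub>\<infinity>k. cinner (l k) (b (m k)))" .
  have "(\<lambda>k. \<Sum>\<^sub>\<infinity>e\<in>E. f k e) summable_on UNIV"
    by (rule summable_on_Sigma_banach[OF fs])
  then have "(\<lambda>k. cinner (l k) (b (m k))) summable_on UNIV"
    by (simp add: infsumI[OF fk])
  from has_sum_infsum[OF this] show ?thesis unfolding tr[symmetric] by (rule has_sum_imp_sums)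
qed

text \<open>The terms of the expansion of the trace are dominated by \<open>C \<parallel>l\<^sub>k\<parallel>\<^sup>2\<close>.\<close>

lemma tr_bounded_weak_limit:
  fixes T :: "'a::chilbert_space \<Rightarrow> 'a"
  assumes sep: "separable_space (euclidean :: 'a topology)" and T: "trace_class T"
    and bn: "\<And>n. bounded_clinear (b n)" and b: "bounded_clinear b'"
    and C: "\<And>n x. norm (b n x) \<le> C * norm x"
    and lim: "\<And>x y. (\<lambda>n. cinner x (b n y)) \<longlonglongrightarrow> cinner x (b' y)"
  shows "(\<lambda>n. tr (T \<circ> b n)) \<longlonglongrightarrow> tr (T \<circ> b')"
proof -
  obtain l m where l: "summable (\<lambda>k. (norm (l k))\<^sup>2)" and m: "\<And>k. norm (m k) = norm (l k)"
    and Ts: "\<And>y. (\<lambda>k. cinner (l k) y *\<^sub>C m k) sums T y"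
    using trace_class_nuclear[OF sep T] by blast
  note tr = tr_nuclear[OF l m Ts]
  have "((\<lambda>n. \<Sum>k. cinner (l k) (b n (m k))) \<longlongrightarrow> (\<Sum>k. cinner (l k) (b' (m k)))) sequentially"
  proof (rule tannerys_theorem[THEN conjunct2, THEN conjunct2])
    show "summable (\<lambda>k. C * (norm (l k))\<^sup>2)" by (rule summable_mult[OF l])
    have "cmod (cinner (l k) (b n (m k))) \<le> C * (norm (l k))\<^sup>2" for k n
    proof -
      have "cmod (cinner (l k) (b n (m k))) \<le> norm (l k) * norm (b n (m k))" by (rule cinner_cauchy_schwarz)
      also have "\<dots> \<le> norm (l k) * (C * norm (m k))" by (intro mult_left_mono C) simp
      finally show ?thesis by (simp add: m power2_eq_square mult_ac)
    qed
    then show "\<forall>\<^sub>F (k, n) in at_top \<times>\<^sub>F sequentially. norm (cinner (l k) (b n (m k))) \<le> C * (norm (l k))\<^sup>2"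
      by (intro always_eventually) auto
  qed (auto intro: lim)
  then show ?thesis using tr[OF bn] tr[OF b] by (simp add: sums_iff)
qed

text \<open>Bounded weakly convergent sequences converge ultraweakly, and \<open>c \<mapsto> \<langle>\<phi>|c \<phi>\<rangle>\<close> is the ultraweakly
  continuous functional given by \<open>|\<phi>\<rangle>\<langle>\<phi>|\<close>.\<close>

lemma normal_cp_map_tendsto:
  fixes \<Phi> :: "('k::chilbert_space \<Rightarrow> 'k) \<Rightarrow> 'v::chilbert_space \<Rightarrow> 'v"
  assumes sep: "separable_space (euclidean :: 'k topology)" and \<Phi>: "normal_cp_map \<Phi>"
    and bn: "\<And>n. bounded_clinear (b n)" and b: "bounded_clinear b'"
    and C: "\<And>n x. norm (b n x) \<le> C * norm x"
    and lim: "\<And>x y. (\<lambda>n. cinner x (b n y)) \<longlonglongrightarrow> cinner x (b' y)"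
  shows "(\<lambda>n. cinner \<phi> (\<Phi> (b n) \<phi>)) \<longlonglongrightarrow> cinner \<phi> (\<Phi> b' \<phi>)"
proof (rule topological_tendstoI)
  have cont: "continuous_map ultraweak_topology ultraweak_topology \<Phi>"
    and b\<Phi>: "\<And>b. bounded_clinear b \<Longrightarrow> bounded_clinear (\<Phi> b)"
    using \<Phi> by (auto simp: normal_cp_map_def)
  have top: "c \<in> topspace (ultraweak_topology :: ('k \<Rightarrow> 'k) topology)" if "bounded_clinear c" for c
    unfolding ultraweak_topology_def topology_generated_by_topspace
    using that trace_class_rank1[of 0] by (intro UnionI[of "{b. bounded_clinear b \<and> tr (rank1 0 0 \<circ> b) \<in> UNIV}"]) auto
  \<comment> \<open>It suffices to consider the sets that generate the ultraweak topology.\<close>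
  have ev: "\<forall>\<^sub>F n in sequentially. b n \<in> V" if "openin ultraweak_topology V" "b' \<in> V" for V
  proof -
    have "generate_topology_on {{b. bounded_clinear b \<and> tr (S \<circ> b) \<in> U} |(S :: 'k \<Rightarrow> 'k) U. trace_class S \<and> open U} V"
      using that(1) by (simp add: ultraweak_topology_def openin_topology_generated_by_iff)
    then show ?thesis using that(2)
    proof induction
      case (Int A B)
      then show ?case by (auto intro: eventually_conj)
    next
      case (UN K)
      then obtain A where A: "A \<in> K" "b' \<in> A" by auto
      then have "\<forall>\<^sub>F n in sequentially. b n \<in> A" using UN by auto
      then show ?case by eventually_elim (use A in auto)
    next
      case (Basis s)
      then obtain S U where SU: "trace_class S" "open U"
        and s: "s = {b. bounded_clinear b \<and> tr (S \<circ> b) \<in> U}" by auto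
      have "\<forall>\<^sub>F n in sequentially. tr (S \<circ> b n) \<in> U"
        using tr_bounded_weak_limit[OF sep SU(1) bn b C lim] SU(2) Basis.prems
        by (auto simp: s dest: topological_tendstoD)
      then show ?case by eventually_elim (auto simp: s bn)
    qed auto
  qed
  fix U :: "complex set" assume U: "open U" "cinner \<phi> (\<Phi> b' \<phi>) \<in> U"
  define V where "V = {c. bounded_clinear c \<and> tr (rank1 \<phi> \<phi> \<circ> c) \<in> U}"
  have "openin ultraweak_topology V" unfolding ultraweak_topology_def V_def
    using U(1) trace_class_rank1 by (intro topology_generated_by_Basis) blast
  then have "openin ultraweak_topology {c \<in> topspace ultraweak_topology. \<Phi> c \<in> V}"
    by (rule openin_continuous_map_preimage[OF cont])
  moreover have "b' \<in> {c \<in> topspace ultraweak_topology. \<Phi> c \<in> V}"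
    using top[OF b] U(2) b\<Phi>[OF b] by (simp add: V_def tr_rank1_comp)
  ultimately have "\<forall>\<^sub>F n in sequentially. b n \<in> {c \<in> topspace ultraweak_topology. \<Phi> c \<in> V}"
    by (rule ev)
  then show "\<forall>\<^sub>F n in sequentially. cinner \<phi> (\<Phi> (b n) \<phi>) \<in> U"
    by eventually_elim (auto simp: V_def tr_rank1_comp)
qed

text \<open>Finite rank approximations of \<open>b\<close>; they are linear combinations of rank one operators and
  converge to \<open>b\<close> weakly without exceeding its norm.\<close>

definition compress :: "'a::chilbert_space set \<Rightarrow> ('a \<Rightarrow> 'a) \<Rightarrow> nat \<Rightarrow> 'a \<Rightarrow> 'a" where
  "compress E b n = (\<lambda>x. proj_on (exhaust E n) (b (proj_on (exhaust E n) x)))"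

lemma compress_props:
  fixes b :: "'a::chilbert_space \<Rightarrow> 'a"
  assumes E: "is_onb E" "countable E" and b: "bounded_clinear b"
  shows "bounded_clinear (compress E b n)"
    and "norm (compress E b n x) \<le> onorm b * norm x"
    and "(\<lambda>n. cinner x (compress E b n y)) \<longlonglongrightarrow> cinner x (b y)"
    and "compress E b n = (\<lambda>x. \<Sum>e\<in>exhaust E n. \<Sum>f\<in>exhaust E n. cinner e (b f) *\<^sub>C rank1 e f x)"
proof -
  note ex = exhaust_filterlim[OF E(2)]
  have on: "orthonormal (exhaust E n)" for n
    using ex(2) is_onb_orthonormal[OF E(1)] orthonormal_subset by blast
  show "bounded_clinear (compress E b n)" unfolding compress_def
    by (rule bounded_clinear_compose[OF bounded_clinear_proj_on bounded_clinear_compose[OF b bounded_clinear_proj_on]])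
  show "norm (compress E b n x) \<le> onorm b * norm x"
  proof -
    have "norm (compress E b n x) \<le> norm (b (proj_on (exhaust E n) x))"
      unfolding compress_def by (rule norm_proj_on_le[OF on ex(1)])
    also have "\<dots> \<le> onorm b * norm (proj_on (exhaust E n) x)" by (rule bclin_bound[OF b])
    also have "\<dots> \<le> onorm b * norm x"
      by (intro mult_left_mono norm_proj_on_le[OF on ex(1)] bclin_onorm_pos b)
    finally show ?thesis .
  qed
  show "(\<lambda>n. cinner x (compress E b n y)) \<longlonglongrightarrow> cinner x (b y)"
  proof -
    have "(\<lambda>n. cinner (proj_on (exhaust E n) x) (b (proj_on (exhaust E n) y))) \<longlonglongrightarrow> cinner x (b y)"
      by (intro tendsto_cinner bclin_tendsto[OF b] proj_exhaust_tendsto E)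
    then show ?thesis by (simp add: compress_def cinner_proj_on(2)[OF on ex(1)])
  qed
  show "compress E b n = (\<lambda>x. \<Sum>e\<in>exhaust E n. \<Sum>f\<in>exhaust E n. cinner e (b f) *\<^sub>C rank1 e f x)"
  proof
    fix x
    have "compress E b n x = (\<Sum>e\<in>exhaust E n. cinner e (b (\<Sum>f\<in>exhaust E n. cinner f x *\<^sub>C f)) *\<^sub>C e)"
      by (simp add: compress_def proj_on_def)
    also have "\<dots> = (\<Sum>e\<in>exhaust E n. (\<Sum>f\<in>exhaust E n. cinner f x * cinner e (b f)) *\<^sub>C e)"
      by (simp add: bclin_sum[OF b] bclin_scaleC[OF b] cinner_sum_right cinner_scaleC_right)
    also have "\<dots> = (\<Sum>e\<in>exhaust E n. \<Sum>f\<in>exhaust E n. (cinner f x * cinner e (b f)) *\<^sub>C e)"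
      by (simp add: bounded_bilinear.sum_left[OF bounded_bilinear_scaleC])
    finally show "compress E b n x = (\<Sum>e\<in>exhaust E n. \<Sum>f\<in>exhaust E n. cinner e (b f) *\<^sub>C rank1 e f x)"
      by (simp add: rank1_apply scaleC_scaleC mult.commute)
  qed
qed

section \<open>The homogeneous space of a compact subgroup\<close>

locale compact_homogeneous_space =
  fixes H :: "'g::{topological_group_add, second_countable_topology, t2_space} set"
    and \<nu>G \<nu>H :: "'g measure" and \<nu>\<Omega> :: "'g set measure"
  assumes locally_compact: "locally_compact_space (euclidean :: 'g topology)"
    and unimodular: "unimodular_group TYPE('g)"
    and subgroup: "is_add_subgroup H" and compact_H: "compact H"
    and haar_G: "haar_measure_on UNIV \<nu>G"
    and haar_H: "haar_measure_on H \<nu>H" and total_H: "emeasure \<nu>H H = 1"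
    and coset_measure: "coset_measure H \<nu>G \<nu>H \<nu>\<Omega>"
begin

abbreviation coset :: "'g \<Rightarrow> 'g set" where "coset g \<equiv> g +o H"
abbreviation lift :: "'g set set \<Rightarrow> 'g set" where "lift X \<equiv> {g. coset g \<in> X}"

lemma H_zero: "0 \<in> H" and H_add: "g \<in> H \<Longrightarrow> h \<in> H \<Longrightarrow> g + h \<in> H" and H_minus: "g \<in> H \<Longrightarrow> - g \<in> H"
  using subgroup by (auto simp: is_add_subgroup_def)

lemma coset_self: "g \<in> coset g"
  using H_zero by (force simp: elt_set_plus_def)

lemma coset_absorb: "h \<in> H \<Longrightarrow> coset (g + h) = coset g"
proof -
  have sub: "coset (g + h) \<subseteq> coset g" if "h \<in> H" for g h
    using that by (auto simp: elt_set_plus_def add.assoc intro: H_add)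
  assume h: "h \<in> H"
  have "coset g = coset ((g + h) + - h)" by (simp add: add.assoc)
  also have "\<dots> \<subseteq> coset (g + h)" by (rule sub[OF H_minus[OF h]])
  finally show ?thesis using sub[OF h] by blast
qed

lemma coset_eq_iff: "coset a = coset b \<longleftrightarrow> (\<exists>h\<in>H. b = a + h)"
proof
  assume "coset a = coset b"
  then have "b \<in> coset a" using coset_self[of b] by simp
  then show "\<exists>h\<in>H. b = a + h" by (auto simp: elt_set_plus_def)
qed (auto simp: coset_absorb)

lemma act_coset: "g +o coset x = coset (g + x)"
  by (auto simp: elt_set_plus_def add.assoc)

lemma cosetsE:
  assumes "c \<in> cosets H" obtains g where "c = coset g"
  using assms by (auto simp: cosets_def)

lemma coset_in [simp]: "coset g \<in> cosets H"
  by (simp add: cosets_def)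

lemma space_coset_borel [simp]: "space (coset_borel H) = cosets H"
  unfolding coset_borel_def by (rule space_measure_of) auto

lemma sets_coset_borel:
  "sets (coset_borel H) = sigma_sets (cosets H) {U. U \<subseteq> cosets H \<and> open (lift U)}"
  unfolding coset_borel_def by (rule sets_measure_of) auto

lemma open_coset_sets: "U \<subseteq> cosets H \<Longrightarrow> open (lift U) \<Longrightarrow> U \<in> sets (coset_borel H)"
  unfolding sets_coset_borel by (rule sigma_sets.Basic) simp

lemma sets_nuG [measurable_cong]: "sets \<nu>G = sets borel"
  using haar_G by (simp add: haar_measure_on_def)

lemma space_nuG [simp]: "space \<nu>G = UNIV"
  using sets_eq_imp_space_eq[OF sets_nuG] by simp

lemma sets_nuO [measurable_cong]: "sets \<nu>\<Omega> = sets (coset_borel H)"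
  using coset_measure by (simp add: coset_measure_def)

lemma space_nuO [simp]: "space \<nu>\<Omega> = cosets H"
  using sets_eq_imp_space_eq[OF sets_nuO] by simp

lemma sets_subset_cosets: "X \<in> sets (coset_borel H) \<Longrightarrow> X \<subseteq> cosets H"
  using sets.sets_into_space by fastforce

lemma measurable_coset [measurable]: "coset \<in> borel \<rightarrow>\<^sub>M coset_borel H"
  unfolding coset_borel_def
proof (rule measurable_measure_of)
  fix U assume "U \<in> {U. U \<subseteq> cosets H \<and> open (lift U)}"
  then show "coset -` U \<inter> space borel \<in> sets borel" by (auto simp: vimage_def)
qed auto

lemma lift_sets: "X \<in> sets (coset_borel H) \<Longrightarrow> lift X \<in> sets borel"
  using measurable_sets[OF measurable_coset, of X] by (simp add: vimage_def)

lemma open_translate: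
  fixes Y :: "'g set"
  assumes "open Y"
  shows "open {g. c + g \<in> Y}" "open {g. g + c \<in> Y}" "open {g. - g \<in> Y}"
proof -
  have "open ((\<lambda>g. c + g) -` Y)" "open ((\<lambda>g. g + c) -` Y)" "open ((\<lambda>g. - g) -` Y)"
    by (intro open_vimage assms continuous_intros)+
  then show "open {g. c + g \<in> Y}" "open {g. g + c \<in> Y}" "open {g. - g \<in> Y}"
    by (simp_all add: vimage_def)
qed

lemma lift_image: "lift (coset ` Y) = (\<Union>h\<in>H. {g. g + h \<in> Y})"
proof (intro set_eqI iffI)
  fix g assume "g \<in> lift (coset ` Y)"
  then obtain y where "y \<in> Y" "coset g = coset y" by auto
  then show "g \<in> (\<Union>h\<in>H. {g. g + h \<in> Y})" unfolding coset_eq_iff by auto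
next
  fix g assume "g \<in> (\<Union>h\<in>H. {g. g + h \<in> Y})"
  then obtain h where h: "h \<in> H" "g + h \<in> Y" by blast
  then have "coset g = coset (g + h)" by (simp add: coset_absorb)
  with h show "g \<in> lift (coset ` Y)" by auto
qed

lemma lift_image_saturated:
  assumes "\<And>g h. g \<in> A \<Longrightarrow> h \<in> H \<Longrightarrow> g + h \<in> A" shows "lift (coset ` A) = A"
proof (intro set_eqI iffI)
  fix x assume "x \<in> lift (coset ` A)"
  then obtain h where h: "h \<in> H" "x + h \<in> A" unfolding lift_image by blast
  from assms[OF h(2) H_minus[OF h(1)]] show "x \<in> A" by (simp only: add.assoc right_minus add_0_right)
qed auto

lemma open_image_coset:
  assumes "open Y" shows "open (lift (coset ` Y))" "coset ` Y \<in> sets (coset_borel H)"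
proof -
  show "open (lift (coset ` Y))" unfolding lift_image by (intro open_UN ballI open_translate assms)
  then show "coset ` Y \<in> sets (coset_borel H)" by (intro open_coset_sets) auto
qed

text \<open>The preimage of an open set is a countable union of products \<open>A \<times> \<pi>(B)\<close> with \<open>A\<close>, \<open>B\<close> from a countable
  basis of \<open>G\<close>, because the quotient map \<open>\<pi>\<close> is open.\<close>

lemma measurable_action: "(\<lambda>p. fst p +o snd p) \<in> borel \<Otimes>\<^sub>M coset_borel H \<rightarrow>\<^sub>M coset_borel H"
proof -
  have "(\<lambda>p. fst p +o snd p) \<in> borel \<Otimes>\<^sub>M coset_borel H \<rightarrow>\<^sub>M sigma (cosets H) {U. U \<subseteq> cosets H \<and> open (lift U)}"
  proof (rule measurable_measure_of)
    show "(\<lambda>p. fst p +o snd p) \<in> space (borel \<Otimes>\<^sub>M coset_borel H) \<rightarrow> cosets H"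
      by (auto simp: space_pair_measure act_coset elim!: cosetsE)
    fix U assume "U \<in> {U. U \<subseteq> cosets H \<and> open (lift U)}"
    then have U: "U \<subseteq> cosets H" "open (lift U)" by auto
    obtain \<B> :: "'g set set" where \<B>: "countable \<B>" "topological_basis \<B>"
      using ex_countable_basis by blast
    define I where "I = {(A, B) \<in> \<B> \<times> \<B>. \<forall>a\<in>A. \<forall>b\<in>B. a + b \<in> lift U}"
    have "(\<lambda>p. fst p +o snd p) -` U \<inter> space (borel \<Otimes>\<^sub>M coset_borel H) = (\<Union>(A, B)\<in>I. A \<times> coset ` B)"
    proof (intro set_eqI iffI)
      fix p assume p: "p \<in> (\<lambda>p. fst p +o snd p) -` U \<inter> space (borel \<Otimes>\<^sub>M coset_borel H)"
      obtain x g where pg: "p = (x, coset g)"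
        using p by (cases p) (auto simp: space_pair_measure elim!: cosetsE)
      have "open ((\<lambda>q :: 'g \<times> 'g. fst q + snd q) -` lift U)"
        by (intro open_vimage U continuous_intros)
      moreover have "(x, g) \<in> (\<lambda>q. fst q + snd q) -` lift U"
        using p by (simp add: pg act_coset)
      ultimately obtain A B where AB: "open A" "open B" "(x, g) \<in> A \<times> B"
        and sub: "A \<times> B \<subseteq> (\<lambda>q. fst q + snd q) -` lift U"
        by (rule open_prod_elim)
      obtain A' where A': "A' \<in> \<B>" "x \<in> A'" "A' \<subseteq> A"
        using AB topological_basisE[OF \<B>(2), of A x] by auto
      obtain B' where B': "B' \<in> \<B>" "g \<in> B'" "B' \<subseteq> B"
        using AB topological_basisE[OF \<B>(2), of B g] by auto
      have "a + b \<in> lift U" if "a \<in> A'" "b \<in> B'" for a b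
        using subsetD[OF sub, of "(a, b)"] that A' B' by auto
      then have "(A', B') \<in> I" using A' B' by (auto simp: I_def)
      with A' B' show "p \<in> (\<Union>(A, B)\<in>I. A \<times> coset ` B)" by (auto simp: pg)
    next
      fix p assume "p \<in> (\<Union>(A, B)\<in>I. A \<times> coset ` B)"
      then obtain A B x b where "(A, B) \<in> I" "x \<in> A" "b \<in> B" "p = (x, coset b)" by auto
      then show "p \<in> (\<lambda>p. fst p +o snd p) -` U \<inter> space (borel \<Otimes>\<^sub>M coset_borel H)"
        by (auto simp: I_def act_coset space_pair_measure)
    qed
    also have "\<dots> \<in> sets (borel \<Otimes>\<^sub>M coset_borel H)"
    proof (rule sets.countable_UN'')
      have "I \<subseteq> \<B> \<times> \<B>" by (auto simp: I_def)
      then show "countable I" using \<B>(1) by (meson countable_SIGMA countable_subset)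
      fix p assume "p \<in> I"
      then show "(case p of (A, B) \<Rightarrow> A \<times> coset ` B) \<in> sets (borel \<Otimes>\<^sub>M coset_borel H)"
        using topological_basis_open[OF \<B>(2)]
        by (auto simp: I_def intro!: pair_measureI open_image_coset borel_open)
    qed
    finally show "(\<lambda>p. fst p +o snd p) -` U \<inter> space (borel \<Otimes>\<^sub>M coset_borel H) \<in> sets (borel \<Otimes>\<^sub>M coset_borel H)" .
  qed auto
  then show ?thesis by (simp add: coset_borel_def)
qed

lemma translate_eq: "X \<subseteq> cosets H \<Longrightarrow> translate g X = {c \<in> cosets H. - g +o c \<in> X}"
proof (intro set_eqI iffI)
  fix c assume X: "X \<subseteq> cosets H" and "c \<in> translate g X"
  then obtain x where "c = g +o coset x" "coset x \<in> X"
    by (auto simp: translate_def elim!: cosetsE dest!: subsetD)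
  then show "c \<in> {c \<in> cosets H. - g +o c \<in> X}" by (simp add: act_coset)
next
  fix c assume "c \<in> {c \<in> cosets H. - g +o c \<in> X}"
  then obtain x where x: "c = coset x" "- g +o coset x \<in> X" by (auto elim: cosetsE)
  moreover have "c = g +o (- g +o coset x)" by (simp add: act_coset x)
  ultimately show "c \<in> translate g X" by (auto simp: translate_def)
qed

lemma lift_translate: "X \<subseteq> cosets H \<Longrightarrow> lift (translate g X) = {x. - g + x \<in> lift X}"
  by (auto simp: translate_eq act_coset)

lemma translate_sets: "X \<in> sets (coset_borel H) \<Longrightarrow> translate g X \<in> sets (coset_borel H)"
proof -
  assume X: "X \<in> sets (coset_borel H)"
  have "(\<lambda>c. - g +o c) \<in> coset_borel H \<rightarrow>\<^sub>M coset_borel H"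
    using measurable_compose[OF _ measurable_action, of "\<lambda>c. (- g, c)" "coset_borel H"] by simp
  from measurable_sets[OF this X] show ?thesis
    using sets_subset_cosets[OF X] by (simp add: translate_eq vimage_def Int_def conj_commute)
qed

subsection \<open>Invariance and neighbourhoods\<close>

lemma left_invariant:
  assumes "A \<in> sets borel" shows "emeasure \<nu>G {x. a + x \<in> A} = emeasure \<nu>G A"
proof -
  have "{x. a + x \<in> A} = - a +o A"
  proof (intro set_eqI iffI)
    fix x assume "x \<in> {x. a + x \<in> A}"
    then show "x \<in> - a +o A" unfolding elt_set_plus_def by (auto intro!: bexI[of _ "a + x"])
  qed (auto simp: elt_set_plus_def)
  then show ?thesis using haar_G assms sets_nuG by (simp add: haar_measure_on_def)
qed

lemma right_invariant:
  assumes "A \<in> sets borel" shows "emeasure \<nu>G {x. x + a \<in> A} = emeasure \<nu>G A"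
proof -
  have "{x. x + a \<in> A} = (\<lambda>x. x + - a) ` A"
  proof (intro set_eqI iffI)
    fix x assume "x \<in> {x. x + a \<in> A}"
    then show "x \<in> (\<lambda>x. x + - a) ` A" by (intro image_eqI[of _ _ "x + a"]) (auto simp: add.assoc)
  qed (auto simp: add.assoc)
  moreover have "emeasure \<nu>G ((\<lambda>x. x + - a) ` A) = emeasure \<nu>G A"
    using unimodular haar_G assms unfolding unimodular_group_def sets_nuG[symmetric] by blast
  ultimately show ?thesis by simp
qed

lemma compact_finite: "compact C \<Longrightarrow> emeasure \<nu>G C < \<infinity>"
  using haar_G by (simp add: haar_measure_on_def)

text \<open>The translates of \<open>Y\<close> form an open cover of a second countable space.\<close>

lemma countable_translates:
  assumes Y: "open Y" "Y \<noteq> {}"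
  obtains g :: "nat \<Rightarrow> 'g" where "\<And>x. \<exists>i. - g i + x \<in> Y"
proof -
  from Y obtain y where y: "y \<in> Y" by blast
  have "\<And>S. S \<in> range (\<lambda>g. {x. - g + x \<in> Y}) \<Longrightarrow> open S" using open_translate(1)[OF Y(1)] by auto
  then obtain F where F: "F \<subseteq> range (\<lambda>g. {x. - g + x \<in> Y})" "countable F"
    "\<Union>F = \<Union>(range (\<lambda>g. {x. - g + x \<in> Y}))" by (rule Lindelof)
  obtain C where C: "countable C" "F = (\<lambda>g. {x. - g + x \<in> Y}) ` C"
    using F(1,2) by (metis countable_subset_image)
  have cover: "\<exists>g\<in>C. - g + x \<in> Y" for x
  proof -
    have "- (x - y) + x = y" by simp
    then have "x \<in> \<Union>(range (\<lambda>g. {x. - g + x \<in> Y}))" using y by (auto intro!: exI[of _ "x - y"])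
    then show ?thesis unfolding F(3)[symmetric] C(2) by auto
  qed
  show ?thesis
  proof (rule that[of "from_nat_into C"])
    show "\<exists>i. - from_nat_into C i + x \<in> Y" for x
      using cover[of x] from_nat_into_surj[OF C(1)] by metis
  qed
qed

text \<open>Countably many translates of \<open>Y\<close> cover \<open>G\<close>, which is not a null set.\<close>

lemma open_positive:
  assumes Y: "open Y" "Y \<noteq> {}" shows "emeasure \<nu>G Y \<noteq> 0"
proof
  assume z: "emeasure \<nu>G Y = 0"
  obtain g :: "nat \<Rightarrow> 'g" where g: "\<And>x. \<exists>i. - g i + x \<in> Y"
    using countable_translates[OF Y] by blast
  have "{x. - g i + x \<in> Y} \<in> null_sets \<nu>G" for i
    using open_translate(1)[OF Y(1)] left_invariant[OF borel_open[OF Y(1)]] z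
    by (auto intro!: null_setsI simp: sets_nuG)
  then have "(\<Union>i. {x. - g i + x \<in> Y}) \<in> null_sets \<nu>G" by (intro null_sets_UN) auto
  moreover have "(\<Union>i. {x. - g i + x \<in> Y}) = UNIV" using g by auto
  ultimately show False using haar_G by (simp add: haar_measure_on_def null_sets_def)
qed

text \<open>Symmetric neighbourhoods of the compact set \<open>H\<close> that are invariant under \<open>H\<close> from both
  sides and shrink to it.\<close>

definition shrinking :: "(nat \<Rightarrow> 'g set) \<Rightarrow> bool" where
  "shrinking Y \<longleftrightarrow> (\<forall>n. open (Y n) \<and> 0 \<in> Y n \<and> (\<forall>y. y \<in> Y n \<longrightarrow> - y \<in> Y n) \<and>
     (\<forall>y h. y \<in> Y n \<longrightarrow> h \<in> H \<longrightarrow> h + y \<in> Y n \<and> y + h \<in> Y n) \<and> emeasure \<nu>G (Y n) < \<infinity>) \<and> decseq Y \<and>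
     (\<forall>X g. open (lift X) \<longrightarrow> g \<in> lift X \<longrightarrow> (\<exists>N. \<forall>n\<ge>N. \<forall>y\<in>Y n. g + y \<in> lift X))"

text \<open>Adding \<open>H\<close> on both sides to a basis of symmetric neighbourhoods of \<open>0\<close> inside a compact set. The sets
  shrink to \<open>H\<close> in the required sense by the tube lemma, which uses the compactness of \<open>H\<close>.\<close>

lemma shrinking_exists: "\<exists>Y. shrinking Y"
proof -
  obtain A where A: "\<And>i::nat. open (A i)" "\<And>i. (0::'g) \<in> A i"
    "\<And>S. open S \<Longrightarrow> 0 \<in> S \<Longrightarrow> eventually (\<lambda>i. A i \<subseteq> S) sequentially"
    using countable_basis_at_decseq[of "0::'g"] by blast
  obtain K C where K: "open K" "compact C" "(0::'g) \<in> K" "K \<subseteq> C"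
    using locally_compact unfolding locally_compact_space_def
    by (metis UNIV_I compactin_euclidean_iff open_openin topspace_euclidean)
  define V where "V n = K \<inter> {g. - g \<in> K} \<inter> (\<Inter>i\<le>n. A i \<inter> {g. - g \<in> A i})" for n
  have V: "open (V n)" "0 \<in> V n" "v \<in> V n \<Longrightarrow> - v \<in> V n" "V n \<subseteq> A n" "V n \<subseteq> C" for n v
    unfolding V_def using A K by (auto intro!: open_Int open_INT open_translate)
  have Vdec: "m \<le> n \<Longrightarrow> V n \<subseteq> V m" for m n by (auto simp: V_def)
  define Y where "Y n = (\<Union>h\<in>H. \<Union>k\<in>H. {g. h + (g + k) \<in> V n})" for n
  have YI: "h + (v + k) \<in> Y n" if "h \<in> H" "k \<in> H" "v \<in> V n" for h v k n
    unfolding Y_def by (rule UN_I[OF H_minus[OF that(1)]], rule UN_I[OF H_minus[OF that(2)]])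
      (use that(3) in \<open>simp only: add.assoc right_minus add_0_right minus_add_cancel mem_Collect_eq\<close>)
  have YE: "\<exists>h\<in>H. \<exists>k\<in>H. \<exists>v\<in>V n. y = h + (v + k)" if y: "y \<in> Y n" for y n
  proof -
    from y obtain h k where hk: "h \<in> H" "k \<in> H" "h + (y + k) \<in> V n" unfolding Y_def by auto
    have "y = - h + ((h + (y + k)) + - k)"
      by (simp only: add.assoc right_minus add_0_right minus_add_cancel)
    then show ?thesis using hk H_minus by blast
  qed
  have "shrinking Y" unfolding shrinking_def
  proof (intro conjI allI impI)
    fix n
    show "open (Y n)" unfolding Y_def
    proof (intro open_UN ballI)
      fix h k
      have "open {g. g + k \<in> {x. h + x \<in> V n}}" by (intro open_translate V)
      then show "open {g. h + (g + k) \<in> V n}" by simp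
    qed
    show "0 \<in> Y n" using YI[OF H_zero H_zero V(2)] by simp
    show "- y \<in> Y n" if y: "y \<in> Y n" for y
    proof -
      obtain h k v where hk: "h \<in> H" "k \<in> H" "v \<in> V n" "y = h + (v + k)" using YE[OF y] by blast
      then have "- y = - k + (- v + - h)" by (simp only: minus_add add.assoc)
      then show ?thesis using YI[of "- k" "- h" "- v" n] hk H_minus V(3) by simp
    qed
    show "h + y \<in> Y n" "y + h \<in> Y n" if y: "y \<in> Y n" "h \<in> H" for y h
    proof -
      obtain h' k v where hk: "h' \<in> H" "k \<in> H" "v \<in> V n" "y = h' + (v + k)" using YE[OF y(1)] by blast
      show "h + y \<in> Y n" using YI[of "h + h'" k v n] hk H_add y(2) by (simp add: add.assoc)
      show "y + h \<in> Y n" using YI[of h' "k + h" v n] hk H_add y(2) by (simp add: add.assoc)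
    qed
    have cpt: "compact ((\<lambda>(h, v, k). h + (v + k)) ` (H \<times> C \<times> H))"
      unfolding case_prod_beta
      by (intro compact_continuous_image compact_Times compact_H K continuous_intros)
    have "Y n \<subseteq> (\<lambda>(h, v, k). h + (v + k)) ` (H \<times> C \<times> H)"
    proof
      fix y assume "y \<in> Y n"
      then obtain h k v where "h \<in> H" "k \<in> H" "v \<in> V n" "y = h + (v + k)" using YE by blast
      then show "y \<in> (\<lambda>(h, v, k). h + (v + k)) ` (H \<times> C \<times> H)" using V(5)
        by (intro image_eqI[of _ _ "(h, v, k)"]) auto
    qed
    then have "emeasure \<nu>G (Y n) \<le> emeasure \<nu>G ((\<lambda>(h, v, k). h + (v + k)) ` (H \<times> C \<times> H))"
      by (rule emeasure_mono) (simp add: sets_nuG borel_closed compact_imp_closed cpt)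
    then show "emeasure \<nu>G (Y n) < \<infinity>"
      using compact_finite[OF cpt] by (rule le_less_trans)
  next
    show "decseq Y" unfolding decseq_def Y_def using Vdec by fast
  next
    fix X g assume X: "open (lift X)" and g: "g \<in> lift X"
    let ?W = "(\<lambda>p :: 'g \<times> 'g. g + (fst p + snd p)) -` lift X"
    have W: "open ?W" by (intro open_vimage X continuous_intros)
    have "coset (g + h) \<in> X" if "h \<in> H" for h using g that by (simp add: coset_absorb)
    then have "H \<times> {0} \<subseteq> ?W" by auto
    with tube_lemma_left[of euclidean euclidean ?W H 0] W compact_H
    obtain R S where "open S" "0 \<in> S" "H \<subseteq> R" and RS: "R \<times> S \<subseteq> ?W" by auto
    then have S: "0 \<in> S" "open S" "H \<times> S \<subseteq> ?W" by auto
    obtain N where N: "\<And>n. n \<ge> N \<Longrightarrow> A n \<subseteq> S"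
      using A(3)[OF S(2,1)] by (auto simp: eventually_sequentially)
    have "g + y \<in> lift X" if n: "n \<ge> N" and y: "y \<in> Y n" for n y
    proof -
      obtain h k v where hk: "h \<in> H" "k \<in> H" "v \<in> V n" "y = h + (v + k)" using YE[OF y] by blast
      then have "(h, v) \<in> ?W" using S(3) N[OF n] V(4) by blast
      moreover have "g + y = (g + (h + v)) + k" by (simp add: hk add.assoc)
      ultimately show ?thesis using coset_absorb[OF hk(2), of "g + (h + v)"] by simp
    qed
    then show "\<exists>N. \<forall>n\<ge>N. \<forall>y\<in>Y n. g + y \<in> lift X" by blast
  qed
  then show ?thesis by blast
qed

subsection \<open>The invariant measure as an image measure\<close>

lemma space_nuH: "space \<nu>H = H"
  using haar_H sets_eq_imp_space_eq[of \<nu>H "restrict_space borel H"]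
  by (simp add: haar_measure_on_def space_restrict_space)

lemma on_coset_eq:
  assumes "\<And>h. h \<in> H \<Longrightarrow> F (g + h) = F g" shows "on_coset F (coset g) = F g"
proof -
  have "F ` coset g = {F g}"
    using assms coset_self[of g] by (auto simp: elt_set_plus_def)
  then show ?thesis by (simp add: on_coset_def)
qed

text \<open>The defining formula of the invariant measure, applied to the indicator function of a set that is
  a union of cosets: the inner integral over \<open>H\<close> is then trivial.\<close>

lemma emeasure_nuO_finite:
  assumes X: "X \<in> sets (coset_borel H)" and fin: "emeasure \<nu>G (lift X) < \<infinity>"
  shows "emeasure \<nu>\<Omega> X = emeasure \<nu>G (lift X)"
proof -
  define f :: "'g \<Rightarrow> complex" where "f = (\<lambda>x. complex_of_real (indicator (lift X) x))"
  have inv: "f (g + h) = f g" if "h \<in> H" for g h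
    using that by (simp add: f_def indicator_def coset_absorb)
  have f: "has_bochner_integral \<nu>G f (measure \<nu>G (lift X))"
    unfolding f_def using lift_sets[OF X] fin sets_nuG
    by (intro has_bochner_integral_of_real has_bochner_integral_real_indicator) auto
  then have "has_bochner_integral \<nu>\<Omega> (on_coset (\<lambda>g. LINT h|\<nu>H. f (g + h))) (LINT g|\<nu>G. f g)"
    using coset_measure by (auto simp: coset_measure_def has_bochner_integral_iff)
  moreover have "(LINT h|\<nu>H. f (g + h)) = f g" for g
  proof -
    have "(LINT h|\<nu>H. f (g + h)) = (LINT h|\<nu>H. f g)"
      by (rule Bochner_Integration.integral_cong) (auto simp: space_nuH inv)
    also have "\<dots> = f g" using total_H by (simp add: space_nuH measure_def)
    finally show ?thesis .
  qed
  ultimately have "has_bochner_integral \<nu>\<Omega> (on_coset f) (measure \<nu>G (lift X))"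
    using f by (simp add: has_bochner_integral_iff)
  moreover have "on_coset f c = complex_of_real (indicator X c)" if "c \<in> space \<nu>\<Omega>" for c
  proof -
    obtain g where g: "c = coset g" using \<open>c \<in> space \<nu>\<Omega>\<close> by (auto elim: cosetsE)
    have "on_coset f c = f g" unfolding g by (rule on_coset_eq) (rule inv)
    then show ?thesis by (simp add: f_def g indicator_def)
  qed
  ultimately have ci: "has_bochner_integral \<nu>\<Omega> (\<lambda>c. complex_of_real (indicator X c)) (measure \<nu>G (lift X))"
    by (subst has_bochner_integral_cong[symmetric]) auto
  have i: "has_bochner_integral \<nu>\<Omega> (\<lambda>c. indicator X c :: real) (measure \<nu>G (lift X))"
    using has_bochner_integral_Re[OF ci] by simp
  then have "emeasure \<nu>\<Omega> X < \<infinity>" using X sets_nuO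
    by (simp add: has_bochner_integral_iff integrable_indicator_iff Int_absorb2 sets_subset_cosets less_top)
  moreover have "measure \<nu>\<Omega> X = measure \<nu>G (lift X)"
    using i X by (simp add: has_bochner_integral_iff Int_absorb2 sets_subset_cosets)
  ultimately show ?thesis using fin
    by (metis emeasure_eq_ennreal_measure infinity_ennreal_def less_irrefl)
qed

text \<open>Translates of one neighbourhood of finite measure.\<close>

lemma finite_cover:
  "\<exists>T :: nat \<Rightarrow> 'g set set. (\<forall>i. T i \<in> sets (coset_borel H) \<and> open (lift (T i)) \<and>
     emeasure \<nu>G (lift (T i)) < \<infinity>) \<and> (\<Union>i. T i) = cosets H"
proof -
  obtain Y where "shrinking Y" using shrinking_exists by blast
  then have Y: "open (Y 0)" "0 \<in> Y 0" "emeasure \<nu>G (Y 0) < \<infinity>"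
    and Yi: "\<And>y h. y \<in> Y 0 \<Longrightarrow> h \<in> H \<Longrightarrow> y + h \<in> Y 0"
    unfolding shrinking_def by blast+
  obtain g :: "nat \<Rightarrow> 'g" where g: "\<And>x. \<exists>i. - g i + x \<in> Y 0"
    using countable_translates[of "Y 0"] Y by blast
  have lY: "lift (coset ` Y 0) = Y 0" by (rule lift_image_saturated) (rule Yi)
  define T where "T i = translate (g i) (coset ` Y 0)" for i
  have lT: "lift (T i) = {x. - g i + x \<in> Y 0}" for i
    unfolding T_def by (subst lift_translate) (auto simp: lY)
  have T: "T i \<in> sets (coset_borel H)" for i
    unfolding T_def by (intro translate_sets open_image_coset Y)
  moreover have "(\<Union>i. T i) = cosets H"
  proof
    show "(\<Union>i. T i) \<subseteq> cosets H" using sets_subset_cosets[OF T] by blast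
    show "cosets H \<subseteq> (\<Union>i. T i)"
    proof
      fix c assume "c \<in> cosets H"
      then obtain x where x: "c = coset x" by (rule cosetsE)
      obtain i where "x \<in> lift (T i)" using g[of x] unfolding lT by blast
      then show "c \<in> (\<Union>i. T i)" by (auto simp: x)
    qed
  qed
  moreover have "emeasure \<nu>G (lift (T i)) < \<infinity>" for i
    unfolding lT using left_invariant[OF borel_open[OF Y(1)]] Y(3) by simp
  moreover have "open (lift (T i))" for i unfolding lT by (intro open_translate Y)
  ultimately show ?thesis by blast
qed

lemma emeasure_nuO:
  assumes X: "X \<in> sets (coset_borel H)"
  shows "emeasure \<nu>\<Omega> X = emeasure \<nu>G (lift X)"
proof -
  obtain T :: "nat \<Rightarrow> 'g set set" where T: "\<And>i. T i \<in> sets (coset_borel H)" "(\<Union>i. T i) = cosets H"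
    "\<And>i. emeasure \<nu>G (lift (T i)) < \<infinity>" using finite_cover by auto
  define S where "S i = X \<inter> disjointed T i" for i
  have "range T \<subseteq> sets (coset_borel H)" by (rule image_subsetI) (rule T(1))
  then have "disjointed T i \<in> sets (coset_borel H)" for i
    using sets.range_disjointed_sets[of T "coset_borel H"] by blast
  then have S: "S i \<in> sets (coset_borel H)" for i
    unfolding S_def using X by simp
  have "(\<Union>i. S i) = X \<inter> (\<Union>i. disjointed T i)" unfolding S_def by blast
  also have "\<dots> = X" unfolding UN_disjointed_eq T(2) using sets_subset_cosets[OF X] by blast
  finally have XS: "X = (\<Union>i. S i)" by (rule sym)
  have dS: "disjoint_family S"
    using disjoint_family_disjointed[of T] unfolding disjoint_family_on_def S_def by blast
  have "emeasure \<nu>\<Omega> (\<Union>i. S i) = (\<Sum>i. emeasure \<nu>\<Omega> (S i))"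
    using S dS sets_nuO by (intro suminf_emeasure[symmetric]) auto
  then have "emeasure \<nu>\<Omega> X = (\<Sum>i. emeasure \<nu>\<Omega> (S i))" unfolding XS[symmetric] .
  also have "\<dots> = (\<Sum>i. emeasure \<nu>G (lift (S i)))"
  proof (intro suminf_cong emeasure_nuO_finite S)
    fix i
    have "S i \<subseteq> T i" using disjointed_subset[of T i] by (auto simp: S_def)
    then have "emeasure \<nu>G (lift (S i)) \<le> emeasure \<nu>G (lift (T i))"
      using lift_sets[OF T(1)] sets_nuG by (intro emeasure_mono) auto
    then show "emeasure \<nu>G (lift (S i)) < \<infinity>" using T(3) le_less_trans by blast
  qed
  also have "\<dots> = emeasure \<nu>G (\<Union>i. lift (S i))"
    using lift_sets[OF S] dS sets_nuG by (intro suminf_emeasure) (auto simp: disjoint_family_on_def)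
  also have "(\<Union>i. lift (S i)) = lift (\<Union>i. S i)" by blast
  also have "\<dots> = lift X" unfolding XS[symmetric] ..
  finally show ?thesis .
qed

lemma nuO_eq_distr: "\<nu>\<Omega> = distr \<nu>G (coset_borel H) coset"
proof (rule measure_eqI)
  show "sets \<nu>\<Omega> = sets (distr \<nu>G (coset_borel H) coset)" by (simp add: sets_nuO)
  fix X assume "X \<in> sets \<nu>\<Omega>"
  then have X: "X \<in> sets (coset_borel H)" by (simp add: sets_nuO)
  have "coset \<in> \<nu>G \<rightarrow>\<^sub>M coset_borel H" by measurable
  then show "emeasure \<nu>\<Omega> X = emeasure (distr \<nu>G (coset_borel H) coset) X"
    using X by (simp add: emeasure_distr emeasure_nuO vimage_def)
qed

lemma sigma_finite_nuG: "sigma_finite_measure \<nu>G"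
proof -
  obtain T :: "nat \<Rightarrow> 'g set set" where T: "\<And>i. T i \<in> sets (coset_borel H)" "(\<Union>i. T i) = cosets H"
    "\<And>i. emeasure \<nu>G (lift (T i)) < \<infinity>" using finite_cover by auto
  have "(\<Union>i. lift (T i)) = UNIV" using T(2) by auto
  show ?thesis
  proof
    show "\<exists>A. countable A \<and> A \<subseteq> sets \<nu>G \<and> \<Union> A = space \<nu>G \<and> (\<forall>a\<in>A. emeasure \<nu>G a \<noteq> \<infinity>)"
    proof (intro exI[of _ "range (\<lambda>i. lift (T i))"] conjI ballI)
      show "\<Union> (range (\<lambda>i. lift (T i))) = space \<nu>G"
        using \<open>(\<Union>i. lift (T i)) = UNIV\<close> by simp
      show "emeasure \<nu>G a \<noteq> \<infinity>" if "a \<in> range (\<lambda>i. lift (T i))" for a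
      proof -
        from that obtain i where "a = lift (T i)" by blast
        then show ?thesis using T(3)[of i] by simp
      qed
      show "range (\<lambda>i. lift (T i)) \<subseteq> sets \<nu>G"
        unfolding sets_nuG by (rule image_subsetI) (rule lift_sets[OF T(1)])
    qed simp
  qed
qed

end

section \<open>Kernels of completely positive maps\<close>

text \<open>The values \<open>\<langle>\<phi>|\<Phi>(|\<eta>\<rangle>\<langle>\<xi>|)\<psi>\<rangle>\<close> of a completely positive map \<open>\<Phi>\<close> on rank one operators form a
  kernel on the pairs \<open>(\<eta>, \<phi>)\<close>; the last condition says \<open>\<Phi>(P) \<le> c I\<close> for finite rank projections \<open>P\<close>.\<close>

definition cp_kernel :: "real \<Rightarrow> ('k::chilbert_space \<times> 'v::chilbert_space \<Rightarrow> 'k \<times> 'v \<Rightarrow> complex) \<Rightarrow> bool" where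
  "cp_kernel c q \<longleftrightarrow> psd_kernel q \<and>
     (\<forall>a b \<eta> \<eta>' \<phi> t. q (a *\<^sub>C \<eta> + b *\<^sub>C \<eta>', \<phi>) t = a * q (\<eta>, \<phi>) t + b * q (\<eta>', \<phi>) t) \<and>
     (\<forall>a b \<eta> \<phi> \<phi>' t. q (\<eta>, a *\<^sub>C \<phi> + b *\<^sub>C \<phi>') t = cnj a * q (\<eta>, \<phi>) t + cnj b * q (\<eta>, \<phi>') t) \<and>
     (\<forall>F \<phi>. finite F \<longrightarrow> orthonormal F \<longrightarrow> (\<Sum>f\<in>F. Re (q (f, \<phi>) (f, \<phi>))) \<le> c * (norm \<phi>)\<^sup>2)"

context
  fixes c :: real and q :: "'k::chilbert_space \<times> 'v::chilbert_space \<Rightarrow> 'k \<times> 'v \<Rightarrow> complex"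
  assumes q: "cp_kernel c q" and c: "0 \<le> c"
begin

lemma cpk_psd: "psd_kernel q"
  using q by (simp add: cp_kernel_def)

lemma cpk_herm: "q s t = cnj (q t s)"
  by (rule psd_hermitian[OF cpk_psd])

lemma cpk_lin1: "q (a *\<^sub>C \<eta> + b *\<^sub>C \<eta>', \<phi>) t = a * q (\<eta>, \<phi>) t + b * q (\<eta>', \<phi>) t"
  and cpk_lin2: "q (\<eta>, a *\<^sub>C \<phi> + b *\<^sub>C \<phi>') t = cnj a * q (\<eta>, \<phi>) t + cnj b * q (\<eta>, \<phi>') t"
  using q unfolding cp_kernel_def by blast+

lemma cpk_lin3: "q s (a *\<^sub>C \<xi> + b *\<^sub>C \<xi>', \<psi>) = cnj a * q s (\<xi>, \<psi>) + cnj b * q s (\<xi>', \<psi>)"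
  by (subst (1 2 3) cpk_herm) (simp add: cpk_lin1)

lemma cpk_lin4: "q s (\<xi>, a *\<^sub>C \<psi> + b *\<^sub>C \<psi>') = a * q s (\<xi>, \<psi>) + b * q s (\<xi>, \<psi>')"
  by (subst (1 2 3) cpk_herm) (simp add: cpk_lin2)

lemma cpk_scale: "q (a *\<^sub>C \<eta>, \<phi>) t = a * q (\<eta>, \<phi>) t" "q s (a *\<^sub>C \<xi>, \<psi>) = cnj a * q s (\<xi>, \<psi>)"
  using cpk_lin1[of a \<eta> 0 0 \<phi> t] cpk_lin3[of s a \<xi> 0 0 \<psi>] by simp_all

lemma cpk_diff1: "q (\<eta> - \<eta>', \<phi>) t = q (\<eta>, \<phi>) t - q (\<eta>', \<phi>) t"
  using cpk_lin1[of 1 \<eta> "- 1" \<eta>' \<phi> t] by (simp add: scaleC_minus_one)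

lemma cpk_diff2: "q (\<eta>, \<phi> - \<phi>') t = q (\<eta>, \<phi>) t - q (\<eta>, \<phi>') t"
  using cpk_lin2[of \<eta> 1 \<phi> "- 1" \<phi>' t] by (simp add: scaleC_minus_one)

lemma cpk_diff3: "q s (\<xi> - \<xi>', \<psi>) = q s (\<xi>, \<psi>) - q s (\<xi>', \<psi>)"
  using cpk_lin3[of s 1 \<xi> "- 1" \<xi>' \<psi>] by (simp add: scaleC_minus_one)

lemma cpk_diff4: "q s (\<xi>, \<psi> - \<psi>') = q s (\<xi>, \<psi>) - q s (\<xi>, \<psi>')"
  using cpk_lin4[of s \<xi> 1 \<psi> "- 1" \<psi>'] by (simp add: scaleC_minus_one)

lemma cpk_proj: "finite F \<Longrightarrow> orthonormal F \<Longrightarrow> (\<Sum>f\<in>F. Re (q (f, \<phi>) (f, \<phi>))) \<le> c * (norm \<phi>)\<^sup>2"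
  using q unfolding cp_kernel_def by blast

lemma cpk_diag_bound: "Re (q (\<eta>, \<phi>) (\<eta>, \<phi>)) \<le> c * (norm \<eta> * norm \<phi>)\<^sup>2"
proof (cases "\<eta> = 0")
  case True
  then show ?thesis using cpk_scale(1)[of 0 0 \<phi> "(0, \<phi>)"] by simp
next
  case False
  define f where "f = complex_of_real (1 / norm \<eta>) *\<^sub>C \<eta>"
  have f: "norm f = 1" "\<eta> = complex_of_real (norm \<eta>) *\<^sub>C f"
    using False by (auto simp: f_def norm_scaleC scaleC_scaleC norm_divide simp flip: of_real_mult)
  have "q (\<eta>, \<phi>) (\<eta>, \<phi>) = complex_of_real ((norm \<eta>)\<^sup>2) * q (f, \<phi>) (f, \<phi>)"
    by (subst (1 2) f(2)) (simp add: cpk_scale power2_eq_square)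
  moreover have "Re (q (f, \<phi>) (f, \<phi>)) \<le> c * (norm \<phi>)\<^sup>2"
    using cpk_proj[of "{f}" \<phi>] f(1) by (simp add: orthonormal_def)
  ultimately show ?thesis
    using mult_left_mono[of "Re (q (f, \<phi>) (f, \<phi>))" "c * (norm \<phi>)\<^sup>2" "(norm \<eta>)\<^sup>2"]
    by (simp add: power_mult_distrib mult_ac)
qed

lemma cpk_bound: "cmod (q (\<eta>, \<phi>) (\<xi>, \<psi>)) \<le> c * (norm \<eta> * norm \<phi> * (norm \<xi> * norm \<psi>))"
proof (rule power2_le_imp_le)
  have "(cmod (q (\<eta>, \<phi>) (\<xi>, \<psi>)))\<^sup>2 \<le> Re (q (\<eta>, \<phi>) (\<eta>, \<phi>)) * Re (q (\<xi>, \<psi>) (\<xi>, \<psi>))"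
    by (rule psd_cauchy_schwarz[OF cpk_psd])
  also have "\<dots> \<le> (c * (norm \<eta> * norm \<phi>)\<^sup>2) * (c * (norm \<xi> * norm \<psi>)\<^sup>2)"
    by (rule mult_mono[OF cpk_diag_bound cpk_diag_bound]) (simp_all add: c psd_self(2)[OF cpk_psd])
  finally show "(cmod (q (\<eta>, \<phi>) (\<xi>, \<psi>)))\<^sup>2 \<le> (c * (norm \<eta> * norm \<phi> * (norm \<xi> * norm \<psi>)))\<^sup>2"
    by (simp add: power_mult_distrib power2_eq_square mult_ac)
qed (simp add: c)

definition cpk_modulus where
  "cpk_modulus \<eta> \<phi> \<xi> \<psi> \<eta>' \<phi>' \<xi>' \<psi>' =
     c * (norm (\<eta>' - \<eta>) * norm \<phi>' * (norm \<xi>' * norm \<psi>')) + c * (norm \<eta> * norm (\<phi>' - \<phi>) * (norm \<xi>' * norm \<psi>'))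
     + c * (norm \<eta> * norm \<phi> * (norm (\<xi>' - \<xi>) * norm \<psi>')) + c * (norm \<eta> * norm \<phi> * (norm \<xi> * norm (\<psi>' - \<psi>)))"

text \<open>The arguments are changed one at a time.\<close>

lemma cpk_modulus_bound:
  "cmod (q (\<eta>', \<phi>') (\<xi>', \<psi>') - q (\<eta>, \<phi>) (\<xi>, \<psi>)) \<le> cpk_modulus \<eta> \<phi> \<xi> \<psi> \<eta>' \<phi>' \<xi>' \<psi>'"
proof -
  have "q (\<eta>', \<phi>') (\<xi>', \<psi>') - q (\<eta>, \<phi>) (\<xi>, \<psi>) =
    q (\<eta>' - \<eta>, \<phi>') (\<xi>', \<psi>') + q (\<eta>, \<phi>' - \<phi>) (\<xi>', \<psi>') + q (\<eta>, \<phi>) (\<xi>' - \<xi>, \<psi>') + q (\<eta>, \<phi>) (\<xi>, \<psi>' - \<psi>)"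
    by (simp add: cpk_diff1 cpk_diff2 cpk_diff3 cpk_diff4)
  also have "cmod \<dots> \<le> cpk_modulus \<eta> \<phi> \<xi> \<psi> \<eta>' \<phi>' \<xi>' \<psi>'"
    unfolding cpk_modulus_def by (intro norm_triangle_le add_mono cpk_bound)
  finally show ?thesis .
qed

lemma cpk_modulus_tendsto:
  assumes "(f \<longlongrightarrow> \<eta>) F" "(g \<longlongrightarrow> \<phi>) F" "(h \<longlongrightarrow> \<xi>) F" "(k \<longlongrightarrow> \<psi>) F"
  shows "((\<lambda>x. cpk_modulus \<eta> \<phi> \<xi> \<psi> (f x) (g x) (h x) (k x)) \<longlongrightarrow> 0) F"
proof -
  have "((\<lambda>x. cpk_modulus \<eta> \<phi> \<xi> \<psi> (f x) (g x) (h x) (k x)) \<longlongrightarrow> cpk_modulus \<eta> \<phi> \<xi> \<psi> \<eta> \<phi> \<xi> \<psi>) F"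
    unfolding cpk_modulus_def by (intro tendsto_intros assms)
  then show ?thesis by (simp add: cpk_modulus_def)
qed

lemma cpk_tendsto:
  assumes "(f \<longlongrightarrow> \<eta>) F" "(g \<longlongrightarrow> \<phi>) F" "(h \<longlongrightarrow> \<xi>) F" "(k \<longlongrightarrow> \<psi>) F"
  shows "((\<lambda>x. q (f x, g x) (h x, k x)) \<longlongrightarrow> q (\<eta>, \<phi>) (\<xi>, \<psi>)) F"
proof -
  have "((\<lambda>x. q (f x, g x) (h x, k x) - q (\<eta>, \<phi>) (\<xi>, \<psi>)) \<longlongrightarrow> 0) F"
    by (rule Lim_null_comparison[OF _ cpk_modulus_tendsto[OF assms]])
      (intro always_eventually allI cpk_modulus_bound)
  then show ?thesis by (simp add: LIM_zero_iff)
qed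

text \<open>A section of the kernel is a bounded sesquilinear form, hence given by an operator.\<close>

lemma cpk_riesz: "\<exists>B. bounded_clinear B \<and> (\<forall>\<xi> \<psi>. q s (\<xi>, \<psi>) = cinner \<xi> (B \<psi>))"
proof -
  obtain \<eta> \<phi> where s: "s = (\<eta>, \<phi>)" by fastforce
  have "\<exists>z. \<forall>\<xi>. q (\<xi>, \<psi>) s = cinner z \<xi>" for \<psi>
  proof (rule riesz_representation[of "\<lambda>\<xi>. q (\<xi>, \<psi>) s" "c * (norm \<psi> * (norm \<eta> * norm \<phi>))"])
    show "q (x + y, \<psi>) s = q (x, \<psi>) s + q (y, \<psi>) s" for x y
      using cpk_lin1[of 1 x 1 y \<psi> s] by simp
    show "cmod (q (x, \<psi>) s) \<le> c * (norm \<psi> * (norm \<eta> * norm \<phi>)) * norm x" for x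
      using cpk_bound[of x \<psi> \<eta> \<phi>] by (simp add: s mult_ac)
  qed (auto simp: cpk_scale)
  then obtain B where B: "\<And>\<psi> \<xi>. q (\<xi>, \<psi>) s = cinner (B \<psi>) \<xi>" by metis
  have B': "q s (\<xi>, \<psi>) = cinner \<xi> (B \<psi>)" for \<xi> \<psi>
    using cpk_herm[of s "(\<xi>, \<psi>)"] B[of \<xi> \<psi>] by (simp flip: cinner_commute)
  have "bounded_clinear B"
  proof (rule bounded_clinearI)
    show "B (x + y) = B x + B y" for x y
      using cpk_lin4[of s _ 1 x 1 y] by (intro cinner_eqI) (simp add: B' cinner_add_right)
    show "B (a *\<^sub>C x) = a *\<^sub>C B x" for a x
      using cpk_lin4[of s _ a x 0 0] by (intro cinner_eqI) (simp add: B' cinner_scaleC_right)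
    show "norm (B x) \<le> norm x * (c * (norm \<eta> * norm \<phi>))" for x
    proof -
      have "norm (B x) * norm (B x) = cmod (q s (B x, x))"
        by (simp add: B' cinner_eq_norm power2_eq_square norm_mult)
      also have "\<dots> \<le> norm (B x) * (norm x * (c * (norm \<eta> * norm \<phi>)))"
        using cpk_bound[of \<eta> \<phi> "B x" x] by (simp add: s mult_ac)
      finally show ?thesis
        by (cases "norm (B x) = 0") (auto simp: c)
    qed
  qed
  with B' show ?thesis by blast
qed

text \<open>The Kraus operators represent the Cholesky factors of the kernel, which are combinations of its
  sections. The bound on finite rank projections makes \<open>\<Sum>\<parallel>B\<^sub>k \<phi>\<parallel>\<^sup>2\<close> converge.\<close>

lemma cpk_kraus:
  assumes sepK: "separable_space (euclidean :: 'k topology)" and sepV: "separable_space (euclidean :: 'v topology)"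
  obtains B :: "nat \<Rightarrow> 'v \<Rightarrow> 'k" where "\<And>k. bounded_clinear (B k)"
    "\<And>\<eta> \<phi> \<xi> \<psi>. (\<lambda>k. cnj (cinner \<eta> (B k \<phi>)) * cinner \<xi> (B k \<psi>)) sums q (\<eta>, \<phi>) (\<xi>, \<psi>)"
    "\<And>\<phi>. summable (\<lambda>k. (norm (B k \<phi>))\<^sup>2)"
proof -
  obtain eK :: "nat \<Rightarrow> 'k" where eK: "\<And>x \<epsilon>. \<epsilon> > 0 \<Longrightarrow> \<exists>k. dist (eK k) x < \<epsilon>"
    using separable_dense_sequence[OF sepK] by blast
  obtain eV :: "nat \<Rightarrow> 'v" where eV: "\<And>x \<epsilon>. \<epsilon> > 0 \<Longrightarrow> \<exists>k. dist (eV k) x < \<epsilon>"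
    using separable_dense_sequence[OF sepV] by blast
  define e where "e k = (eK (fst (prod_decode k)), eV (snd (prod_decode k)))" for k
  let ?P = "\<lambda>f. \<exists>B. bounded_clinear B \<and> (\<forall>\<xi> \<psi>. f (\<xi>, \<psi>) = cinner \<xi> (B \<psi>))"
  obtain l where l: "\<And>k. ?P (l k)" and sums: "\<And>s t. (\<lambda>k. cnj (l k s) * l k t) sums q s t"
  proof (rule psd_factorization[of q e ?P])
    show "psd_kernel q" by (rule cpk_psd)
    show "?P (q (e k))" for k by (rule cpk_riesz)
    show "\<exists>k. Re (q s s - q s (e k) - q (e k) s + q (e k) (e k)) < \<epsilon>" if \<epsilon>: "\<epsilon> > 0" for s \<epsilon>
    proof -
      obtain \<eta> \<phi> where s: "s = (\<eta>, \<phi>)" by fastforce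
      have "\<exists>i. dist (eK i) \<eta> < inverse (real (Suc n))" "\<exists>j. dist (eV j) \<phi> < inverse (real (Suc n))" for n
        using eK[of "inverse (real (Suc n))"] eV[of "inverse (real (Suc n))"] by auto
      then obtain i j where ij: "\<And>n. dist (eK (i n)) \<eta> < inverse (real (Suc n))"
        "\<And>n. dist (eV (j n)) \<phi> < inverse (real (Suc n))" by metis
      have lim: "(\<lambda>n. eK (i n)) \<longlonglongrightarrow> \<eta>" "(\<lambda>n. eV (j n)) \<longlonglongrightarrow> \<phi>"
        using ij by (auto intro!: metric_tendsto_imp_tendsto[OF LIMSEQ_inverse_real_of_nat]
            always_eventually less_imp_le)
      let ?e = "\<lambda>n. (eK (i n), eV (j n))"
      have "(\<lambda>n. Re (q s s - q s (?e n) - q (?e n) s + q (?e n) (?e n))) \<longlonglongrightarrow> Re (q s s - q s s - q s s + q s s)"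
        unfolding s by (intro tendsto_intros cpk_tendsto lim)
      then have "\<forall>\<^sub>F n in sequentially. Re (q s s - q s (?e n) - q (?e n) s + q (?e n) (?e n)) < \<epsilon>"
        using \<epsilon> by (intro order_tendstoD(2)[where a = \<epsilon>]) auto
      then obtain n where n: "Re (q s s - q s (?e n) - q (?e n) s + q (?e n) (?e n)) < \<epsilon>"
        by (auto simp: eventually_sequentially)
      have "e (prod_encode (i n, j n)) = ?e n" by (simp add: e_def)
      with n show ?thesis by metis
    qed
    show "?P (\<lambda>t. a * f t + b * g t)" if fg: "?P f" "?P g" for f g a b
    proof -
      from fg obtain B1 B2 where B1: "bounded_clinear B1" "\<And>\<xi> \<psi>. f (\<xi>, \<psi>) = cinner \<xi> (B1 \<psi>)"
        and B2: "bounded_clinear B2" "\<And>\<xi> \<psi>. g (\<xi>, \<psi>) = cinner \<xi> (B2 \<psi>)" by blast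
      show ?thesis
        using bounded_clinear_add[OF bounded_clinear_scaleC[OF B1(1)] bounded_clinear_scaleC[OF B2(1)]]
        by (intro exI[of _ "\<lambda>\<psi>. a *\<^sub>C B1 \<psi> + b *\<^sub>C B2 \<psi>"])
          (simp add: B1(2) B2(2) cinner_add_right cinner_scaleC_right)
    qed
  qed (blast intro: that)
  from l have "\<exists>B. \<forall>k. bounded_clinear (B k) \<and> (\<forall>\<xi> \<psi>. l k (\<xi>, \<psi>) = cinner \<xi> (B k \<psi>))" by (intro choice) blast
  then obtain B where B: "\<And>k. bounded_clinear (B k)" "\<And>k \<xi> \<psi>. l k (\<xi>, \<psi>) = cinner \<xi> (B k \<psi>)" by blast
  have s: "(\<lambda>k. cnj (cinner \<eta> (B k \<phi>)) * cinner \<xi> (B k \<psi>)) sums q (\<eta>, \<phi>) (\<xi>, \<psi>)" for \<eta> \<phi> \<xi> \<psi>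
    using sums[of "(\<eta>, \<phi>)" "(\<xi>, \<psi>)"] by (simp add: B(2))
  have "summable (\<lambda>k. (norm (B k \<phi>))\<^sup>2)" for \<phi>
  proof -
    obtain E :: "'k set" where E: "is_onb E" using onb_exists by blast
    have "(\<Sum>k<n. (norm (B k \<phi>))\<^sup>2) \<le> c * (norm \<phi>)\<^sup>2" for n
    proof (rule has_sum_le_finite_sums)
      show "((\<lambda>f. \<Sum>k<n. (cmod (cinner f (B k \<phi>)))\<^sup>2) has_sum (\<Sum>k<n. (norm (B k \<phi>))\<^sup>2)) E"
        by (intro sum_has_sum_finite parseval_norm E)
      fix F assume F: "finite F" "F \<subseteq> E"
      have "(\<Sum>k<n. (cmod (cinner f (B k \<phi>)))\<^sup>2) \<le> Re (q (f, \<phi>) (f, \<phi>))" for f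
      proof -
        have "cnj (cinner f (B k \<phi>)) * cinner f (B k \<phi>) = complex_of_real ((cmod (cinner f (B k \<phi>)))\<^sup>2)" for k
          by (metis complex_norm_square mult.commute)
        then have "(\<lambda>k. complex_of_real ((cmod (cinner f (B k \<phi>)))\<^sup>2)) sums q (f, \<phi>) (f, \<phi>)"
          using s[of f \<phi> f \<phi>] by simp
        from sums_Re[OF this] have "(\<lambda>k. (cmod (cinner f (B k \<phi>)))\<^sup>2) sums Re (q (f, \<phi>) (f, \<phi>))" by simp
        then show ?thesis
          using sum_le_suminf[of "\<lambda>k. (cmod (cinner f (B k \<phi>)))\<^sup>2" "{..<n}"] by (simp add: sums_iff)
      qed
      then have "(\<Sum>f\<in>F. \<Sum>k<n. (cmod (cinner f (B k \<phi>)))\<^sup>2) \<le> (\<Sum>f\<in>F. Re (q (f, \<phi>) (f, \<phi>)))"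
        by (rule sum_mono)
      also have "\<dots> \<le> c * (norm \<phi>)\<^sup>2"
        using F orthonormal_subset[OF is_onb_orthonormal[OF E]] by (intro cpk_proj) auto
      finally show "(\<Sum>f\<in>F. \<Sum>k<n. (cmod (cinner f (B k \<phi>)))\<^sup>2) \<le> c * (norm \<phi>)\<^sup>2" .
    qed
    then show ?thesis by (intro summableI_nonneg_bounded) auto
  qed
  with B s show ?thesis using that by blast
qed

end

lemma cp_kernel_limit:
  assumes qn: "\<And>n. cp_kernel c (q n)" and c: "0 \<le> c" and lim: "\<And>s t. (\<lambda>n. q n s t) \<longlonglongrightarrow> q' s t"
  shows "cp_kernel c q'"
proof -
  have "psd_kernel q'" unfolding psd_kernel_def
  proof (intro allI)
    fix m and x :: "nat \<Rightarrow> 'a \<times> 'b" and a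
    have "(\<lambda>n. \<Sum>i<m. \<Sum>j<m. cnj (a i) * a j * q n (x i) (x j))
        \<longlonglongrightarrow> (\<Sum>i<m. \<Sum>j<m. cnj (a i) * a j * q' (x i) (x j))"
      by (intro tendsto_intros lim)
    moreover have "(\<Sum>i<m. \<Sum>j<m. cnj (a i) * a j * q n (x i) (x j)) \<in> \<real>\<^sub>\<ge>\<^sub>0" for n
      using qn[of n] by (simp add: cp_kernel_def psd_kernel_def)
    ultimately show "(\<Sum>i<m. \<Sum>j<m. cnj (a i) * a j * q' (x i) (x j)) \<in> \<real>\<^sub>\<ge>\<^sub>0"
      by (intro Lim_in_closed_set[OF closed_nonneg_Reals_complex]) auto
  qed
  moreover have "q' (a *\<^sub>C \<eta> + b *\<^sub>C \<eta>', \<phi>) t = a * q' (\<eta>, \<phi>) t + b * q' (\<eta>', \<phi>) t" for a b \<eta> \<eta>' \<phi> t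
  proof (rule LIMSEQ_unique[OF lim])
    have "(\<lambda>n. a * q n (\<eta>, \<phi>) t + b * q n (\<eta>', \<phi>) t) \<longlonglongrightarrow> a * q' (\<eta>, \<phi>) t + b * q' (\<eta>', \<phi>) t"
      by (intro tendsto_intros lim)
    then show "(\<lambda>n. q n (a *\<^sub>C \<eta> + b *\<^sub>C \<eta>', \<phi>) t) \<longlonglongrightarrow> a * q' (\<eta>, \<phi>) t + b * q' (\<eta>', \<phi>) t"
      unfolding cpk_lin1[OF qn c] .
  qed
  moreover have "q' (\<eta>, a *\<^sub>C \<phi> + b *\<^sub>C \<phi>') t = cnj a * q' (\<eta>, \<phi>) t + cnj b * q' (\<eta>, \<phi>') t" for a b \<eta> \<phi> \<phi>' t
  proof (rule LIMSEQ_unique[OF lim])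
    have "(\<lambda>n. cnj a * q n (\<eta>, \<phi>) t + cnj b * q n (\<eta>, \<phi>') t) \<longlonglongrightarrow> cnj a * q' (\<eta>, \<phi>) t + cnj b * q' (\<eta>, \<phi>') t"
      by (intro tendsto_intros lim)
    then show "(\<lambda>n. q n (\<eta>, a *\<^sub>C \<phi> + b *\<^sub>C \<phi>') t) \<longlonglongrightarrow> cnj a * q' (\<eta>, \<phi>) t + cnj b * q' (\<eta>, \<phi>') t"
      unfolding cpk_lin2[OF qn c] .
  qed
  moreover have "(\<Sum>f\<in>F. Re (q' (f, \<phi>) (f, \<phi>))) \<le> c * (norm \<phi>)\<^sup>2" if "finite F" "orthonormal F" for F \<phi>
  proof (rule LIMSEQ_le_const2)
    show "(\<lambda>n. \<Sum>f\<in>F. Re (q n (f, \<phi>) (f, \<phi>))) \<longlonglongrightarrow> (\<Sum>f\<in>F. Re (q' (f, \<phi>) (f, \<phi>)))"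
      by (intro tendsto_intros lim)
    show "\<exists>N. \<forall>n\<ge>N. (\<Sum>f\<in>F. Re (q n (f, \<phi>) (f, \<phi>))) \<le> c * (norm \<phi>)\<^sup>2"
      using cpk_proj[OF qn c that] by blast
  qed
  ultimately show ?thesis unfolding cp_kernel_def by blast
qed

text \<open>Sequential compactness: a diagonal sequence converges on a countable dense set, and the common
  modulus of continuity extends the convergence to all arguments.\<close>

lemma cp_kernel_compact:
  fixes q :: "nat \<Rightarrow> 'k::chilbert_space \<times> 'v::chilbert_space \<Rightarrow> 'k \<times> 'v \<Rightarrow> complex"
  assumes sepK: "separable_space (euclidean :: 'k topology)" and sepV: "separable_space (euclidean :: 'v topology)"
    and qn: "\<And>n. cp_kernel c (q n)" and c: "0 \<le> c"
  shows "\<exists>r q'. strict_mono r \<and> cp_kernel c q' \<and> (\<forall>s t. (\<lambda>n. q (r n) s t) \<longlonglongrightarrow> q' s t)"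
proof -
  obtain eK :: "nat \<Rightarrow> 'k" where eK: "\<And>x \<epsilon>. \<epsilon> > 0 \<Longrightarrow> \<exists>k. dist (eK k) x < \<epsilon>"
    using separable_dense_sequence[OF sepK] by blast
  obtain eV :: "nat \<Rightarrow> 'v" where eV: "\<And>x \<epsilon>. \<epsilon> > 0 \<Longrightarrow> \<exists>k. dist (eV k) x < \<epsilon>"
    using separable_dense_sequence[OF sepV] by blast
  define N where "N = (\<lambda>(i, j, k, l). norm (eK i) * norm (eV j) * (norm (eK k) * norm (eV l)))"
  define f where "f n = (\<lambda>(i, j, k, l). q n (eK i, eV j) (eK k, eV l) / complex_of_real (1 + N (i, j, k, l)))" for n
  have N: "N p \<ge> 0" for p by (cases p) (simp add: N_def)
  have bound: "norm (f n p) \<le> c" for n p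
  proof -
    obtain i j k l where p: "p = (i, j, k, l)" by (cases p)
    have "norm (q n (eK i, eV j) (eK k, eV l)) \<le> c * N p"
      using cpk_bound[OF qn c, of n "eK i" "eV j" "eK k" "eV l"] by (simp add: N_def p)
    also have "\<dots> \<le> c * (1 + N p)" using c by (intro mult_left_mono) auto
    finally have "norm (q n (eK i, eV j) (eK k, eV l)) / (1 + N p) \<le> c"
      using N[of p] by (simp add: divide_le_eq)
    moreover have "norm (f n p) = norm (q n (eK i, eV j) (eK k, eV l)) / (1 + N p)"
    proof -
      have "cmod (complex_of_real (1 + N p)) = 1 + N p" unfolding norm_of_real using N[of p] by simp
      then show ?thesis by (simp add: f_def p norm_divide)
    qed
    ultimately show ?thesis by simp
  qed
  obtain r where r: "strict_mono r" and rl: "\<And>p. \<exists>l. (\<lambda>n. f (r n) p) \<longlonglongrightarrow> l"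
    using function_convergent_subsequence[of "UNIV :: (nat \<times> nat \<times> nat \<times> nat) set" f c] bound by auto
  have dense: "convergent (\<lambda>n. q (r n) (eK i, eV j) (eK k, eV l))" for i j k l
  proof -
    obtain m where "(\<lambda>n. f (r n) (i, j, k, l)) \<longlonglongrightarrow> m" using rl by blast
    then have "(\<lambda>n. f (r n) (i, j, k, l) * complex_of_real (1 + N (i, j, k, l))) \<longlonglongrightarrow> m * complex_of_real (1 + N (i, j, k, l))"
      by (rule tendsto_mult_right)
    moreover have "complex_of_real (1 + N (i, j, k, l)) \<noteq> 0"
      using N[of "(i, j, k, l)"] unfolding of_real_eq_0_iff by linarith
    ultimately show ?thesis unfolding convergent_def by (auto simp: f_def)
  qed
  have "convergent (\<lambda>n. q (r n) (\<eta>, \<phi>) (\<xi>, \<psi>))" for \<eta> \<phi> \<xi> \<psi>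
  proof -
    have "Cauchy (\<lambda>n. q (r n) (\<eta>, \<phi>) (\<xi>, \<psi>))"
    proof (rule CauchyI)
      fix \<epsilon> :: real assume \<epsilon>: "\<epsilon> > 0"
      have "\<exists>i. dist (eK i) x < inverse (real (Suc n))" "\<exists>j. dist (eV j) y < inverse (real (Suc n))" for n x y
        using eK[of "inverse (real (Suc n))"] eV[of "inverse (real (Suc n))"] by auto
      then obtain i j k l where ij: "\<And>n. dist (eK (i n)) \<eta> < inverse (real (Suc n))"
        "\<And>n. dist (eV (j n)) \<phi> < inverse (real (Suc n))"
        "\<And>n. dist (eK (k n)) \<xi> < inverse (real (Suc n))"
        "\<And>n. dist (eV (l n)) \<psi> < inverse (real (Suc n))" by metis
      have lim: "(\<lambda>n. eK (i n)) \<longlonglongrightarrow> \<eta>" "(\<lambda>n. eV (j n)) \<longlonglongrightarrow> \<phi>" "(\<lambda>n. eK (k n)) \<longlonglongrightarrow> \<xi>" "(\<lambda>n. eV (l n)) \<longlonglongrightarrow> \<psi>"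
        using ij by (auto intro!: metric_tendsto_imp_tendsto[OF LIMSEQ_inverse_real_of_nat]
            always_eventually less_imp_le)
      let ?M = "cpk_modulus c \<eta> \<phi> \<xi> \<psi>"
      have "\<forall>\<^sub>F n in sequentially. ?M (eK (i n)) (eV (j n)) (eK (k n)) (eV (l n)) < \<epsilon> / 3"
        using order_tendstoD(2)[OF cpk_modulus_tendsto[OF qn c lim], of "\<epsilon> / 3"] \<epsilon> by simp
      then obtain m where m: "?M (eK (i m)) (eV (j m)) (eK (k m)) (eV (l m)) < \<epsilon> / 3"
        by (auto simp: eventually_sequentially)
      let ?a = "\<lambda>n. q (r n) (\<eta>, \<phi>) (\<xi>, \<psi>)"
      let ?b = "\<lambda>n. q (r n) (eK (i m), eV (j m)) (eK (k m), eV (l m))"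
      have ab: "cmod (?b n - ?a n) < \<epsilon> / 3" for n
        using cpk_modulus_bound[OF qn c] m by (rule le_less_trans)
      have "Cauchy ?b" using dense by (simp add: Cauchy_convergent_iff)
      then obtain M where M: "\<And>n n'. n \<ge> M \<Longrightarrow> n' \<ge> M \<Longrightarrow> cmod (?b n - ?b n') < \<epsilon> / 3"
        using CauchyD[of ?b "\<epsilon> / 3"] \<epsilon> by auto
      have "cmod (?a n - ?a n') < \<epsilon>" if "n \<ge> M" "n' \<ge> M" for n n'
      proof -
        have "cmod (?a n - ?a n') = cmod ((?b n - ?b n') - (?b n - ?a n) + (?b n' - ?a n'))" by simp
        also have "\<dots> \<le> cmod (?b n - ?b n') + cmod (?b n - ?a n) + cmod (?b n' - ?a n')"
          by (meson add_mono_thms_linordered_semiring(3) norm_triangle_ineq norm_triangle_ineq4 order_trans)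
        also have "\<dots> < \<epsilon>" using M[OF that] ab[of n] ab[of n'] by linarith
        finally show ?thesis .
      qed
      then show "\<exists>M. \<forall>n\<ge>M. \<forall>n'\<ge>M. norm (?a n - ?a n') < \<epsilon>" by blast
    qed
    then show ?thesis by (simp add: Cauchy_convergent_iff)
  qed
  then have "\<exists>l. (\<lambda>n. q (r n) s t) \<longlonglongrightarrow> l" for s t
    by (cases s, cases t) (auto simp: convergent_def)
  then obtain q' where q': "\<And>s t. (\<lambda>n. q (r n) s t) \<longlonglongrightarrow> q' s t" by metis
  have "cp_kernel c q'" by (rule cp_kernel_limit[OF qn c q'])
  with r q' show ?thesis by blast
qed

section \<open>Normal functionals given by square-summable families of vectors\<close>

text \<open>The functional \<open>b \<mapsto> tr[S b]\<close> with \<open>S = \<Sum>|y\<^sub>k\<rangle>\<langle>y\<^sub>k|\<close>.\<close>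

definition vsum :: "(nat \<Rightarrow> 'k::chilbert_space) \<Rightarrow> ('k \<Rightarrow> 'k) \<Rightarrow> complex" where
  "vsum y b = (\<Sum>k. cinner (y k) (b (y k)))"

context
  fixes y :: "nat \<Rightarrow> 'k::chilbert_space"
  assumes y: "summable (\<lambda>k. (norm (y k))\<^sup>2)"
begin

lemma vsum_term_bound:
  assumes "\<And>x. norm (b x) \<le> C * norm x"
  shows "cmod (cinner (y k) (b (y k))) \<le> C * (norm (y k))\<^sup>2"
proof -
  have "cmod (cinner (y k) (b (y k))) \<le> norm (y k) * norm (b (y k))" by (rule cinner_cauchy_schwarz)
  also have "\<dots> \<le> norm (y k) * (C * norm (y k))" by (intro mult_left_mono assms) simp
  finally show ?thesis by (simp add: power2_eq_square mult_ac)
qed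

lemma vsum_abs_summable:
  assumes "bounded_clinear b" shows "summable (\<lambda>k. cmod (cinner (y k) (b (y k))))"
proof (rule summable_comparison_test')
  show "summable (\<lambda>k. onorm b * (norm (y k))\<^sup>2)" by (rule summable_mult[OF y])
  show "norm (cmod (cinner (y k) (b (y k)))) \<le> onorm b * (norm (y k))\<^sup>2" for k
    using vsum_term_bound[of b "onorm b" k, OF bclin_bound[OF assms]] by simp
qed

lemma vsum_summable: "bounded_clinear b \<Longrightarrow> summable (\<lambda>k. cinner (y k) (b (y k)))"
  by (rule summable_norm_cancel[OF vsum_abs_summable])

lemma vsum_bound:
  assumes "\<And>x. norm (b x) \<le> C * norm x" "bounded_clinear b"
  shows "cmod (vsum y b) \<le> C * (\<Sum>k. (norm (y k))\<^sup>2)"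
proof -
  have "cmod (vsum y b) \<le> (\<Sum>k. cmod (cinner (y k) (b (y k))))"
    unfolding vsum_def by (rule summable_norm[OF vsum_abs_summable[OF assms(2)]])
  also have "\<dots> \<le> (\<Sum>k. C * (norm (y k))\<^sup>2)"
    by (rule suminf_le[OF vsum_term_bound[OF assms(1)] vsum_abs_summable[OF assms(2)] summable_mult[OF y]])
  also have "\<dots> = C * (\<Sum>k. (norm (y k))\<^sup>2)" by (rule suminf_mult[OF y])
  finally show ?thesis .
qed

lemma vsum_lin:
  assumes "bounded_clinear a" "bounded_clinear b"
  shows "vsum y (\<lambda>x. \<alpha> *\<^sub>C a x + \<beta> *\<^sub>C b x) = \<alpha> * vsum y a + \<beta> * vsum y b"
proof -
  have "(\<lambda>k. \<alpha> * cinner (y k) (a (y k)) + \<beta> * cinner (y k) (b (y k))) sums (\<alpha> * vsum y a + \<beta> * vsum y b)"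
    unfolding vsum_def by (rule sums_add[OF sums_mult[OF summable_sums[OF vsum_summable[OF assms(1)]]]
        sums_mult[OF summable_sums[OF vsum_summable[OF assms(2)]]]])
  then show ?thesis by (simp add: vsum_def cinner_add_right cinner_scaleC_right sums_iff)
qed

lemma vsum_id: "vsum y id = complex_of_real (\<Sum>k. (norm (y k))\<^sup>2)"
  using suminf_of_real[OF y, where 'a = complex] by (simp only: vsum_def cinner_eq_norm id_apply)

lemma vsum_compress:
  assumes E: "is_onb E" "countable E" and b: "bounded_clinear b"
  shows "(\<lambda>n. vsum y (compress E b n)) \<longlonglongrightarrow> vsum y b"
  unfolding vsum_def
proof (rule tannerys_theorem[THEN conjunct2, THEN conjunct2])
  show "summable (\<lambda>k. onorm b * (norm (y k))\<^sup>2)" by (rule summable_mult[OF y])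
  show "\<forall>\<^sub>F (k, n) in at_top \<times>\<^sub>F sequentially. norm (cinner (y k) (compress E b n (y k))) \<le> onorm b * (norm (y k))\<^sup>2"
    using vsum_term_bound[OF compress_props(2)[OF E b]] by (intro always_eventually) auto
qed (auto intro: compress_props(3)[OF E b])

end

lemma vsum_zero: "vsum y (\<lambda>_. 0) = 0"
  by (simp add: vsum_def)

text \<open>By normality such a functional is determined by its values on rank one operators.\<close>

lemma vsum_eqI:
  fixes y z :: "nat \<Rightarrow> 'k::chilbert_space"
  assumes sep: "separable_space (euclidean :: 'k topology)"
    and y: "summable (\<lambda>k. (norm (y k))\<^sup>2)" and z: "summable (\<lambda>k. (norm (z k))\<^sup>2)"
    and eq: "\<And>\<eta> \<xi>. vsum y (rank1 \<eta> \<xi>) = vsum z (rank1 \<eta> \<xi>)" and b: "bounded_clinear b"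
  shows "vsum y b = vsum z b"
proof -
  obtain E :: "'k set" where E: "is_onb E" using onb_exists by blast
  have cE: "countable E" by (rule onb_countable[OF E sep])
  have fin: "bounded_clinear (\<lambda>x. \<Sum>i\<in>I. a i *\<^sub>C c i x) \<and>
      vsum y (\<lambda>x. \<Sum>i\<in>I. a i *\<^sub>C c i x) = vsum z (\<lambda>x. \<Sum>i\<in>I. a i *\<^sub>C c i x)"
    if "finite I" "\<And>i. i \<in> I \<Longrightarrow> bounded_clinear (c i) \<and> vsum y (c i) = vsum z (c i)"
    for I and a :: "'k \<Rightarrow> complex" and c :: "'k \<Rightarrow> 'k \<Rightarrow> 'k"
    using that
  proof (induction I rule: finite_induct)
    case (insert i I)
    then have IH: "bounded_clinear (\<lambda>x. \<Sum>i\<in>I. a i *\<^sub>C c i x)" "bounded_clinear (c i)"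
      and e: "vsum y (\<lambda>x. \<Sum>i\<in>I. a i *\<^sub>C c i x) = vsum z (\<lambda>x. \<Sum>i\<in>I. a i *\<^sub>C c i x)" "vsum y (c i) = vsum z (c i)"
      by auto
    have s: "(\<lambda>x. \<Sum>i\<in>insert i I. a i *\<^sub>C c i x) = (\<lambda>x. a i *\<^sub>C c i x + 1 *\<^sub>C (\<Sum>i\<in>I. a i *\<^sub>C c i x))"
      using insert by simp
    show ?case unfolding s vsum_lin[OF y IH(2,1)] vsum_lin[OF z IH(2,1)] e
      using bounded_clinear_add[OF bounded_clinear_scaleC[OF IH(2)] bounded_clinear_scaleC[OF IH(1)]] by blast
  qed (simp add: vsum_zero)
  have "vsum y (compress E b n) = vsum z (compress E b n)" for n
  proof -
    note ex = exhaust_filterlim(1)[OF cE, of n]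
    have inner: "bounded_clinear (\<lambda>x. \<Sum>f\<in>exhaust E n. cinner e (b f) *\<^sub>C rank1 e f x) \<and>
        vsum y (\<lambda>x. \<Sum>f\<in>exhaust E n. cinner e (b f) *\<^sub>C rank1 e f x)
          = vsum z (\<lambda>x. \<Sum>f\<in>exhaust E n. cinner e (b f) *\<^sub>C rank1 e f x)" for e
      by (rule fin[OF ex]) (simp add: eq)
    show ?thesis
      using fin[OF ex inner, of "\<lambda>_. 1"] unfolding compress_props(4)[OF E cE b] by simp
  qed
  then have "(\<lambda>n. vsum y (compress E b n)) \<longlonglongrightarrow> vsum z b" using vsum_compress[OF z E cE b] by simp
  with vsum_compress[OF y E cE b] show ?thesis by (rule LIMSEQ_unique)
qed

section \<open>Covariant instruments\<close>

text \<open>For unitary \<open>U\<^sub>g\<close> the distance of \<open>U\<^sub>g\<^sup>* x\<close> from \<open>y = U\<^sub>h\<^sup>* x\<close> is the distance of \<open>U\<^sub>h y\<close> from \<open>U\<^sub>g y\<close>.\<close>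

lemma unitary_family_cadjoint_continuous:
  fixes U :: "'g::topological_space \<Rightarrow> 'a::chilbert_space \<Rightarrow> 'a"
  assumes U: "\<And>g. unitary_op (U g)" and c: "strongly_continuous U"
  shows "continuous_on UNIV (\<lambda>g. cadjoint (U g) x)"
  unfolding continuous_on_def
proof
  fix g0
  have "((\<lambda>g. U g (cadjoint (U g0) x)) \<longlongrightarrow> U g0 (cadjoint (U g0) x)) (at g0)"
    using c unfolding strongly_continuous_def continuous_on_def by blast
  then have lim: "((\<lambda>g. U g (cadjoint (U g0) x)) \<longlongrightarrow> x) (at g0)"
    by (simp add: U)
  have "((\<lambda>g. norm (U g (cadjoint (U g0) x) - x)) \<longlongrightarrow> 0) (at g0)"
    using tendsto_norm[OF tendsto_diff[OF lim tendsto_const[of x]]] by simp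
  moreover have "norm (U g (cadjoint (U g0) x) - x) = norm (cadjoint (U g) x - cadjoint (U g0) x)" for g
  proof -
    have "norm (cadjoint (U g) x - cadjoint (U g0) x) = norm (U g (cadjoint (U g) x - cadjoint (U g0) x))"
      by (rule unitary_op_norm[OF U, symmetric])
    also have "\<dots> = norm (x - U g (cadjoint (U g0) x))"
      by (simp add: bclin_diff[OF unitary_op_bounded[OF U]] U)
    finally show ?thesis by (simp add: norm_minus_commute)
  qed
  ultimately have "((\<lambda>g. norm (cadjoint (U g) x - cadjoint (U g0) x)) \<longlongrightarrow> 0) (at g0)" by simp
  then have "((\<lambda>g. cadjoint (U g) x - cadjoint (U g0) x) \<longlongrightarrow> 0) (at g0)"
    by (rule tendsto_norm_zero_cancel)
  then show "((\<lambda>g. cadjoint (U g) x) \<longlongrightarrow> cadjoint (U g0) x) (at g0 within UNIV)"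
    by (simp add: LIM_zero_iff)
qed

locale covariant_instrument = compact_homogeneous_space H \<nu>G \<nu>H \<nu>\<Omega>
  for H :: "'g::{topological_group_add, second_countable_topology, t2_space} set"
    and \<nu>G \<nu>H :: "'g measure" and \<nu>\<Omega> :: "'g set measure" +
  fixes W :: "'g \<Rightarrow> 'v::chilbert_space \<Rightarrow> 'v" and u :: "'g \<Rightarrow> 'k::chilbert_space \<Rightarrow> 'k"
    and d :: real and \<Gamma> :: "('k \<Rightarrow> 'k) \<Rightarrow> 'g set set \<Rightarrow> 'v \<Rightarrow> 'v"
  assumes sepV: "separable_space (euclidean :: 'v topology)"
    and sepK: "separable_space (euclidean :: 'k topology)"
    and W: "unitary_rep W" and d: "d > 0"
    and square_integrable: "\<And>\<phi> \<psi>. norm \<phi> = 1 \<Longrightarrow> norm \<psi> = 1 \<Longrightarrow> (LINT g|\<nu>G. (cmod (cinner \<phi> (W g \<psi>)))\<^sup>2) = d"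
    and u: "projective_unitary_rep u"
    and \<Gamma>: "\<Gamma> \<in> covariant_instruments H u W"
begin

lemma W_unitary [simp]: "unitary_op (W g)" and W_add: "W (g + h) x = W g (W h x)"
  and W_continuous: "continuous_on UNIV (\<lambda>g. W g x)"
  using W by (auto simp: unitary_rep_def strongly_continuous_def)

lemma W_adj_continuous: "continuous_on UNIV (\<lambda>g. cadjoint (W g) x)"
  using W by (intro unitary_family_cadjoint_continuous) (auto simp: unitary_rep_def)

lemma W_minus: "W (- g) x = cadjoint (W g) x"
proof -
  have "W 0 (W 0 y) = W 0 y" for y by (simp flip: W_add)
  then have "W 0 y = y" for y by (metis W_unitary unitary_op_cancel(1))
  then have "W g (W (- g) x) = x" by (simp flip: W_add)
  then show ?thesis by (metis W_unitary unitary_op_cancel(1))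
qed

lemma W_adj_add: "cadjoint (W (g + h)) x = cadjoint (W h) (cadjoint (W g) x)"
  by (simp only: W_minus[symmetric] minus_add W_add)

lemma u_unitary [simp]: "unitary_op (u g)"
  using u by (simp add: projective_unitary_rep_def)

lemma u_adj_continuous: "continuous_on UNIV (\<lambda>g. cadjoint (u g) x)"
  using u by (intro unitary_family_cadjoint_continuous) (auto simp: projective_unitary_rep_def)

lemma u_add: "\<exists>c. cmod c = 1 \<and> (\<forall>x. u (g + h) x = c *\<^sub>C u g (u h x))"
  using u unfolding projective_unitary_rep_def by blast

lemma phase_mult: "cmod c = 1 \<Longrightarrow> c * cnj c = 1"
  by (metis complex_norm_square of_real_1 one_power2)

text \<open>The cocycle contributes only a phase, which cancels in all expressions that are sesquilinear in
  \<open>u\<close>.\<close>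

lemma u_adj_add: "\<exists>c. cmod c = 1 \<and> (\<forall>x. cadjoint (u (g + h)) x = c *\<^sub>C cadjoint (u h) (cadjoint (u g) x))"
proof -
  obtain c where c: "cmod c = 1" "\<And>x. u (g + h) x = c *\<^sub>C u g (u h x)" using u_add by blast
  have "cadjoint (u (g + h)) x = cnj c *\<^sub>C cadjoint (u h) (cadjoint (u g) x)" for x
  proof -
    have "u (g + h) (cnj c *\<^sub>C cadjoint (u h) (cadjoint (u g) x)) = x"
      by (simp add: bclin_scaleC[OF unitary_op_bounded] c(2) scaleC_scaleC phase_mult[OF c(1)])
    then show ?thesis by (metis u_unitary unitary_op_cancel(1))
  qed
  then show ?thesis using c(1) by (intro exI[of _ "cnj c"]) simp
qed

subsection \<open>The kernels of an instrument\<close>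

context
  fixes X assumes X: "X \<in> sets (coset_borel H)"
begin

lemma \<Gamma>_normal: "normal_cp_map (\<lambda>b. \<Gamma> b X)"
  using \<Gamma> X by (simp add: covariant_instruments_def)

lemma \<Gamma>_bounded: "bounded_clinear b \<Longrightarrow> bounded_clinear (\<Gamma> b X)"
  using \<Gamma>_normal by (simp add: normal_cp_map_def)

lemma \<Gamma>_lin:
  "bounded_clinear a \<Longrightarrow> bounded_clinear b \<Longrightarrow> \<Gamma> (\<lambda>x. \<alpha> *\<^sub>C a x + \<beta> *\<^sub>C b x) X \<phi> = \<alpha> *\<^sub>C \<Gamma> a X \<phi> + \<beta> *\<^sub>C \<Gamma> b X \<phi>"
proof -
  assume a: "bounded_clinear a" and b: "bounded_clinear b"
  have "operator_map_linear (\<lambda>b. \<Gamma> b X)" using \<Gamma>_normal by (simp add: normal_cp_map_def)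
  from this[unfolded operator_map_linear_def, rule_format, OF a b, of \<alpha> \<beta>]
  show ?thesis by (rule fun_cong)
qed

lemma \<Gamma>_positive_matrix:
  assumes "\<And>i j. bounded_clinear (A i j)" "positive_matrix n A"
  shows "(\<Sum>i<n. \<Sum>j<n. cinner (x i) (\<Gamma> (A i j) X (x j))) \<in> \<real>\<^sub>\<ge>\<^sub>0"
  using \<Gamma>_normal assms unfolding normal_cp_map_def positive_matrix_def by blast

lemma \<Gamma>_positive:
  assumes "positive_op b" shows "positive_op (\<Gamma> b X)"
proof -
  have "cinner \<phi> (\<Gamma> b X \<phi>) \<in> \<real>\<^sub>\<ge>\<^sub>0" for \<phi>
    using \<Gamma>_positive_matrix[of "\<lambda>_ _. b" 1 "\<lambda>_. \<phi>"] assms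
    by (simp add: positive_matrix_def positive_op_def)
  then show ?thesis using \<Gamma>_bounded assms by (simp add: positive_op_def)
qed

lemma \<Gamma>_cov:
  "bounded_clinear b \<Longrightarrow> \<Gamma> (u g \<circ> b \<circ> cadjoint (u g)) (translate g X) \<phi> = W g (\<Gamma> b X (cadjoint (W g) \<phi>))"
  using \<Gamma> X by (simp add: covariant_instruments_def)

lemma \<Gamma>_zero: "\<Gamma> (\<lambda>_. 0) X \<phi> = 0"
  using \<Gamma>_lin[of "\<lambda>_. 0" "\<lambda>_. 0" 0 0 \<phi>] by simp

lemma \<Gamma>_sum:
  assumes "finite I" "\<And>i. i \<in> I \<Longrightarrow> bounded_clinear (b i)"
  shows "\<Gamma> (\<lambda>x. \<Sum>i\<in>I. b i x) X \<phi> = (\<Sum>i\<in>I. \<Gamma> (b i) X \<phi>)"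
  using assms
proof (induction I rule: finite_induct)
  case (insert i I)
  then have "\<Gamma> (\<lambda>x. 1 *\<^sub>C b i x + 1 *\<^sub>C (\<Sum>i\<in>I. b i x)) X \<phi>
      = 1 *\<^sub>C \<Gamma> (b i) X \<phi> + 1 *\<^sub>C \<Gamma> (\<lambda>x. \<Sum>i\<in>I. b i x) X \<phi>"
    by (intro \<Gamma>_lin bounded_clinear_sum) auto
  with insert show ?case by simp
qed (simp add: \<Gamma>_zero)

text \<open>The operator \<open>I - P\<close> is positive for the projection \<open>P\<close> onto the span of \<open>F\<close>.\<close>

lemma \<Gamma>_proj_le:
  assumes F: "finite F" "orthonormal F"
  shows "(\<Sum>f\<in>F. Re (cinner \<phi> (\<Gamma> (rank1 f f) X \<phi>))) \<le> Re (cinner \<phi> (\<Gamma> id X \<phi>))"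
proof -
  define b where "b = (\<lambda>x. 1 *\<^sub>C id x + (- 1) *\<^sub>C proj_on F x)"
  have "positive_op b" unfolding positive_op_def
  proof (intro conjI allI)
    show "bounded_clinear b" unfolding b_def
      by (rule bounded_clinear_add[OF bounded_clinear_scaleC bounded_clinear_scaleC]) simp_all
    fix x
    have "cinner (proj_on F x) (x - proj_on F x) = 0"
      using cinner_proj_on[OF F(2,1), of x x] cinner_proj_on(2)[OF F(2,1), of x x]
      by (simp add: cinner_diff_right)
    then have "cinner x (b x) = cinner (x - proj_on F x) (x - proj_on F x)"
      by (simp add: b_def scaleC_minus_one cinner_diff_left)
    then show "cinner x (b x) \<in> \<real>\<^sub>\<ge>\<^sub>0" by (simp add: cinner_eq_norm complex_nonneg_Reals_iff)
  qed
  from positive_op_Re[OF \<Gamma>_positive[OF this], of \<phi>]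
  have "0 \<le> Re (cinner \<phi> (\<Gamma> id X \<phi>)) - Re (cinner \<phi> (\<Gamma> (proj_on F) X \<phi>))"
    unfolding b_def by (subst (asm) \<Gamma>_lin) (simp_all add: cinner_diff_right scaleC_minus_one)
  moreover have "proj_on F = (\<lambda>x. \<Sum>f\<in>F. rank1 f f x)"
    by (simp add: proj_on_def rank1_apply fun_eq_iff)
  then have "cinner \<phi> (\<Gamma> (proj_on F) X \<phi>) = (\<Sum>f\<in>F. cinner \<phi> (\<Gamma> (rank1 f f) X \<phi>))"
    using F(1) by (simp add: \<Gamma>_sum cinner_sum_right)
  ultimately show ?thesis by simp
qed

end

definition kernel :: "'g set set \<Rightarrow> 'k \<times> 'v \<Rightarrow> 'k \<times> 'v \<Rightarrow> complex" where
  "kernel X s t = cinner (snd s) (\<Gamma> (rank1 (fst s) (fst t)) X (snd t))"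

text \<open>The transformation of the arguments of \<open>kernel\<close> that corresponds to translating \<open>X\<close> by \<open>g\<close>.\<close>

definition act :: "'g \<Rightarrow> 'k \<times> 'v \<Rightarrow> 'k \<times> 'v" where
  "act g s = (cadjoint (u g) (fst s), cadjoint (W g) (snd s))"

lemma kernel_translate:
  assumes X: "X \<in> sets (coset_borel H)"
  shows "kernel (translate g X) s t = kernel X (act g s) (act g t)"
proof -
  have "rank1 (fst s) (fst t) = u g \<circ> rank1 (cadjoint (u g) (fst s)) (cadjoint (u g) (fst t)) \<circ> cadjoint (u g)"
    by (simp add: fun_eq_iff rank1_apply bclin_scaleC[OF unitary_op_bounded] unitary_op_cadjoint_cinner)
  then have "\<Gamma> (rank1 (fst s) (fst t)) (translate g X) (snd t)
     = W g (\<Gamma> (rank1 (cadjoint (u g) (fst s)) (cadjoint (u g) (fst t))) X (cadjoint (W g) (snd t)))"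
    using \<Gamma>_cov[OF X, of "rank1 (cadjoint (u g) (fst s)) (cadjoint (u g) (fst t))"] by simp
  then show ?thesis by (simp add: kernel_def act_def cadjoint_exists)
qed

text \<open>Complete positivity, applied to the positive operator matrix with entries \<open>|\<eta>\<^sub>i\<rangle>\<langle>\<eta>\<^sub>j|\<close>.\<close>

lemma psd_kernel_instrument:
  assumes X: "X \<in> sets (coset_borel H)" shows "psd_kernel (kernel X)"
  unfolding psd_kernel_def
proof (intro allI)
  fix n and x :: "nat \<Rightarrow> 'k \<times> 'v" and a :: "nat \<Rightarrow> complex"
  have "positive_matrix n (\<lambda>i j. rank1 (fst (x i)) (fst (x j)))"
    unfolding positive_matrix_def
  proof
    fix y :: "nat \<Rightarrow> 'k"
    define z where "z = (\<Sum>i<n. cinner (fst (x i)) (y i))"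
    have "(\<Sum>i<n. \<Sum>j<n. cinner (y i) (rank1 (fst (x i)) (fst (x j)) (y j))) = (\<Sum>i<n. \<Sum>j<n. cnj (cinner (fst (x i)) (y i)) * cinner (fst (x j)) (y j))"
    proof (intro sum.cong refl)
      fix i j
      show "cinner (y i) (rank1 (fst (x i)) (fst (x j)) (y j)) = cnj (cinner (fst (x i)) (y i)) * cinner (fst (x j)) (y j)"
        unfolding rank1_apply cinner_scaleC_right cinner_commute[of "y i" "fst (x i)"] by (rule mult.commute)
    qed
    also have "\<dots> = cnj z * z" by (simp add: z_def sum_product)
    also have "\<dots> = complex_of_real ((cmod z)\<^sup>2)" by (metis complex_norm_square mult.commute)
    finally show "(\<Sum>i<n. \<Sum>j<n. cinner (y i) (rank1 (fst (x i)) (fst (x j)) (y j))) \<in> \<real>\<^sub>\<ge>\<^sub>0"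
      by (simp add: complex_nonneg_Reals_iff)
  qed
  from \<Gamma>_positive_matrix[OF X _ this, of "\<lambda>i. a i *\<^sub>C snd (x i)"]
  show "(\<Sum>i<n. \<Sum>j<n. cnj (a i) * a j * kernel X (x i) (x j)) \<in> \<real>\<^sub>\<ge>\<^sub>0"
    by (simp add: kernel_def bclin_scaleC[OF \<Gamma>_bounded[OF X]] cinner_scaleC_left cinner_scaleC_right mult_ac)
qed

subsection \<open>The scalar measures of an instrument\<close>

text \<open>Countable additivity, tested on the trace class operator \<open>|\<phi>\<rangle>\<langle>\<phi>|\<close>.\<close>

lemma \<Gamma>_sums:
  assumes b: "bounded_clinear b" and X: "range X \<subseteq> sets (coset_borel H)" "disjoint_family X"
  shows "(\<lambda>j. cinner \<phi> (\<Gamma> b (X j) \<phi>)) sums cinner \<phi> (\<Gamma> b (\<Union>j. X j) \<phi>)"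
proof -
  have "(\<lambda>j. tr (rank1 \<phi> \<phi> \<circ> \<Gamma> b (X j))) sums tr (rank1 \<phi> \<phi> \<circ> \<Gamma> b (\<Union>j. X j))"
    using \<Gamma> b X trace_class_rank1[of \<phi>] unfolding covariant_instruments_def by blast
  moreover have "X j \<in> sets (coset_borel H)" "(\<Union>j. X j) \<in> sets (coset_borel H)" for j
    using X(1) by auto
  ultimately show ?thesis using b by (simp add: tr_rank1_comp \<Gamma>_bounded)
qed

definition instr_measure :: "('k \<Rightarrow> 'k) \<Rightarrow> 'v \<Rightarrow> 'g set measure" where
  "instr_measure b \<phi> = measure_of (cosets H) (sets (coset_borel H)) (\<lambda>X. ennreal (Re (cinner \<phi> (\<Gamma> b X \<phi>))))"

lemma sets_instr_measure [measurable_cong]: "sets (instr_measure b \<phi>) = sets (coset_borel H)"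
  unfolding instr_measure_def
  using sets.sigma_sets_eq[of "coset_borel H"] sets.space_closed[of "coset_borel H"]
  by (subst sets_measure_of) auto

lemma space_instr_measure [simp]: "space (instr_measure b \<phi>) = cosets H"
  using sets_eq_imp_space_eq[OF sets_instr_measure] by simp

lemma emeasure_instr_measure:
  assumes b: "positive_op b" and X: "X \<in> sets (coset_borel H)"
  shows "emeasure (instr_measure b \<phi>) X = ennreal (Re (cinner \<phi> (\<Gamma> b X \<phi>)))"
  unfolding instr_measure_def
proof (rule emeasure_measure_of_sigma)
  note bb = positive_op_bounded[OF b]
  show "sigma_algebra (cosets H) (sets (coset_borel H))"
    using sets.sigma_algebra_axioms[of "coset_borel H"] by simp
  have "(\<lambda>j::nat. cinner \<phi> (\<Gamma> b {} \<phi>)) sums cinner \<phi> (\<Gamma> b {} \<phi>)"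
    using \<Gamma>_sums[OF bb, of "\<lambda>_. {}" \<phi>] by (simp add: disjoint_family_on_def)
  then have "(\<lambda>j::nat. cinner \<phi> (\<Gamma> b {} \<phi>)) \<longlonglongrightarrow> 0"
    by (intro summable_LIMSEQ_zero) (auto simp: summable_def)
  then have "cinner \<phi> (\<Gamma> b {} \<phi>) = 0" by (simp add: LIMSEQ_const_iff)
  then show "positive (sets (coset_borel H)) (\<lambda>X. ennreal (Re (cinner \<phi> (\<Gamma> b X \<phi>))))"
    by (simp add: positive_def)
  show "countably_additive (sets (coset_borel H)) (\<lambda>X. ennreal (Re (cinner \<phi> (\<Gamma> b X \<phi>))))"
  proof (rule countably_additiveI)
    fix A :: "nat \<Rightarrow> 'g set set" assume A: "range A \<subseteq> sets (coset_borel H)" "disjoint_family A"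
    have "0 \<le> Re (cinner \<phi> (\<Gamma> b (A i) \<phi>))" for i
      using A(1) by (intro positive_op_Re \<Gamma>_positive b) auto
    then show "(\<Sum>i. ennreal (Re (cinner \<phi> (\<Gamma> b (A i) \<phi>)))) = ennreal (Re (cinner \<phi> (\<Gamma> b (\<Union> (range A)) \<phi>)))"
      using sums_Re[OF \<Gamma>_sums[OF bb A]] by (rule suminf_ennreal_eq)
  qed
qed (rule X)

lemma finite_instr_measure: "positive_op b \<Longrightarrow> finite_measure (instr_measure b \<phi>)"
  by (rule finite_measureI) (simp add: emeasure_instr_measure sets.top[of "coset_borel H", simplified])

lemma instr_swap:
  assumes b: "positive_op b" and S: "S \<in> sets (borel \<Otimes>\<^sub>M coset_borel H)"
  shows "(\<integral>\<^sup>+x. emeasure (instr_measure b \<phi>) {\<omega>. (x, \<omega>) \<in> S} \<partial>\<nu>G)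
    = (\<integral>\<^sup>+\<omega>. emeasure \<nu>G {x. (x, \<omega>) \<in> S} \<partial>instr_measure b \<phi>)"
proof -
  interpret G: sigma_finite_measure \<nu>G by (rule sigma_finite_nuG)
  interpret M: finite_measure "instr_measure b \<phi>" by (rule finite_instr_measure[OF b])
  interpret P: pair_sigma_finite \<nu>G "instr_measure b \<phi>" ..
  have S': "S \<in> sets (\<nu>G \<Otimes>\<^sub>M instr_measure b \<phi>)"
    using S by (simp cong: sets_pair_measure_cong add: sets_pair_measure_cong[OF sets_nuG sets_instr_measure])
  from M.emeasure_pair_measure_alt[OF S'] P.emeasure_pair_measure_alt2[OF S']
  show ?thesis by (simp add: vimage_def)
qed

lemma id_positive: "positive_op (id :: 'a::chilbert_space \<Rightarrow> 'a)"
  by (simp add: positive_op_def cinner_eq_norm complex_nonneg_Reals_iff)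

lemma cosets_sets: "cosets H \<in> sets (coset_borel H)"
  using sets.top[of "coset_borel H"] by simp

lemma \<Gamma>_id_total: "\<Gamma> id (cosets H) = id"
  using \<Gamma> by (simp add: covariant_instruments_def)

subsection \<open>Square integrability bounds the instrument by the invariant measure\<close>

text \<open>A Bochner integral with nonzero value belongs to an integrable function, so the hypothesis on unit
  vectors gives an actual integral; the general case follows by scaling.\<close>

lemma nn_square_integral:
  "(\<integral>\<^sup>+g. ennreal ((cmod (cinner \<phi> (W g \<psi>)))\<^sup>2) \<partial>\<nu>G) = ennreal (d * ((norm \<phi>)\<^sup>2 * (norm \<psi>)\<^sup>2))"
proof (cases "\<phi> = 0 \<or> \<psi> = 0")
  case True
  then show ?thesis by (auto simp: bclin_zero[OF unitary_op_bounded])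
next
  case False
  define \<phi>' \<psi>' where "\<phi>' = (1 / norm \<phi>) *\<^sub>R \<phi>" and "\<psi>' = (1 / norm \<psi>) *\<^sub>R \<psi>"
  have n: "norm \<phi>' = 1" "norm \<psi>' = 1" using False by (simp_all add: \<phi>'_def \<psi>'_def)
  have e: "(cmod (cinner \<phi> (W g \<psi>)))\<^sup>2 = ((norm \<phi>)\<^sup>2 * (norm \<psi>)\<^sup>2) * (cmod (cinner \<phi>' (W g \<psi>')))\<^sup>2" for g
  proof -
    have "\<phi> = norm \<phi> *\<^sub>R \<phi>'" "\<psi> = complex_of_real (norm \<psi>) *\<^sub>C \<psi>'"
      using False by (simp_all add: \<phi>'_def \<psi>'_def flip: scaleR_scaleC)
    then have "cinner \<phi> (W g \<psi>) = complex_of_real (norm \<phi> * norm \<psi>) * cinner \<phi>' (W g \<psi>')"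
      by (metis (no_types, lifting) bclin_scaleC cinner_scaleC_right cinner_scaleR_left mult.assoc
          of_real_mult scaleR_conv_of_real unitary_op_bounded W_unitary mult.left_commute)
    then show ?thesis by (simp add: norm_mult power_mult_distrib)
  qed
  let ?f = "\<lambda>g. (cmod (cinner \<phi>' (W g \<psi>')))\<^sup>2"
  have int: "(LINT g|\<nu>G. ?f g) = d" by (rule square_integrable[OF n])
  then have "integrable \<nu>G ?f" using d not_integrable_integral_eq[of \<nu>G ?f] by (metis less_irrefl)
  then have "(\<integral>\<^sup>+g. ennreal (?f g) \<partial>\<nu>G) = ennreal d"
    using nn_integral_eq_integral[of \<nu>G ?f] int by simp
  moreover have "?f \<in> borel_measurable \<nu>G" using \<open>integrable \<nu>G ?f\<close> by (rule borel_measurable_integrable)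
  ultimately show ?thesis
    unfolding e by (simp add: ennreal_mult nn_integral_cmult mult.commute[of d] less_imp_le[OF d])
qed

text \<open>By covariance the integrand is the measure of the translate of \<open>X\<close> by \<open>- g\<close>. For a point \<open>hH\<close> of
  \<open>\<Omega>\<close> the group elements that move it into \<open>X\<close> form a right translate of the preimage of \<open>X\<close>, whose
  measure does not depend on \<open>h\<close> because \<open>G\<close> is unimodular.\<close>

lemma orbit_integral:
  assumes X: "X \<in> sets (coset_borel H)"
  shows "(\<integral>\<^sup>+g. ennreal (Re (cinner (W g \<psi>) (\<Gamma> id X (W g \<psi>)))) \<partial>\<nu>G) = emeasure \<nu>G (lift X) * ennreal ((norm \<psi>)\<^sup>2)"
proof -
  define S where "S = {p \<in> space (borel \<Otimes>\<^sub>M coset_borel H). fst p +o snd p \<in> X}"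
  have S: "S \<in> sets (borel \<Otimes>\<^sub>M coset_borel H)"
    using measurable_sets[OF measurable_action X] by (simp add: S_def vimage_def Int_def conj_commute)
  have S1: "{\<omega>. (g, \<omega>) \<in> S} = translate (- g) X" for g
    using sets_subset_cosets[OF X] by (simp add: S_def space_pair_measure translate_eq)
  have S2: "emeasure \<nu>G {g. (g, \<omega>) \<in> S} = emeasure \<nu>G (lift X)" if \<omega>: "\<omega> \<in> cosets H" for \<omega>
  proof -
    obtain h where h: "\<omega> = coset h" using \<omega> by (rule cosetsE)
    have "{g. (g, \<omega>) \<in> S} = {g. g + h \<in> lift X}" by (auto simp: S_def space_pair_measure h act_coset)
    then show ?thesis using right_invariant[OF lift_sets[OF X]] by simp
  qed
  have "ennreal (Re (cinner (W g \<psi>) (\<Gamma> id X (W g \<psi>)))) = emeasure (instr_measure id \<psi>) {\<omega>. (g, \<omega>) \<in> S}" for g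
  proof -
    have "\<Gamma> id (translate (- g) X) \<psi> = \<Gamma> (u (- g) \<circ> id \<circ> cadjoint (u (- g))) (translate (- g) X) \<psi>"
    proof -
      have "u (- g) \<circ> id \<circ> cadjoint (u (- g)) = id" by (simp add: fun_eq_iff)
      then show ?thesis by simp
    qed
    also have "\<dots> = W (- g) (\<Gamma> id X (cadjoint (W (- g)) \<psi>))" by (rule \<Gamma>_cov[OF X]) simp
    also have "cadjoint (W (- g)) \<psi> = W g \<psi>" using W_minus[of "- g" \<psi>] by simp
    finally have "cinner \<psi> (\<Gamma> id (translate (- g) X) \<psi>) = cinner (W g \<psi>) (\<Gamma> id X (W g \<psi>))"
      unfolding W_minus by (simp only: cadjoint_right[OF unitary_op_bounded[OF W_unitary]])
    then show ?thesis unfolding S1 by (simp add: emeasure_instr_measure id_positive translate_sets X)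
  qed
  then have "(\<integral>\<^sup>+g. ennreal (Re (cinner (W g \<psi>) (\<Gamma> id X (W g \<psi>)))) \<partial>\<nu>G)
      = (\<integral>\<^sup>+\<omega>. emeasure \<nu>G {g. (g, \<omega>) \<in> S} \<partial>instr_measure id \<psi>)"
    using instr_swap[OF id_positive S, of \<psi>] by simp
  also have "\<dots> = (\<integral>\<^sup>+\<omega>. emeasure \<nu>G (lift X) \<partial>instr_measure id \<psi>)"
    by (rule nn_integral_cong) (simp add: S2)
  also have "\<dots> = emeasure \<nu>G (lift X) * ennreal ((norm \<psi>)\<^sup>2)"
    by (simp add: emeasure_instr_measure id_positive cosets_sets \<Gamma>_id_total cinner_eq_norm)
  finally show ?thesis .
qed

text \<open>The Cauchy--Schwarz inequality \<open>|\<langle>A\<phi>|W(g)\<phi>\<rangle>|\<^sup>2 \<le> \<langle>\<phi>|A\<phi>\<rangle> \<langle>W(g)\<phi>|A W(g)\<phi>\<rangle>\<close> for \<open>A = \<Gamma>(I, X)\<close>,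
  integrated over the group.\<close>

lemma \<Gamma>_id_bound:
  assumes X: "X \<in> sets (coset_borel H)" and fin: "emeasure \<nu>G (lift X) < \<infinity>"
  shows "Re (cinner \<phi> (\<Gamma> id X \<phi>)) \<le> measure \<nu>G (lift X) / d * (norm \<phi>)\<^sup>2"
proof (cases "\<phi> = 0")
  case False
  note A = \<Gamma>_positive[OF X id_positive]
  define A where "A = \<Gamma> id X"
  define a where "a = Re (cinner \<phi> (A \<phi>))"
  define m where "m = measure \<nu>G (lift X)"
  have a: "0 \<le> a" unfolding a_def A_def by (rule positive_op_Re[OF A])
  have m: "0 \<le> m" by (simp add: m_def)
  have em: "emeasure \<nu>G (lift X) = ennreal m"
    using fin by (simp add: m_def emeasure_eq_ennreal_measure less_top)
  have "ennreal (d * ((norm (A \<phi>))\<^sup>2 * (norm \<phi>)\<^sup>2)) = (\<integral>\<^sup>+g. ennreal ((cmod (cinner (A \<phi>) (W g \<phi>)))\<^sup>2) \<partial>\<nu>G)"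
    by (rule nn_square_integral[symmetric])
  also have "\<dots> \<le> (\<integral>\<^sup>+g. ennreal a * ennreal (Re (cinner (W g \<phi>) (A (W g \<phi>)))) \<partial>\<nu>G)"
  proof (rule nn_integral_mono)
    fix g
    have "(cmod (cinner (A \<phi>) (W g \<phi>)))\<^sup>2 \<le> a * Re (cinner (W g \<phi>) (A (W g \<phi>)))"
      using psd_cauchy_schwarz[OF positive_op_psd[OF A], of \<phi> "W g \<phi>"]
      by (simp add: a_def A_def positive_op_selfadjoint[OF A])
    then show "ennreal ((cmod (cinner (A \<phi>) (W g \<phi>)))\<^sup>2) \<le> ennreal a * ennreal (Re (cinner (W g \<phi>) (A (W g \<phi>))))"
      using a by (simp add: A_def ennreal_leI positive_op_Re[OF A] flip: ennreal_mult)
  qed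
  also have "\<dots> = ennreal a * (\<integral>\<^sup>+g. ennreal (Re (cinner (W g \<phi>) (A (W g \<phi>)))) \<partial>\<nu>G)"
  proof (rule nn_integral_cmult)
    have bA: "bounded_clinear A" unfolding A_def by (rule positive_op_bounded[OF A])
    have "continuous_on UNIV A" using bA by (simp add: bounded_clinear_def linear_continuous_on)
    then have "continuous_on UNIV (\<lambda>g. A (W g \<phi>))"
      by (rule continuous_on_compose2[OF _ W_continuous]) simp
    then have "continuous_on UNIV (\<lambda>g. Re (cinner (W g \<phi>) (A (W g \<phi>))))"
      by (intro continuous_intros W_continuous)
    then have "(\<lambda>g. Re (cinner (W g \<phi>) (A (W g \<phi>)))) \<in> borel_measurable borel"
      by (rule borel_measurable_continuous_onI)
    then show "(\<lambda>g. ennreal (Re (cinner (W g \<phi>) (A (W g \<phi>))))) \<in> borel_measurable \<nu>G"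
      by (simp add: measurable_cong_sets[OF sets_nuG refl])
  qed
  also have "\<dots> = ennreal (a * (m * (norm \<phi>)\<^sup>2))"
    using orbit_integral[OF X, of \<phi>] a m by (simp add: A_def em ennreal_mult)
  finally have "d * ((norm (A \<phi>))\<^sup>2 * (norm \<phi>)\<^sup>2) \<le> a * (m * (norm \<phi>)\<^sup>2)"
    using a m by (simp add: ennreal_le_iff)
  then have 1: "d * (norm (A \<phi>))\<^sup>2 \<le> a * m" using False by (simp add: mult.assoc[symmetric])
  have "a \<le> norm \<phi> * norm (A \<phi>)"
    unfolding a_def using cinner_cauchy_schwarz complex_Re_le_cmod order_trans by blast
  then have "a\<^sup>2 \<le> (norm \<phi>)\<^sup>2 * (norm (A \<phi>))\<^sup>2" using a by (metis power_mono power_mult_distrib)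
  then have "d * a\<^sup>2 \<le> (norm \<phi>)\<^sup>2 * (d * (norm (A \<phi>))\<^sup>2)"
    using d mult_left_mono[of "a\<^sup>2" _ d] by (simp add: mult.left_commute)
  also have "\<dots> \<le> (norm \<phi>)\<^sup>2 * (a * m)" by (rule mult_left_mono[OF 1]) simp
  finally have 2: "a * (d * a) \<le> a * (m * (norm \<phi>)\<^sup>2)" by (simp add: power2_eq_square mult_ac)
  have "d * a \<le> m * (norm \<phi>)\<^sup>2"
  proof (cases "a = 0")
    case True
    then show ?thesis using m by simp
  next
    case False
    then show ?thesis using mult_left_le_imp_le[OF 2] a by simp
  qed
  then show ?thesis using d by (simp add: a_def A_def m_def field_simps)
qed (simp add: bclin_zero[OF \<Gamma>_bounded[OF X]])

lemma cp_kernel_instrument: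
  assumes X: "X \<in> sets (coset_borel H)" and fin: "emeasure \<nu>G (lift X) < \<infinity>"
    and pos: "0 < measure \<nu>G (lift X)"
  shows "cp_kernel (1 / d) (\<lambda>s t. kernel X s t / complex_of_real (measure \<nu>G (lift X)))"
proof -
  define m where "m = measure \<nu>G (lift X)"
  have m: "m > 0" using pos by (simp add: m_def)
  note p = psd_kernel_instrument[OF X]
  have lin1: "kernel X (a *\<^sub>C \<eta> + b *\<^sub>C \<eta>', \<phi>) t = a * kernel X (\<eta>, \<phi>) t + b * kernel X (\<eta>', \<phi>) t" for a b \<eta> \<eta>' \<phi> t
  proof -
    have "rank1 (a *\<^sub>C \<eta> + b *\<^sub>C \<eta>') (fst t) = (\<lambda>x. a *\<^sub>C rank1 \<eta> (fst t) x + b *\<^sub>C rank1 \<eta>' (fst t) x)"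
      by (simp add: fun_eq_iff rank1_apply scaleC_add_right scaleC_scaleC mult.commute)
    then show ?thesis by (simp add: kernel_def \<Gamma>_lin[OF X] cinner_add_right cinner_scaleC_right)
  qed
  have "psd_kernel (\<lambda>s t. kernel X s t / complex_of_real m)" unfolding psd_kernel_def
  proof (intro allI)
    fix n and x :: "nat \<Rightarrow> 'k \<times> 'v" and a
    have "(\<Sum>i<n. \<Sum>j<n. cnj (a i) * a j * kernel X (x i) (x j)) \<in> \<real>\<^sub>\<ge>\<^sub>0"
      using p by (simp add: psd_kernel_def)
    then have "(\<Sum>i<n. \<Sum>j<n. cnj (a i) * a j * kernel X (x i) (x j)) / complex_of_real m \<in> \<real>\<^sub>\<ge>\<^sub>0"
      using m by (simp add: complex_nonneg_Reals_iff)
    then show "(\<Sum>i<n. \<Sum>j<n. cnj (a i) * a j * (kernel X (x i) (x j) / complex_of_real m)) \<in> \<real>\<^sub>\<ge>\<^sub>0"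
      by (simp add: sum_divide_distrib)
  qed
  moreover have "(\<Sum>f\<in>F. Re (kernel X (f, \<phi>) (f, \<phi>) / complex_of_real m)) \<le> 1 / d * (norm \<phi>)\<^sup>2"
    if "finite F" "orthonormal F" for F \<phi>
  proof -
    have "(\<Sum>f\<in>F. Re (kernel X (f, \<phi>) (f, \<phi>))) \<le> m / d * (norm \<phi>)\<^sup>2"
      using \<Gamma>_proj_le[OF X that, of \<phi>] \<Gamma>_id_bound[OF X fin, of \<phi>] by (simp add: kernel_def m_def)
    then have "(\<Sum>f\<in>F. Re (kernel X (f, \<phi>) (f, \<phi>))) / m \<le> 1 / d * (norm \<phi>)\<^sup>2"
      using m by (simp add: divide_le_eq mult_ac)
    then show ?thesis by (simp add: sum_divide_distrib)
  qed
  moreover have "kernel X (\<eta>, a *\<^sub>C \<phi> + b *\<^sub>C \<phi>') t = cnj a * kernel X (\<eta>, \<phi>) t + cnj b * kernel X (\<eta>, \<phi>') t" for a b \<eta> \<phi> \<phi>' t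
    by (simp add: kernel_def cinner_add_left cinner_scaleC_left)
  ultimately show ?thesis
    unfolding cp_kernel_def m_def[symmetric] by (simp add: lin1 add_divide_distrib)
qed

end

context covariant_instrument
begin

section \<open>The density of an instrument at the base point\<close>

lemma cpk_act_continuous:
  assumes q: "cp_kernel c q" "0 \<le> c"
  shows "continuous_on UNIV (\<lambda>g. q (act g s) (act g t))"
  unfolding continuous_on_def act_def
  using u_adj_continuous W_adj_continuous by (auto intro!: cpk_tendsto[OF q] simp: continuous_on_def)

lemma cpk_act_bound:
  assumes q: "cp_kernel c q" "0 \<le> c"
  shows "Re (q (act g s) (act g s)) \<le> c * (norm (fst s) * norm (snd s))\<^sup>2"
  using cpk_diag_bound[OF q, of "cadjoint (u g) (fst s)" "cadjoint (W g) (snd s)"]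
  by (simp add: act_def unitary_op_norm_cadjoint)

context
  fixes Y :: "nat \<Rightarrow> 'g set" assumes Y: "shrinking Y"
begin

lemma Y_open: "open (Y n)" and Y_zero: "0 \<in> Y n" and Y_minus: "y \<in> Y n \<Longrightarrow> - y \<in> Y n"
  and Y_left: "y \<in> Y n \<Longrightarrow> h \<in> H \<Longrightarrow> h + y \<in> Y n" and Y_right: "y \<in> Y n \<Longrightarrow> h \<in> H \<Longrightarrow> y + h \<in> Y n"
  and Y_finite: "emeasure \<nu>G (Y n) < \<infinity>" and Y_mono: "m \<le> n \<Longrightarrow> Y n \<subseteq> Y m"
  using Y[unfolded shrinking_def, THEN conjunct1, rule_format, of n]
    Y[unfolded shrinking_def, THEN conjunct2, THEN conjunct1]
  by (simp_all add: decseq_def)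

lemma Y_shrinks: "open (lift X) \<Longrightarrow> g \<in> lift X \<Longrightarrow> \<exists>N. \<forall>n\<ge>N. \<forall>y\<in>Y n. g + y \<in> lift X"
  by (rule Y[unfolded shrinking_def, THEN conjunct2, THEN conjunct2, rule_format])

abbreviation nbhd :: "nat \<Rightarrow> 'g set set" where "nbhd n \<equiv> coset ` Y n"

abbreviation vol :: "nat \<Rightarrow> real" where "vol n \<equiv> measure \<nu>G (Y n)"

lemma lift_nbhd: "lift (nbhd n) = Y n"
  by (rule lift_image_saturated) (rule Y_right)

lemma nbhd_sets: "nbhd n \<in> sets (coset_borel H)"
  by (rule open_image_coset[OF Y_open])

lemma vol_pos: "0 < vol n"
proof -
  have "emeasure \<nu>G (Y n) \<noteq> 0" using Y_zero by (intro open_positive Y_open) auto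
  then have "vol n \<noteq> 0" using Y_finite[of n] by (simp add: measure_def enn2real_eq_0_iff less_top)
  then show ?thesis by (simp add: less_le)
qed

lemma emeasure_Y: "emeasure \<nu>G (Y n) = ennreal (vol n)"
  using Y_finite[of n] by (simp add: emeasure_eq_ennreal_measure less_top)

lemma mem_translate_nbhd: "coset g \<in> translate x (nbhd n) \<longleftrightarrow> - g + x \<in> Y n"
proof -
  have "coset g \<in> translate x (nbhd n) \<longleftrightarrow> g \<in> lift (translate x (nbhd n))" by simp
  also have "\<dots> \<longleftrightarrow> - x + g \<in> Y n"
    using lift_nbhd[of n] by (subst lift_translate) auto
  also have "\<dots> \<longleftrightarrow> - g + x \<in> Y n"
    using Y_minus[of "- x + g" n] Y_minus[of "- g + x" n] by (auto simp: minus_add)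
  finally show ?thesis .
qed

text \<open>The points of \<open>X\<close> whose entire neighbourhood of index \<open>m\<close> lies in \<open>X\<close>. These are closed sets that
  exhaust an open \<open>X\<close>; they replace approximation by compact sets.\<close>

definition core :: "'g set set \<Rightarrow> nat \<Rightarrow> 'g set" where
  "core X m = {g. \<forall>y\<in>Y m. g + y \<in> lift X}"

lemma core_right: "g \<in> core X m \<Longrightarrow> h \<in> H \<Longrightarrow> g + h \<in> core X m"
  using Y_left by (auto simp: core_def add.assoc)

lemma lift_core: "lift (coset ` core X m) = core X m"
  by (rule lift_image_saturated) (rule core_right)

lemma core_subset: "core X m \<subseteq> lift X"
  using Y_zero[of m] by (force simp: core_def)

lemma core_mono: "m \<le> n \<Longrightarrow> core X m \<subseteq> core X n"
  using Y_mono by (fastforce simp: core_def)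

lemma core_union: "open (lift X) \<Longrightarrow> (\<Union>m. core X m) = lift X"
  using core_subset Y_shrinks[of X] by (fastforce simp: core_def)

lemma core_sets: "coset ` core X m \<in> sets (coset_borel H)"
proof -
  have "- core X m = (\<Union>z\<in>- lift X. {g. - z + g \<in> Y m})"
  proof (intro set_eqI iffI)
    fix g assume "g \<in> - core X m"
    then obtain y where y: "y \<in> Y m" "g + y \<notin> lift X" by (auto simp: core_def)
    have "- (g + y) + g = - y" by (simp only: minus_add add.assoc left_minus add_0_right)
    then show "g \<in> (\<Union>z\<in>- lift X. {g. - z + g \<in> Y m})" using y Y_minus[OF y(1)] by fastforce
  next
    fix g assume "g \<in> (\<Union>z\<in>- lift X. {g. - z + g \<in> Y m})"
    then obtain z where z: "z \<notin> lift X" "- z + g \<in> Y m" by blast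
    have "g + - (- z + g) = z" by (simp only: minus_add minus_minus add.assoc[symmetric] right_minus add_0_left)
    with Y_minus[OF z(2)] z(1) show "g \<in> - core X m" unfolding core_def by (metis (no_types, lifting) ComplI mem_Collect_eq)
  qed
  then have "open (- core X m)" by (auto intro!: open_translate Y_open)
  moreover have "lift (cosets H - coset ` core X m) = - core X m" using lift_core[of X m] by auto
  ultimately have "cosets H - coset ` core X m \<in> sets (coset_borel H)" by (intro open_coset_sets) auto
  then have "cosets H - (cosets H - coset ` core X m) \<in> sets (coset_borel H)"
    using sets.compl_sets[of _ "coset_borel H"] by simp
  moreover have "cosets H - (cosets H - coset ` core X m) = coset ` core X m" by auto
  ultimately show ?thesis by simp
qed

lemma core_borel: "core X m \<in> sets borel"
  using lift_sets[OF core_sets[of X m]] by (simp only: lift_core)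

text \<open>Averaging over translates of a small neighbourhood, evaluated by Fubini's theorem.\<close>

lemma nbhd_average:
  assumes b: "positive_op b" and Z: "Z \<in> sets borel"
  shows "(\<integral>\<^sup>+x. emeasure (instr_measure b \<phi>) (translate x (nbhd n)) * indicator Z x \<partial>\<nu>G)
    = (\<integral>\<^sup>+\<omega>. emeasure \<nu>G {x \<in> Z. \<omega> \<in> translate x (nbhd n)} \<partial>instr_measure b \<phi>)"
proof -
  define S where "S = {p \<in> space (borel \<Otimes>\<^sub>M coset_borel H). fst p \<in> Z \<and> - fst p +o snd p \<in> nbhd n}"
  have "(\<lambda>p. - fst p +o snd p) \<in> borel \<Otimes>\<^sub>M coset_borel H \<rightarrow>\<^sub>M coset_borel H"
  proof -
    have "(\<lambda>p :: 'g \<times> 'g set. (- fst p, snd p)) \<in> borel \<Otimes>\<^sub>M coset_borel H \<rightarrow>\<^sub>M borel \<Otimes>\<^sub>M coset_borel H"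
    proof (intro measurable_Pair)
      have "(\<lambda>x :: 'g. - x) \<in> borel_measurable borel"
        by (intro borel_measurable_continuous_onI continuous_intros)
      with measurable_fst[of "borel :: 'g measure" "coset_borel H"]
      show "(\<lambda>p :: 'g \<times> 'g set. - fst p) \<in> borel \<Otimes>\<^sub>M coset_borel H \<rightarrow>\<^sub>M borel" by (rule measurable_compose)
    qed simp
    from measurable_compose[OF this measurable_action] show ?thesis by simp
  qed
  from measurable_sets[OF this nbhd_sets] measurable_sets[OF measurable_fst Z]
  have "((\<lambda>p. - fst p +o snd p) -` nbhd n \<inter> space (borel \<Otimes>\<^sub>M coset_borel H)) \<inter> (fst -` Z \<inter> space (borel \<Otimes>\<^sub>M coset_borel H))
      \<in> sets (borel \<Otimes>\<^sub>M coset_borel H)" by (rule sets.Int)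
  also have "((\<lambda>p. - fst p +o snd p) -` nbhd n \<inter> space (borel \<Otimes>\<^sub>M coset_borel H)) \<inter> (fst -` Z \<inter> space (borel \<Otimes>\<^sub>M coset_borel H)) = S"
    by (auto simp: S_def)
  finally have S: "S \<in> sets (borel \<Otimes>\<^sub>M coset_borel H)" .
  have tr: "translate x (nbhd n) = {\<omega> \<in> cosets H. - x +o \<omega> \<in> nbhd n}" for x
    by (rule translate_eq[OF sets_subset_cosets[OF nbhd_sets]])
  have "{\<omega>. (x, \<omega>) \<in> S} = (if x \<in> Z then translate x (nbhd n) else {})" for x
    unfolding tr by (auto simp: S_def space_pair_measure)
  then have "emeasure (instr_measure b \<phi>) (translate x (nbhd n)) * indicator Z x = emeasure (instr_measure b \<phi>) {\<omega>. (x, \<omega>) \<in> S}" for x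
    by simp
  moreover have "{x. (x, \<omega>) \<in> S} = {x \<in> Z. \<omega> \<in> translate x (nbhd n)}" for \<omega>
    unfolding tr by (auto simp: S_def space_pair_measure)
  ultimately show ?thesis using instr_swap[OF b S, of \<phi>] by simp
qed

text \<open>For a point of the core all group elements that move the small neighbourhood onto it lie over \<open>X\<close>.\<close>

lemma average_core_lower:
  assumes b: "positive_op b" and X: "X \<in> sets (coset_borel H)" and n: "m \<le> n"
  shows "emeasure \<nu>G (Y n) * emeasure (instr_measure b \<phi>) (coset ` core X m)
    \<le> (\<integral>\<^sup>+x. emeasure (instr_measure b \<phi>) (translate x (nbhd n)) * indicator (lift X) x \<partial>\<nu>G)"
proof -
  have "emeasure \<nu>G (Y n) * emeasure (instr_measure b \<phi>) (coset ` core X m)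
      = (\<integral>\<^sup>+\<omega>. emeasure \<nu>G (Y n) * indicator (coset ` core X m) \<omega> \<partial>instr_measure b \<phi>)"
    using core_sets by (simp add: nn_integral_cmult_indicator sets_instr_measure)
  also have "\<dots> \<le> (\<integral>\<^sup>+\<omega>. emeasure \<nu>G {x \<in> lift X. \<omega> \<in> translate x (nbhd n)} \<partial>instr_measure b \<phi>)"
  proof (rule nn_integral_mono)
    fix \<omega>
    show "emeasure \<nu>G (Y n) * indicator (coset ` core X m) \<omega> \<le> emeasure \<nu>G {x \<in> lift X. \<omega> \<in> translate x (nbhd n)}"
    proof (cases "\<omega> \<in> coset ` core X m")
      case True
      then obtain g where g: "g \<in> core X m" "\<omega> = coset g" by blast
      have "x \<in> lift X" if "- g + x \<in> Y n" for x
      proof -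
        have "\<forall>y\<in>Y m. g + y \<in> lift X" using g(1) by (simp add: core_def)
        then have "g + (- g + x) \<in> lift X" using that Y_mono[OF n] by blast
        then show ?thesis by (simp only: add.assoc[symmetric] right_minus add_0_left)
      qed
      then have "{x \<in> lift X. \<omega> \<in> translate x (nbhd n)} = {x. - g + x \<in> Y n}"
        unfolding g(2) mem_translate_nbhd by blast
      then show ?thesis using left_invariant[OF borel_open[OF Y_open]] True by simp
    qed simp
  qed
  also have "\<dots> = (\<integral>\<^sup>+x. emeasure (instr_measure b \<phi>) (translate x (nbhd n)) * indicator (lift X) x \<partial>\<nu>G)"
    by (rule nbhd_average[OF b lift_sets[OF X], symmetric])
  finally show ?thesis .
qed

text \<open>Translating the small neighbourhood by a group element over the core only reaches points of \<open>X\<close>.\<close>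

lemma average_core_upper:
  assumes b: "positive_op b" and X: "X \<in> sets (coset_borel H)" and n: "m \<le> n"
  shows "(\<integral>\<^sup>+x. emeasure (instr_measure b \<phi>) (translate x (nbhd n)) * indicator (core X m) x \<partial>\<nu>G)
    \<le> emeasure \<nu>G (Y n) * emeasure (instr_measure b \<phi>) X"
proof -
  have "(\<integral>\<^sup>+x. emeasure (instr_measure b \<phi>) (translate x (nbhd n)) * indicator (core X m) x \<partial>\<nu>G)
    = (\<integral>\<^sup>+\<omega>. emeasure \<nu>G {x \<in> core X m. \<omega> \<in> translate x (nbhd n)} \<partial>instr_measure b \<phi>)"
    by (rule nbhd_average[OF b core_borel])
  also have "\<dots> \<le> (\<integral>\<^sup>+\<omega>. emeasure \<nu>G (Y n) * indicator X \<omega> \<partial>instr_measure b \<phi>)"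
  proof (rule nn_integral_mono)
    fix \<omega> assume "\<omega> \<in> space (instr_measure b \<phi>)"
    then obtain g where g: "\<omega> = coset g" by (auto elim: cosetsE)
    show "emeasure \<nu>G {x \<in> core X m. \<omega> \<in> translate x (nbhd n)} \<le> emeasure \<nu>G (Y n) * indicator X \<omega>"
    proof (cases "g \<in> lift X")
      case True
      have "emeasure \<nu>G {x \<in> core X m. \<omega> \<in> translate x (nbhd n)} \<le> emeasure \<nu>G {x. - g + x \<in> Y n}"
        unfolding g mem_translate_nbhd
        by (rule emeasure_mono) (auto simp: sets_nuG intro!: borel_open open_translate Y_open)
      then show ?thesis using left_invariant[OF borel_open[OF Y_open]] True g by simp
    next
      case False
      have "- g + x \<notin> Y n" if x: "x \<in> core X m" for x
      proof
        assume "- g + x \<in> Y n"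
        moreover have "\<forall>y\<in>Y m. x + y \<in> lift X" using x by (simp add: core_def)
        ultimately have "x + - (- g + x) \<in> lift X" using Y_minus Y_mono[OF n] by blast
        then have "g \<in> lift X" by (simp only: minus_add minus_minus add.assoc[symmetric] right_minus add_0_left)
        with False show False by simp
      qed
      then have e: "{x \<in> core X m. \<omega> \<in> translate x (nbhd n)} = {}" unfolding g mem_translate_nbhd by blast
      show ?thesis unfolding e by simp
    qed
  qed
  also have "\<dots> = emeasure \<nu>G (Y n) * emeasure (instr_measure b \<phi>) X"
    using X by (simp add: nn_integral_cmult_indicator sets_instr_measure)
  finally show ?thesis .
qed

definition approx :: "nat \<Rightarrow> 'k \<times> 'v \<Rightarrow> 'k \<times> 'v \<Rightarrow> complex" where
  "approx n s t = kernel (nbhd n) s t / complex_of_real (vol n)"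

lemma cp_kernel_approx: "cp_kernel (1 / d) (approx n)"
  unfolding approx_def
  using cp_kernel_instrument[OF nbhd_sets[of n], unfolded lift_nbhd, OF Y_finite vol_pos] .

lemma approx_invariant: "h \<in> H \<Longrightarrow> approx n (act h s) (act h t) = approx n s t"
proof -
  assume h: "h \<in> H"
  have "translate h (nbhd n) = nbhd n"
  proof -
    have "lift (translate h (nbhd n)) = {x. - h + x \<in> Y n}"
      using lift_nbhd[of n] by (subst lift_translate) auto
    also have "\<dots> = Y n"
    proof (intro set_eqI iffI)
      fix x assume "x \<in> {x. - h + x \<in> Y n}"
      from Y_left[OF this[simplified] h] show "x \<in> Y n" by (simp only: add_minus_cancel)
    next
      fix x assume "x \<in> Y n"
      from Y_left[OF this H_minus[OF h]] show "x \<in> {x. - h + x \<in> Y n}" by simp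
    qed
    finally have "lift (translate h (nbhd n)) = lift (nbhd n)" by (simp only: lift_nbhd)
    then have "c \<in> translate h (nbhd n) \<longleftrightarrow> c \<in> nbhd n" if "c \<in> cosets H" for c
      using that by (auto elim!: cosetsE)
    moreover have "translate h (nbhd n) \<subseteq> cosets H" "nbhd n \<subseteq> cosets H"
      using sets_subset_cosets translate_sets nbhd_sets by blast+
    ultimately show ?thesis by blast
  qed
  then show ?thesis using kernel_translate[OF nbhd_sets, of h n s t] by (simp add: approx_def)
qed

lemma emeasure_translate_nbhd:
  "emeasure (instr_measure (rank1 \<eta> \<eta>) \<phi>) (translate x (nbhd n))
    = emeasure \<nu>G (Y n) * ennreal (Re (approx n (act x (\<eta>, \<phi>)) (act x (\<eta>, \<phi>))))"
proof -
  have "emeasure (instr_measure (rank1 \<eta> \<eta>) \<phi>) (translate x (nbhd n)) = ennreal (Re (kernel (translate x (nbhd n)) (\<eta>, \<phi>) (\<eta>, \<phi>)))"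
    by (simp add: emeasure_instr_measure positive_rank1 translate_sets nbhd_sets kernel_def)
  also have "kernel (translate x (nbhd n)) (\<eta>, \<phi>) (\<eta>, \<phi>) = vol n * approx n (act x (\<eta>, \<phi>)) (act x (\<eta>, \<phi>))"
    using vol_pos[of n] by (simp add: kernel_translate nbhd_sets approx_def)
  finally show ?thesis
    using vol_pos[of n] by (simp add: emeasure_Y ennreal_mult')
qed

end

text \<open>The two averaging estimates, divided by the volume of the small neighbourhood, bound the measure of
  \<open>X\<close> from above and from below by integrals of the approximating kernels. These converge by
  dominated convergence, as the kernels are uniformly bounded and \<open>X\<close> has finite measure.\<close>

lemma limit_density_open:
  fixes q :: "'k \<times> 'v \<Rightarrow> 'k \<times> 'v \<Rightarrow> complex"
  assumes Y: "shrinking Y" and r: "strict_mono r" and q: "cp_kernel (1 / d) q"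
    and lim: "\<And>s t. (\<lambda>n. approx Y (r n) s t) \<longlonglongrightarrow> q s t"
    and X: "X \<in> sets (coset_borel H)" "open (lift X)" and fin: "emeasure \<nu>G (lift X) < \<infinity>"
  shows "emeasure (instr_measure (rank1 \<eta> \<eta>) \<phi>) X
    = (\<integral>\<^sup>+g. ennreal (Re (q (act g (\<eta>, \<phi>)) (act g (\<eta>, \<phi>)))) * indicator (lift X) g \<partial>\<nu>G)"
proof (rule antisym)
  have d0: "0 \<le> 1 / d" using d by simp
  define s where "s = (\<eta>, \<phi>)"
  define \<mu> where "\<mu> = instr_measure (rank1 \<eta> \<eta>) \<phi>"
  define F where "F g = ennreal (Re (q (act g s) (act g s)))" for g
  define f where "f n g = ennreal (Re (approx Y n (act g s) (act g s)))" for n g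
  note b = positive_rank1[of \<eta>]
  have meas: "(\<lambda>g. ennreal (Re (q' (act g s) (act g s)))) \<in> borel_measurable \<nu>G" if "cp_kernel (1 / d) q'" for q'
  proof -
    have "(\<lambda>g. Re (q' (act g s) (act g s))) \<in> borel_measurable borel"
      by (intro borel_measurable_continuous_onI continuous_intros cpk_act_continuous[OF that d0])
    then show ?thesis by (simp add: measurable_cong_sets[OF sets_nuG refl])
  qed
  have mF: "F \<in> borel_measurable \<nu>G" and mf: "f n \<in> borel_measurable \<nu>G" for n
    using meas[OF q] meas[OF cp_kernel_approx[OF Y]] by (simp_all add: F_def[abs_def] f_def[abs_def])
  define C where "C = 1 / d * (norm \<eta> * norm \<phi>)\<^sup>2"
  have limZ: "(\<lambda>n. \<integral>\<^sup>+g. f (r n) g * indicator Z g \<partial>\<nu>G) \<longlonglongrightarrow> (\<integral>\<^sup>+g. F g * indicator Z g \<partial>\<nu>G)"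
    if Z: "Z \<in> sets borel" "Z \<subseteq> lift X" for Z
  proof (rule nn_integral_dominated_convergence)
    have iZ: "(indicator Z :: 'g \<Rightarrow> ennreal) \<in> borel_measurable \<nu>G" using Z sets_nuG by simp
    show "(\<lambda>g. f (r n) g * indicator Z g) \<in> borel_measurable \<nu>G" for n
      by (intro borel_measurable_times_ennreal mf iZ)
    show "(\<lambda>g. F g * indicator Z g) \<in> borel_measurable \<nu>G" by (intro borel_measurable_times_ennreal mF iZ)
    have iX: "(indicator (lift X) :: 'g \<Rightarrow> ennreal) \<in> borel_measurable \<nu>G" using lift_sets[OF X(1)] sets_nuG by simp
    then show "(\<lambda>g. ennreal C * indicator (lift X) g) \<in> borel_measurable \<nu>G" by simp
    show "(\<integral>\<^sup>+g. ennreal C * indicator (lift X) g \<partial>\<nu>G) < \<infinity>"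
      using fin lift_sets[OF X(1)] sets_nuG by (simp add: nn_integral_cmult_indicator ennreal_mult_less_top)
    show "AE g in \<nu>G. f (r n) g * indicator Z g \<le> ennreal C * indicator (lift X) g" for n
    proof (rule AE_I2)
      fix g
      have "f (r n) g \<le> ennreal C" unfolding f_def C_def
        using cpk_act_bound[OF cp_kernel_approx[OF Y] d0, of "r n" g s] by (intro ennreal_leI) (simp add: s_def)
      then show "f (r n) g * indicator Z g \<le> ennreal C * indicator (lift X) g"
        using Z(2) by (auto simp: indicator_def)
    qed
    show "AE g in \<nu>G. (\<lambda>n. f (r n) g * indicator Z g) \<longlonglongrightarrow> F g * indicator Z g"
    proof (rule AE_I2)
      fix g
      have "(\<lambda>n. f (r n) g) \<longlonglongrightarrow> F g" unfolding f_def F_def by (intro tendsto_ennrealI tendsto_Re lim)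
      then show "(\<lambda>n. f (r n) g * indicator Z g) \<longlonglongrightarrow> F g * indicator Z g"
        by (cases "g \<in> Z") auto
    qed
  qed
  have yn: "emeasure \<nu>G (Y n) \<noteq> 0" "emeasure \<nu>G (Y n) \<noteq> top" for n
    using vol_pos[OF Y, of n] by (simp_all add: emeasure_Y[OF Y])
  have avg: "(\<integral>\<^sup>+x. emeasure \<mu> (translate x (coset ` Y n)) * indicator Z x \<partial>\<nu>G)
      = emeasure \<nu>G (Y n) * (\<integral>\<^sup>+g. f n g * indicator Z g \<partial>\<nu>G)" if "Z \<in> sets borel" for Z n
  proof -
    have "(\<lambda>g. f n g * indicator Z g) \<in> borel_measurable \<nu>G"
      using that sets_nuG mf by (intro borel_measurable_times_ennreal) auto
    then show ?thesis
      unfolding \<mu>_def emeasure_translate_nbhd[OF Y] f_def s_def by (simp add: nn_integral_cmult mult.assoc)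
  qed
  have incm: "incseq (\<lambda>m. coset ` core Y X m)" "incseq (core Y X)"
    using core_mono[OF Y] by (auto simp: incseq_def intro!: image_mono)
  have un: "(\<Union>m. coset ` core Y X m) = X"
  proof -
    have "(\<Union>m. coset ` core Y X m) = coset ` lift X" using core_union[OF Y X(2)] by blast
    also have "coset ` lift X = X"
    proof
      show "X \<subseteq> coset ` lift X"
      proof
        fix x assume x: "x \<in> X"
        then obtain g where "x = coset g" using sets_subset_cosets[OF X(1)] by (blast elim: cosetsE)
        with x show "x \<in> coset ` lift X" by blast
      qed
    qed blast
    finally show ?thesis .
  qed
  have low: "emeasure \<mu> (coset ` core Y X m) \<le> (\<integral>\<^sup>+g. F g * indicator (lift X) g \<partial>\<nu>G)" for m
  proof (rule LIMSEQ_le_const[OF limZ[OF lift_sets[OF X(1)] subset_refl]])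
    have "emeasure \<mu> (coset ` core Y X m) \<le> (\<integral>\<^sup>+g. f n g * indicator (lift X) g \<partial>\<nu>G)" if "m \<le> n" for n
      using average_core_lower[OF Y b X(1) that, of \<phi>] yn[of n]
      unfolding \<mu>_def[symmetric] avg[OF lift_sets[OF X(1)]] by (simp add: ennreal_mult_le_mult_iff)
    then show "\<exists>N. \<forall>n\<ge>N. emeasure \<mu> (coset ` core Y X m) \<le> (\<integral>\<^sup>+g. f (r n) g * indicator (lift X) g \<partial>\<nu>G)"
      using seq_suble[OF r] by (meson order_trans)
  qed
  have up: "(\<integral>\<^sup>+g. F g * indicator (core Y X m) g \<partial>\<nu>G) \<le> emeasure \<mu> X" for m
  proof (rule LIMSEQ_le_const2[OF limZ[OF core_borel[OF Y] core_subset[OF Y]]])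
    have "(\<integral>\<^sup>+g. f n g * indicator (core Y X m) g \<partial>\<nu>G) \<le> emeasure \<mu> X" if "m \<le> n" for n
      using average_core_upper[OF Y b X(1) that, of \<phi>] yn[of n]
      unfolding \<mu>_def[symmetric] avg[OF core_borel[OF Y]] by (simp add: ennreal_mult_le_mult_iff)
    then show "\<exists>N. \<forall>n\<ge>N. (\<integral>\<^sup>+g. f (r n) g * indicator (core Y X m) g \<partial>\<nu>G) \<le> emeasure \<mu> X"
      using seq_suble[OF r] by (meson order_trans)
  qed
  have "(\<lambda>m. emeasure \<mu> (coset ` core Y X m)) \<longlonglongrightarrow> emeasure \<mu> X"
    using Lim_emeasure_incseq[OF _ incm(1), of \<mu>] core_sets[OF Y] unfolding un
    by (auto simp: \<mu>_def sets_instr_measure)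
  then show "emeasure (instr_measure (rank1 \<eta> \<eta>) \<phi>) X
    \<le> (\<integral>\<^sup>+g. ennreal (Re (q (act g (\<eta>, \<phi>)) (act g (\<eta>, \<phi>)))) * indicator (lift X) g \<partial>\<nu>G)"
    using low unfolding \<mu>_def F_def s_def by (intro LIMSEQ_le_const2) auto
  have dens: "emeasure (density \<nu>G F) Z = (\<integral>\<^sup>+g. F g * indicator Z g \<partial>\<nu>G)" if "Z \<in> sets borel" for Z
    using that sets_nuG by (intro emeasure_density mF) simp
  have "(\<lambda>m. emeasure (density \<nu>G F) (core Y X m)) \<longlonglongrightarrow> emeasure (density \<nu>G F) (lift X)"
    using Lim_emeasure_incseq[OF _ incm(2), of "density \<nu>G F"] core_borel[OF Y] sets_nuG
    unfolding core_union[OF Y X(2)] by auto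
  then have "(\<lambda>m. \<integral>\<^sup>+g. F g * indicator (core Y X m) g \<partial>\<nu>G) \<longlonglongrightarrow> (\<integral>\<^sup>+g. F g * indicator (lift X) g \<partial>\<nu>G)"
    by (simp only: dens[OF core_borel[OF Y]] dens[OF lift_sets[OF X(1)]])
  then show "(\<integral>\<^sup>+g. ennreal (Re (q (act g (\<eta>, \<phi>)) (act g (\<eta>, \<phi>)))) * indicator (lift X) g \<partial>\<nu>G)
    \<le> emeasure (instr_measure (rank1 \<eta> \<eta>) \<phi>) X"
    using up unfolding \<mu>_def F_def s_def by (intro LIMSEQ_le_const2) auto
qed

text \<open>The open sets of finite measure generate the Borel sets, are stable under intersections and contain a
  countable cover, so the formula extends from them to all Borel sets.\<close>

theorem density_kernel:
  "\<exists>q. cp_kernel (1 / d) q \<and> (\<forall>h\<in>H. \<forall>s t. q (act h s) (act h t) = q s t) \<and>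
     (\<forall>\<eta> \<phi>. \<forall>X\<in>sets (coset_borel H). emeasure (instr_measure (rank1 \<eta> \<eta>) \<phi>) X
        = (\<integral>\<^sup>+g. ennreal (Re (q (act g (\<eta>, \<phi>)) (act g (\<eta>, \<phi>)))) * indicator (lift X) g \<partial>\<nu>G))"
proof -
  have d0: "0 \<le> 1 / d" using d by simp
  obtain Y where Y: "shrinking Y" using shrinking_exists by blast
  obtain r q where r: "strict_mono r" and q: "cp_kernel (1 / d) q"
    and lim: "\<And>s t. (\<lambda>n. approx Y (r n) s t) \<longlonglongrightarrow> q s t"
    using cp_kernel_compact[OF sepK sepV, where q = "approx Y", OF cp_kernel_approx[OF Y] d0] by blast
  have inv: "q (act h s) (act h t) = q s t" if "h \<in> H" for h s t
    using lim[of "act h s" "act h t"] lim[of s t] LIMSEQ_unique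
    unfolding approx_invariant[OF Y that] by blast
  have "emeasure (instr_measure (rank1 \<eta> \<eta>) \<phi>) X
      = (\<integral>\<^sup>+g. ennreal (Re (q (act g (\<eta>, \<phi>)) (act g (\<eta>, \<phi>)))) * indicator (lift X) g \<partial>\<nu>G)"
    if X: "X \<in> sets (coset_borel H)" for \<eta> \<phi> X
  proof -
    define F where "F g = ennreal (Re (q (act g (\<eta>, \<phi>)) (act g (\<eta>, \<phi>))))" for g
    have "(\<lambda>g. Re (q (act g (\<eta>, \<phi>)) (act g (\<eta>, \<phi>)))) \<in> borel_measurable borel"
      by (intro borel_measurable_continuous_onI continuous_intros cpk_act_continuous[OF q d0])
    then have mF: "F \<in> borel_measurable \<nu>G"
      unfolding F_def[abs_def] by (simp add: measurable_cong_sets[OF sets_nuG refl])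
    define \<sigma> where "\<sigma> = distr (density \<nu>G F) (coset_borel H) coset"
    have \<sigma>: "emeasure \<sigma> A = (\<integral>\<^sup>+g. F g * indicator (lift A) g \<partial>\<nu>G)" if A: "A \<in> sets (coset_borel H)" for A
    proof -
      have "coset \<in> density \<nu>G F \<rightarrow>\<^sub>M coset_borel H"
        using measurable_coset by (simp add: measurable_cong_sets[OF sets_nuG refl])
      then have "emeasure \<sigma> A = emeasure (density \<nu>G F) (lift A)"
        unfolding \<sigma>_def using A by (simp add: emeasure_distr vimage_def)
      also have "\<dots> = (\<integral>\<^sup>+g. F g * indicator (lift A) g \<partial>\<nu>G)"
        using lift_sets[OF A] sets_nuG by (intro emeasure_density mF) simp
      finally show ?thesis .
    qed
    define E where "E = {A. A \<subseteq> cosets H \<and> open (lift A) \<and> emeasure \<nu>G (lift A) < \<infinity>}"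
    obtain T :: "nat \<Rightarrow> 'g set set" where T: "\<And>i. T i \<in> sets (coset_borel H)" "\<And>i. open (lift (T i))"
      "\<And>i. emeasure \<nu>G (lift (T i)) < \<infinity>" "(\<Union>i. T i) = cosets H" using finite_cover by auto
    have TE: "T i \<in> E" for i using T(2,3) sets_subset_cosets[OF T(1)] by (simp add: E_def)
    have sig: "sets (coset_borel H) = sigma_sets (cosets H) E"
    proof
      show "sigma_sets (cosets H) E \<subseteq> sets (coset_borel H)"
        unfolding sets_coset_borel by (rule sigma_sets_mono') (auto simp: E_def)
      show "sets (coset_borel H) \<subseteq> sigma_sets (cosets H) E"
        unfolding sets_coset_borel
      proof (rule sigma_sets_mono, rule subsetI)
        fix U assume U: "U \<in> {U. U \<subseteq> cosets H \<and> open (lift U)}"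
        have "U \<inter> T i \<in> E" for i
        proof -
          have l: "lift (U \<inter> T i) = lift U \<inter> lift (T i)" by blast
          have "emeasure \<nu>G (lift (U \<inter> T i)) \<le> emeasure \<nu>G (lift (T i))"
            using T(2) by (intro emeasure_mono) (auto simp: sets_nuG)
          then have "emeasure \<nu>G (lift (U \<inter> T i)) < \<infinity>" using T(3) by (rule le_less_trans)
          moreover have "open (lift (U \<inter> T i))" unfolding l using U T(2) by (intro open_Int) auto
          ultimately show ?thesis using U by (auto simp: E_def)
        qed
        then have "(\<Union>i. U \<inter> T i) \<in> sigma_sets (cosets H) E"
          by (intro sigma_sets.Union sigma_sets.Basic)
        moreover have "(\<Union>i. U \<inter> T i) = U" using U T(4) by blast
        ultimately show "U \<in> sigma_sets (cosets H) E" by simp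
      qed
    qed
    have "instr_measure (rank1 \<eta> \<eta>) \<phi> = \<sigma>"
    proof (rule measure_eqI_generator_eq[where E = E and \<Omega> = "cosets H" and A = T])
      show "Int_stable E"
      proof (rule Int_stableI)
        fix A B assume A: "A \<in> E" and B: "B \<in> E"
        have l: "lift (A \<inter> B) = lift A \<inter> lift B" by blast
        have "emeasure \<nu>G (lift (A \<inter> B)) \<le> emeasure \<nu>G (lift A)"
          using A by (intro emeasure_mono) (auto simp: E_def sets_nuG)
        moreover have "emeasure \<nu>G (lift A) < \<infinity>" using A by (simp add: E_def)
        ultimately have "emeasure \<nu>G (lift (A \<inter> B)) < \<infinity>" by (rule le_less_trans)
        moreover have "open (lift (A \<inter> B))" unfolding l using A B by (intro open_Int) (auto simp: E_def)
        ultimately show "A \<inter> B \<in> E" using A by (auto simp: E_def)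
      qed
      show "E \<subseteq> Pow (cosets H)" by (auto simp: E_def)
      show "emeasure (instr_measure (rank1 \<eta> \<eta>) \<phi>) A = emeasure \<sigma> A" if A: "A \<in> E" for A
      proof -
        have "A \<in> sets (coset_borel H)" "open (lift A)" "emeasure \<nu>G (lift A) < \<infinity>"
          using A open_coset_sets by (auto simp: E_def)
        from limit_density_open[OF Y r q lim this] show ?thesis
          using \<sigma>[OF \<open>A \<in> sets (coset_borel H)\<close>] by (simp add: F_def)
      qed
      show "sets (instr_measure (rank1 \<eta> \<eta>) \<phi>) = sigma_sets (cosets H) E" by (simp add: sets_instr_measure sig)
      show "sets \<sigma> = sigma_sets (cosets H) E" by (simp add: \<sigma>_def sig)
      show "range T \<subseteq> E" using TE by blast
      show "(\<Union>i. T i) = cosets H" by (rule T(4))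
      show "emeasure (instr_measure (rank1 \<eta> \<eta>) \<phi>) (T i) \<noteq> \<infinity>" for i
        by (simp add: emeasure_instr_measure positive_rank1 T(1))
    qed
    then show ?thesis using \<sigma>[OF X] by (simp add: F_def)
  qed
  with q inv show ?thesis by blast
qed

end

section \<open>From the density kernel to Kraus operators\<close>

text \<open>A finite \<open>E\<close> is enumerated with zeros appended; this is why only summands that vanish at \<open>0\<close>
  are considered.\<close>

definition enumerates :: "(nat \<Rightarrow> 'a::zero) \<Rightarrow> 'a set \<Rightarrow> bool" where
  "enumerates e E \<longleftrightarrow>
     (\<forall>f :: 'a \<Rightarrow> real. f 0 = 0 \<longrightarrow> (\<forall>s. (f has_sum s) E \<longleftrightarrow> ((\<lambda>n. f (e n)) has_sum s) UNIV))"

lemma countable_enumerates: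
  fixes E :: "'a::zero set"
  assumes E: "countable E"
  obtains e :: "nat \<Rightarrow> 'a" where "enumerates e E"
proof -
  define N where "N = to_nat_on E ` E"
  define e where "e n = (if n \<in> N then from_nat_into E n else 0)" for n
  have bij: "bij_betw e N E"
    by (rule bij_betw_byWitness[where f' = "to_nat_on E"]) (auto simp: e_def N_def E)
  have "(f has_sum s) E \<longleftrightarrow> ((\<lambda>n. f (e n)) has_sum s) UNIV" if f0: "f 0 = 0" for f :: "'a \<Rightarrow> real" and s
  proof -
    have "(f has_sum s) E \<longleftrightarrow> ((\<lambda>n. f (e n)) has_sum s) N"
      by (rule has_sum_reindex_bij_betw[OF bij, symmetric])
    also have "\<dots> \<longleftrightarrow> ((\<lambda>n. f (e n)) has_sum s) UNIV"
      by (rule has_sum_cong_neutral) (auto simp: e_def f0)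
    finally show ?thesis .
  qed
  then show ?thesis by (intro that[of e]) (simp add: enumerates_def)
qed

lemma norm_sq_suminf:
  fixes x :: "'a::chilbert_space"
  assumes "is_onb E" and "enumerates e E"
  shows "ennreal ((norm x)\<^sup>2) = (\<Sum>n. ennreal ((cmod (cinner (e n) x))\<^sup>2))"
proof -
  have "((\<lambda>n. (cmod (cinner (e n) x))\<^sup>2) has_sum (norm x)\<^sup>2) UNIV"
    using parseval_norm[OF assms(1), of x]
      assms(2)[unfolded enumerates_def, rule_format, of "\<lambda>e. (cmod (cinner e x))\<^sup>2"] by simp
  then show ?thesis by (intro suminf_ennreal_eq[symmetric] has_sum_imp_sums) auto
qed

lemma ennreal_suminf_swap:
  fixes f :: "nat \<Rightarrow> nat \<Rightarrow> ennreal"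
  shows "(\<Sum>i. \<Sum>j. f i j) = (\<Sum>j. \<Sum>i. f i j)"
proof -
  have "(\<Sum>i. \<Sum>j. f i j) = (\<integral>\<^sup>+i. (\<Sum>j. f i j) \<partial>count_space UNIV)"
    by (simp add: nn_integral_count_space_nat)
  also have "\<dots> = (\<Sum>j. \<integral>\<^sup>+i. f i j \<partial>count_space UNIV)" by (rule nn_integral_suminf) simp
  finally show ?thesis by (simp add: nn_integral_count_space_nat)
qed

lemma rank1_polarization:
  "rank1 \<eta> \<xi> = (\<lambda>x. 1 *\<^sub>C ((1/4) *\<^sub>C rank1 (\<eta> + \<xi>) (\<eta> + \<xi>) x + (- 1/4) *\<^sub>C rank1 (\<eta> - \<xi>) (\<eta> - \<xi>) x)
     + 1 *\<^sub>C ((\<i>/4) *\<^sub>C rank1 (\<eta> + \<i> *\<^sub>C \<xi>) (\<eta> + \<i> *\<^sub>C \<xi>) x + (- \<i>/4) *\<^sub>C rank1 (\<eta> - \<i> *\<^sub>C \<xi>) (\<eta> - \<i> *\<^sub>C \<xi>) x))"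
proof
  fix x
  define a b where "a = cinner \<eta> x" and "b = cinner \<xi> x"
  let ?R = "1 *\<^sub>C ((1/4) *\<^sub>C rank1 (\<eta> + \<xi>) (\<eta> + \<xi>) x + (- 1/4) *\<^sub>C rank1 (\<eta> - \<xi>) (\<eta> - \<xi>) x)
     + 1 *\<^sub>C ((\<i>/4) *\<^sub>C rank1 (\<eta> + \<i> *\<^sub>C \<xi>) (\<eta> + \<i> *\<^sub>C \<xi>) x + (- \<i>/4) *\<^sub>C rank1 (\<eta> - \<i> *\<^sub>C \<xi>) (\<eta> - \<i> *\<^sub>C \<xi>) x)"
  have "cinner y (rank1 \<eta> \<xi> x) = cinner y ?R" for y
  proof -
    define p r where "p = cinner y \<eta>" and "r = cinner y \<xi>"
    have "cinner y ?R = (1/4) * ((a + b) * (p + r)) - (1/4) * ((a - b) * (p - r))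
      + (\<i>/4) * ((a - \<i> * b) * (p + \<i> * r)) - (\<i>/4) * ((a + \<i> * b) * (p - \<i> * r))"
      by (simp add: rank1_apply cinner_add_right cinner_diff_right cinner_add_left cinner_diff_left
          cinner_scaleC_left cinner_scaleC_right a_def b_def p_def r_def)
    also have "\<dots> = b * p" by (simp add: field_simps)
    finally show ?thesis by (simp add: rank1_apply cinner_scaleC_right b_def p_def)
  qed
  then show "rank1 \<eta> \<xi> x = ?R" by (rule cinner_eqI)
qed

context covariant_instrument
begin

text \<open>For continuous functions the preimages of open sets are open in the quotient topology. Measurability
  of more general functions on \<open>\<Omega>\<close> is obtained from this by limits only.\<close>

lemma on_coset_borel_measurable:
  fixes F :: "'g \<Rightarrow> complex"
  assumes c: "continuous_on UNIV F" and inv: "\<And>g h. h \<in> H \<Longrightarrow> F (g + h) = F g"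
  shows "on_coset F \<in> borel_measurable (coset_borel H)"
proof (rule borel_measurableI)
  fix S :: "complex set" assume S: "open S"
  have "on_coset F (coset g) = F g" for g by (rule on_coset_eq) (rule inv)
  then have "lift (on_coset F -` S \<inter> space (coset_borel H)) = F -` S" by auto
  moreover have "open (F -` S)" using c S by (simp add: open_vimage)
  ultimately show "on_coset F -` S \<inter> space (coset_borel H) \<in> sets (coset_borel H)"
    by (intro open_coset_sets) auto
qed

lemma set_integral_lift:
  fixes f :: "'g set \<Rightarrow> complex"
  assumes X: "X \<in> sets (coset_borel H)" and f: "f \<in> borel_measurable (coset_borel H)"
    and i: "has_bochner_integral \<nu>G (\<lambda>g. indicator (lift X) g *\<^sub>R f (coset g)) I"
  shows "set_integrable \<nu>\<Omega> X f" "(LINT c:X|\<nu>\<Omega>. f c) = I"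
proof -
  have m: "coset \<in> \<nu>G \<rightarrow>\<^sub>M coset_borel H"
    using measurable_coset by (simp add: measurable_cong_sets[OF sets_nuG refl])
  have mf: "(\<lambda>c. indicator X c *\<^sub>R f c) \<in> borel_measurable (coset_borel H)"
    using X f by (intro borel_measurable_scaleR borel_measurable_indicator)
  have e: "indicator X (coset g) *\<^sub>R f (coset g) = indicator (lift X) g *\<^sub>R f (coset g)" for g
    by (simp add: indicator_def)
  show "set_integrable \<nu>\<Omega> X f"
    unfolding set_integrable_def nuO_eq_distr integrable_distr_eq[OF m mf] e
    using i by (simp add: has_bochner_integral_iff)
  show "(LINT c:X|\<nu>\<Omega>. f c) = I"
    unfolding set_lebesgue_integral_def nuO_eq_distr integral_distr[OF m mf] e
    using i by (simp add: has_bochner_integral_iff)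
qed

end

text \<open>A density kernel of the instrument at the base point and operators that factor it.\<close>

locale kraus_decomposition = covariant_instrument H \<nu>G \<nu>H \<nu>\<Omega> W u d \<Gamma>
  for H :: "'g::{topological_group_add, second_countable_topology, t2_space} set"
    and \<nu>G \<nu>H :: "'g measure" and \<nu>\<Omega> :: "'g set measure"
    and W :: "'g \<Rightarrow> 'v::chilbert_space \<Rightarrow> 'v" and u :: "'g \<Rightarrow> 'k::chilbert_space \<Rightarrow> 'k"
    and d :: real and \<Gamma> :: "('k \<Rightarrow> 'k) \<Rightarrow> 'g set set \<Rightarrow> 'v \<Rightarrow> 'v" +
  fixes q :: "'k \<times> 'v \<Rightarrow> 'k \<times> 'v \<Rightarrow> complex" and B :: "nat \<Rightarrow> 'v \<Rightarrow> 'k"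
  assumes q: "cp_kernel (1 / d) q"
    and q_invariant: "\<And>h s t. h \<in> H \<Longrightarrow> q (act h s) (act h t) = q s t"
    and q_density: "\<And>\<eta> \<phi> X. X \<in> sets (coset_borel H) \<Longrightarrow> emeasure (instr_measure (rank1 \<eta> \<eta>) \<phi>) X
        = (\<integral>\<^sup>+g. ennreal (Re (q (act g (\<eta>, \<phi>)) (act g (\<eta>, \<phi>)))) * indicator (lift X) g \<partial>\<nu>G)"
    and B: "\<And>k. bounded_clinear (B k)"
    and B_sums: "\<And>\<eta> \<phi> \<xi> \<psi>. (\<lambda>k. cnj (cinner \<eta> (B k \<phi>)) * cinner \<xi> (B k \<psi>)) sums q (\<eta>, \<phi>) (\<xi>, \<psi>)"
    and B_summable: "\<And>\<phi>. summable (\<lambda>k. (norm (B k \<phi>))\<^sup>2)"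
begin

lemma inverse_d_nonneg: "0 \<le> 1 / d"
  using d by simp

abbreviation orbit :: "'v \<Rightarrow> 'g \<Rightarrow> nat \<Rightarrow> 'k" where
  "orbit \<phi> g \<equiv> (\<lambda>k. u g (B k (cadjoint (W g) \<phi>)))"

text \<open>The density claimed for \<open>X \<mapsto> \<langle>\<phi>|\<Gamma>(b, X)\<phi>\<rangle>\<close>, as a function on the group.\<close>

definition dens :: "('k \<Rightarrow> 'k) \<Rightarrow> 'v \<Rightarrow> 'g \<Rightarrow> complex" where
  "dens b \<phi> g = vsum (orbit \<phi> g) b"

lemma u_B_summable: "summable (\<lambda>k. (norm (u g (B k \<phi>)))\<^sup>2)"
  using B_summable by (simp add: unitary_op_norm)

lemma vsum_rank1_u: "vsum (\<lambda>k. u g (B k \<phi>)) (rank1 \<eta> \<xi>) = q (cadjoint (u g) \<eta>, \<phi>) (cadjoint (u g) \<xi>, \<phi>)"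
proof -
  have "cinner (u g (B k \<phi>)) (rank1 \<eta> \<xi> (u g (B k \<phi>)))
      = cnj (cinner (cadjoint (u g) \<eta>) (B k \<phi>)) * cinner (cadjoint (u g) \<xi>) (B k \<phi>)" for k
    unfolding rank1_apply cinner_scaleC_right cadjoint_exists[OF unitary_op_bounded[OF u_unitary]]
    by (subst cinner_commute[of "u g (B k \<phi>)" \<eta>]) (rule mult.commute)
  then show ?thesis
    using B_sums[of "cadjoint (u g) \<eta>" \<phi> "cadjoint (u g) \<xi>" \<phi>] by (simp add: vsum_def sums_iff)
qed

lemma vsum_rank1: "vsum (\<lambda>k. B k \<phi>) (rank1 \<eta> \<xi>) = q (\<eta>, \<phi>) (\<xi>, \<phi>)"
proof -
  have "cinner (B k \<phi>) (rank1 \<eta> \<xi> (B k \<phi>)) = cnj (cinner \<eta> (B k \<phi>)) * cinner \<xi> (B k \<phi>)" for k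
    unfolding rank1_apply cinner_scaleC_right by (subst cinner_commute[of "B k \<phi>" \<eta>]) (rule mult.commute)
  then show ?thesis using B_sums[of \<eta> \<phi> \<xi> \<phi>] by (simp add: vsum_def sums_iff)
qed

lemma dens_rank1: "dens (rank1 \<eta> \<xi>) \<phi> g = q (act g (\<eta>, \<phi>)) (act g (\<xi>, \<phi>))"
  unfolding dens_def vsum_rank1_u by (simp add: act_def)

lemma q_act_add: "q (act (g + h) s) (act (g + h) t) = q (act h (act g s)) (act h (act g t))"
proof -
  obtain c where c: "cmod c = 1" "\<And>x. cadjoint (u (g + h)) x = c *\<^sub>C cadjoint (u h) (cadjoint (u g) x)"
    using u_adj_add by blast
  have "cnj c * (c * z) = z" for z using phase_mult[OF c(1)] by (simp add: mult.commute mult.left_commute)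
  then show ?thesis
    by (simp add: act_def c(2) W_adj_add cpk_scale[OF q inverse_d_nonneg])
qed

lemma dens_invariant:
  assumes b: "bounded_clinear b" and h: "h \<in> H" shows "dens b \<phi> (g + h) = dens b \<phi> g"
  unfolding dens_def
proof (rule vsum_eqI[OF sepK u_B_summable u_B_summable _ b])
  show "vsum (orbit \<phi> (g + h)) (rank1 \<eta> \<xi>) = vsum (orbit \<phi> g) (rank1 \<eta> \<xi>)" for \<eta> \<xi>
    using dens_rank1[of \<eta> \<xi> \<phi> "g + h"] dens_rank1[of \<eta> \<xi> \<phi> g] q_act_add[of g h] q_invariant[OF h]
    by (simp add: dens_def)
qed

lemma on_coset_dens: "bounded_clinear b \<Longrightarrow> on_coset (dens b \<phi>) (coset g) = dens b \<phi> g"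
  by (rule on_coset_eq) (rule dens_invariant)

text \<open>On rank one operators this is the invariance of the density kernel under the stabilizer \<open>H\<close>.\<close>

lemma B_covariant:
  assumes b: "bounded_clinear b" and h: "h \<in> H"
  shows "vsum (\<lambda>k. u h (B k \<phi>)) b = vsum (\<lambda>k. B k (W h \<phi>)) b"
proof (rule vsum_eqI[OF sepK u_B_summable B_summable _ b])
  show "vsum (\<lambda>k. u h (B k \<phi>)) (rank1 \<eta> \<xi>) = vsum (\<lambda>k. B k (W h \<phi>)) (rank1 \<eta> \<xi>)" for \<eta> \<xi>
    unfolding vsum_rank1_u vsum_rank1
    using q_invariant[OF h, of "(\<eta>, W h \<phi>)" "(\<xi>, W h \<phi>)"] by (simp add: act_def)
qed

subsection \<open>Operators whose measure has the expected density\<close>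

definition has_density :: "'v \<Rightarrow> ('k \<Rightarrow> 'k) \<Rightarrow> bool" where
  "has_density \<phi> b \<longleftrightarrow> bounded_clinear b \<and> on_coset (dens b \<phi>) \<in> borel_measurable (coset_borel H) \<and>
     (\<forall>X\<in>sets (coset_borel H).
        has_bochner_integral \<nu>G (\<lambda>g. indicator (lift X) g *\<^sub>R dens b \<phi> g) (cinner \<phi> (\<Gamma> b X \<phi>)))"

lemma has_densityD:
  "has_density \<phi> b \<Longrightarrow> X \<in> sets (coset_borel H) \<Longrightarrow>
    has_bochner_integral \<nu>G (\<lambda>g. indicator (lift X) g *\<^sub>R dens b \<phi> g) (cinner \<phi> (\<Gamma> b X \<phi>))"
  unfolding has_density_def by blast

lemma has_density_positive_rank1: "has_density \<phi> (rank1 \<eta> \<eta>)"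
proof -
  let ?F = "\<lambda>g. q (act g (\<eta>, \<phi>)) (act g (\<eta>, \<phi>))"
  have cont: "continuous_on UNIV ?F" by (rule cpk_act_continuous[OF q inverse_d_nonneg])
  have d: "dens (rank1 \<eta> \<eta>) \<phi> = ?F" by (rule ext) (rule dens_rank1)
  have real: "?F g = complex_of_real (Re (?F g))" "0 \<le> Re (?F g)" for g
    by (rule psd_self[OF cpk_psd[OF q inverse_d_nonneg]])+
  have "on_coset (dens (rank1 \<eta> \<eta>) \<phi>) \<in> borel_measurable (coset_borel H)"
    by (rule on_coset_borel_measurable) (simp_all add: dens_invariant d[symmetric] cont[unfolded d[symmetric]])
  moreover have "has_bochner_integral \<nu>G (\<lambda>g. indicator (lift X) g *\<^sub>R dens (rank1 \<eta> \<eta>) \<phi> g) (cinner \<phi> (\<Gamma> (rank1 \<eta> \<eta>) X \<phi>))"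
    if X: "X \<in> sets (coset_borel H)" for X
  proof -
    have "(\<lambda>g. Re (?F g)) \<in> borel_measurable borel"
      by (intro borel_measurable_continuous_onI continuous_intros cont)
    then have mF: "(\<lambda>g. indicator (lift X) g * Re (?F g)) \<in> borel_measurable \<nu>G"
      using lift_sets[OF X] by (simp add: measurable_cong_sets[OF sets_nuG refl])
    have A: "positive_op (\<Gamma> (rank1 \<eta> \<eta>) X)" by (rule \<Gamma>_positive[OF X positive_rank1])
    have "has_bochner_integral \<nu>G (\<lambda>g. indicator (lift X) g * Re (?F g)) (Re (cinner \<phi> (\<Gamma> (rank1 \<eta> \<eta>) X \<phi>)))"
    proof (rule has_bochner_integral_nn_integral[OF mF])
      show "AE g in \<nu>G. 0 \<le> indicator (lift X) g * Re (?F g)" using real(2) by simp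
      show "0 \<le> Re (cinner \<phi> (\<Gamma> (rank1 \<eta> \<eta>) X \<phi>))" by (rule positive_op_Re[OF A])
      have "ennreal (indicator (lift X) g * Re (?F g)) = ennreal (Re (?F g)) * indicator (lift X) g" for g
        by (simp add: indicator_def)
      then show "(\<integral>\<^sup>+g. ennreal (indicator (lift X) g * Re (?F g)) \<partial>\<nu>G) = ennreal (Re (cinner \<phi> (\<Gamma> (rank1 \<eta> \<eta>) X \<phi>)))"
        using q_density[OF X, of \<eta> \<phi>] by (simp add: emeasure_instr_measure positive_rank1 X)
    qed
    from has_bochner_integral_of_real[OF this]
    have "has_bochner_integral \<nu>G (\<lambda>g. complex_of_real (indicator (lift X) g * Re (?F g))) (cinner \<phi> (\<Gamma> (rank1 \<eta> \<eta>) X \<phi>))"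
      by (subst positive_op_real[OF A])
    moreover have "complex_of_real (indicator (lift X) g * Re (?F g)) = indicator (lift X) g *\<^sub>R dens (rank1 \<eta> \<eta>) \<phi> g" for g
      unfolding d scaleR_conv_of_real of_real_mult real(1)[of g, symmetric] ..
    ultimately show ?thesis by simp
  qed
  ultimately show ?thesis by (simp add: has_density_def)
qed

lemma has_density_lin:
  assumes a: "has_density \<phi> a" and b: "has_density \<phi> b"
  shows "has_density \<phi> (\<lambda>x. \<alpha> *\<^sub>C a x + \<beta> *\<^sub>C b x)"
proof -
  let ?c = "\<lambda>x. \<alpha> *\<^sub>C a x + \<beta> *\<^sub>C b x"
  from a b have ba: "bounded_clinear a" and bb: "bounded_clinear b"
    and ma: "on_coset (dens a \<phi>) \<in> borel_measurable (coset_borel H)"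
    and mb: "on_coset (dens b \<phi>) \<in> borel_measurable (coset_borel H)"
    by (auto simp: has_density_def)
  have bc: "bounded_clinear ?c"
    by (rule bounded_clinear_add[OF bounded_clinear_scaleC[OF ba] bounded_clinear_scaleC[OF bb]])
  have d: "dens ?c \<phi> g = \<alpha> * dens a \<phi> g + \<beta> * dens b \<phi> g" for g
    unfolding dens_def by (rule vsum_lin[OF u_B_summable ba bb])
  have m1: "(\<lambda>c. \<alpha> * on_coset (dens a \<phi>) c + \<beta> * on_coset (dens b \<phi>) c) \<in> borel_measurable (coset_borel H)"
    using ma mb by (intro borel_measurable_add borel_measurable_times borel_measurable_const)
  have e1: "on_coset (dens ?c \<phi>) c = \<alpha> * on_coset (dens a \<phi>) c + \<beta> * on_coset (dens b \<phi>) c"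
    if "c \<in> space (coset_borel H)" for c
  proof -
    obtain g where "c = coset g" using \<open>c \<in> space (coset_borel H)\<close> by (auto elim: cosetsE)
    then show ?thesis using d[of g] by (simp add: on_coset_dens ba bb bc)
  qed
  have mc: "on_coset (dens ?c \<phi>) \<in> borel_measurable (coset_borel H)"
    by (rule iffD2[OF measurable_cong[OF e1] m1])
  have "has_bochner_integral \<nu>G (\<lambda>g. indicator (lift X) g *\<^sub>R dens ?c \<phi> g) (cinner \<phi> (\<Gamma> ?c X \<phi>))"
    if X: "X \<in> sets (coset_borel H)" for X
  proof -
    have "has_bochner_integral \<nu>G (\<lambda>g. \<alpha> * (indicator (lift X) g *\<^sub>R dens a \<phi> g) + \<beta> * (indicator (lift X) g *\<^sub>R dens b \<phi> g))
        (\<alpha> * cinner \<phi> (\<Gamma> a X \<phi>) + \<beta> * cinner \<phi> (\<Gamma> b X \<phi>))"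
      using a b X unfolding has_density_def
      by (intro has_bochner_integral_add has_bochner_integral_mult_right) auto
    moreover have "\<alpha> * (indicator (lift X) g *\<^sub>R dens a \<phi> g) + \<beta> * (indicator (lift X) g *\<^sub>R dens b \<phi> g)
        = indicator (lift X) g *\<^sub>R dens ?c \<phi> g" for g
      by (simp add: d scaleR_add_right)
    moreover have "\<alpha> * cinner \<phi> (\<Gamma> a X \<phi>) + \<beta> * cinner \<phi> (\<Gamma> b X \<phi>) = cinner \<phi> (\<Gamma> ?c X \<phi>)"
      by (simp add: \<Gamma>_lin[OF X ba bb] cinner_add_right cinner_scaleC_right)
    ultimately show ?thesis by simp
  qed
  with bc mc show ?thesis by (simp add: has_density_def)
qed

lemma has_density_sum:
  assumes "finite I" "\<And>i. i \<in> I \<Longrightarrow> has_density \<phi> (b i)"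
  shows "has_density \<phi> (\<lambda>x. \<Sum>i\<in>I. \<alpha> i *\<^sub>C b i x)"
  using assms
proof (induction I rule: finite_induct)
  case empty
  then show ?case using has_density_lin[OF has_density_positive_rank1 has_density_positive_rank1, of \<phi> 0 0 0 0] by simp
next
  case (insert i I)
  then have "has_density \<phi> (\<lambda>x. \<alpha> i *\<^sub>C b i x + 1 *\<^sub>C (\<Sum>i\<in>I. \<alpha> i *\<^sub>C b i x))"
    by (intro has_density_lin) auto
  with insert show ?case by simp
qed

lemma has_density_rank1: "has_density \<phi> (rank1 \<eta> \<xi>)"
  unfolding rank1_polarization[of \<eta> \<xi>]
  by (rule has_density_lin[OF has_density_lin[OF has_density_positive_rank1 has_density_positive_rank1]
        has_density_lin[OF has_density_positive_rank1 has_density_positive_rank1]])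

lemma has_density_compress:
  assumes E: "is_onb E" "countable E" and b: "bounded_clinear b"
  shows "has_density \<phi> (compress E b n)"
proof -
  have "has_density \<phi> (\<lambda>x. \<Sum>e\<in>exhaust E n. 1 *\<^sub>C (\<Sum>f\<in>exhaust E n. cinner e (b f) *\<^sub>C rank1 e f x))"
    by (rule has_density_sum[OF exhaust_filterlim(1)[OF E(2)] has_density_sum[OF exhaust_filterlim(1)[OF E(2)] has_density_rank1]])
  then show ?thesis by (simp add: compress_props(4)[OF E b])
qed

lemma dens_compress:
  assumes E: "is_onb E" "countable E" and b: "bounded_clinear b"
  shows "(\<lambda>n. dens (compress E b n) \<phi> g) \<longlonglongrightarrow> dens b \<phi> g"
  unfolding dens_def by (rule vsum_compress[OF u_B_summable E b])

lemma \<Gamma>_compress: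
  assumes E: "is_onb E" "countable E" and b: "bounded_clinear b" and X: "X \<in> sets (coset_borel H)"
  shows "(\<lambda>n. cinner \<phi> (\<Gamma> (compress E b n) X \<phi>)) \<longlonglongrightarrow> cinner \<phi> (\<Gamma> b X \<phi>)"
  by (rule normal_cp_map_tendsto[OF sepK \<Gamma>_normal[OF X] compress_props(1)[OF E b] b compress_props(2)[OF E b] compress_props(3)[OF E b]])

definition weight :: "'v \<Rightarrow> 'g \<Rightarrow> real" where
  "weight \<phi> g = (\<Sum>k. (norm (B k (cadjoint (W g) \<phi>)))\<^sup>2)"

lemma dens_id: "dens id \<phi> g = complex_of_real (weight \<phi> g)"
  unfolding dens_def vsum_id[OF u_B_summable] weight_def by (simp add: unitary_op_norm)

lemma weight_nonneg: "0 \<le> weight \<phi> g"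
  unfolding weight_def by (intro suminf_nonneg B_summable) simp

lemma dens_bound: "bounded_clinear b \<Longrightarrow> (\<And>x. norm (b x) \<le> C * norm x) \<Longrightarrow> cmod (dens b \<phi> g) \<le> C * weight \<phi> g"
  using vsum_bound[OF u_B_summable[of g "cadjoint (W g) \<phi>"], of b C]
  by (simp add: dens_def weight_def unitary_op_norm)

text \<open>The weight is the limit of the densities of finite rank projections. Their integrals converge by
  normality, so Fatou's lemma bounds the integral of the weight; the weight then dominates the densities of
  all operators.\<close>

lemma weight_integrable: "integrable \<nu>G (weight \<phi>)"
proof -
  obtain E :: "'k set" where E: "is_onb E" using onb_exists by blast
  have cE: "countable E" by (rule onb_countable[OF E sepK])
  define f where "f n g = Re (dens (compress E id n) \<phi> g)" for n g
  define I where "I n = Re (cinner \<phi> (\<Gamma> (compress E id n) (cosets H) \<phi>))" for n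
  have i: "has_bochner_integral \<nu>G (f n) (I n)" for n
  proof -
    have "has_bochner_integral \<nu>G (\<lambda>g. indicator (lift (cosets H)) g *\<^sub>R dens (compress E id n) \<phi> g)
        (cinner \<phi> (\<Gamma> (compress E id n) (cosets H) \<phi>))"
      by (rule has_densityD[OF has_density_compress[OF E cE bounded_clinear_id(1)] cosets_sets])
    from has_bochner_integral_Re[OF this] show ?thesis by (simp add: f_def[abs_def] I_def)
  qed
  have mf: "f n \<in> borel_measurable \<nu>G" for n
    using i[of n] borel_measurable_integrable has_bochner_integral_iff by blast
  have nonneg: "0 \<le> f n g" for n g
  proof -
    have on: "orthonormal (exhaust E n)"
      using exhaust_filterlim(2)[OF cE] is_onb_orthonormal[OF E] orthonormal_subset by blast
    have form: "cinner y (compress E id n y) = complex_of_real ((norm (proj_on (exhaust E n) y))\<^sup>2)" for y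
      using cinner_proj_on(2)[OF on exhaust_filterlim(1)[OF cE], of y "proj_on (exhaust E n) y"]
      by (simp add: compress_def cinner_eq_norm)
    have "(\<lambda>k. cinner (orbit \<phi> g k) (compress E id n (orbit \<phi> g k))) sums dens (compress E id n) \<phi> g"
      unfolding dens_def vsum_def
      by (rule summable_sums[OF vsum_summable[OF u_B_summable compress_props(1)[OF E cE bounded_clinear_id(1)]]])
    then have "(\<lambda>k. complex_of_real ((norm (proj_on (exhaust E n) (orbit \<phi> g k)))\<^sup>2)) sums dens (compress E id n) \<phi> g"
      by (simp only: form)
    from sums_Re[OF this] have "(\<lambda>k. (norm (proj_on (exhaust E n) (orbit \<phi> g k)))\<^sup>2) sums f n g"
      by (simp add: f_def)
    then show ?thesis using suminf_nonneg by (metis sums_iff zero_le_power2)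
  qed
  have lim: "(\<lambda>n. f n g) \<longlonglongrightarrow> weight \<phi> g" for g
    using tendsto_Re[OF dens_compress[OF E cE bounded_clinear_id(1), of \<phi> g]] by (simp add: f_def dens_id)
  have m: "weight \<phi> \<in> borel_measurable \<nu>G" by (rule borel_measurable_LIMSEQ_real[OF lim mf])
  have "(\<integral>\<^sup>+g. ennreal (weight \<phi> g) \<partial>\<nu>G) = (\<integral>\<^sup>+g. liminf (\<lambda>n. ennreal (f n g)) \<partial>\<nu>G)"
    by (intro nn_integral_cong lim_imp_Liminf[symmetric] tendsto_ennrealI lim) simp
  also have "\<dots> \<le> liminf (\<lambda>n. \<integral>\<^sup>+g. ennreal (f n g) \<partial>\<nu>G)"
    using mf by (intro nn_integral_liminf) simp
  also have "(\<lambda>n. \<integral>\<^sup>+g. ennreal (f n g) \<partial>\<nu>G) = (\<lambda>n. ennreal (I n))"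
  proof
    fix n
    show "(\<integral>\<^sup>+g. ennreal (f n g) \<partial>\<nu>G) = ennreal (I n)"
      using nn_integral_eq_integral[of \<nu>G "f n"] i[of n] nonneg by (simp add: has_bochner_integral_iff)
  qed
  also have "liminf (\<lambda>n. ennreal (I n)) = ennreal (Re (cinner \<phi> (\<Gamma> id (cosets H) \<phi>)))"
    unfolding I_def by (intro lim_imp_Liminf tendsto_ennrealI tendsto_Re \<Gamma>_compress E cE cosets_sets) simp_all
  also have "\<dots> < \<infinity>" by simp
  finally have "(\<integral>\<^sup>+g. ennreal (norm (weight \<phi> g)) \<partial>\<nu>G) < \<infinity>" using weight_nonneg by simp
  then show ?thesis using m by (simp add: integrable_iff_bounded)
qed

theorem has_density_all:
  assumes b: "bounded_clinear b" shows "has_density \<phi> b"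
proof -
  obtain E :: "'k set" where E: "is_onb E" using onb_exists by blast
  have cE: "countable E" by (rule onb_countable[OF E sepK])
  note c = has_density_compress[OF E cE b, of \<phi>]
  note cb = compress_props(1)[OF E cE b]
  have "on_coset (dens b \<phi>) \<in> borel_measurable (coset_borel H)"
  proof (rule borel_measurable_LIMSEQ_metric)
    show "on_coset (dens (compress E b n) \<phi>) \<in> borel_measurable (coset_borel H)" for n
      using c by (simp add: has_density_def)
    fix x assume "x \<in> space (coset_borel H)"
    then obtain g where "x = coset g" by (auto elim: cosetsE)
    then show "(\<lambda>n. on_coset (dens (compress E b n) \<phi>) x) \<longlonglongrightarrow> on_coset (dens b \<phi>) x"
      using dens_compress[OF E cE b, of \<phi> g] by (simp add: on_coset_dens b cb)
  qed
  moreover have "has_bochner_integral \<nu>G (\<lambda>g. indicator (lift X) g *\<^sub>R dens b \<phi> g) (cinner \<phi> (\<Gamma> b X \<phi>))"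
    if X: "X \<in> sets (coset_borel H)" for X
  proof -
    let ?f = "\<lambda>n g. indicator (lift X) g *\<^sub>R dens (compress E b n) \<phi> g"
    have i: "has_bochner_integral \<nu>G (?f n) (cinner \<phi> (\<Gamma> (compress E b n) X \<phi>))" for n
      using c[of n] X by (simp add: has_density_def)
    have lim: "(\<lambda>n. ?f n g) \<longlonglongrightarrow> indicator (lift X) g *\<^sub>R dens b \<phi> g" for g
      by (intro tendsto_intros dens_compress[OF E cE b])
    have mf: "?f n \<in> borel_measurable \<nu>G" for n
      using i[of n] borel_measurable_integrable has_bochner_integral_iff by blast
    have m: "(\<lambda>g. indicator (lift X) g *\<^sub>R dens b \<phi> g) \<in> borel_measurable \<nu>G"
      by (rule borel_measurable_LIMSEQ_metric[OF mf lim])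
    have w: "integrable \<nu>G (\<lambda>g. onorm b * weight \<phi> g)" using weight_integrable by simp
    have bound: "norm (?f n g) \<le> onorm b * weight \<phi> g" for n g
    proof -
      have "norm (?f n g) \<le> cmod (dens (compress E b n) \<phi> g)" by (simp add: indicator_def)
      also have "\<dots> \<le> onorm b * weight \<phi> g" by (rule dens_bound[OF cb compress_props(2)[OF E cE b]])
      finally show ?thesis .
    qed
    note dc = integrable_dominated_convergence[OF m mf w AE_I2[OF lim] AE_I2[OF bound]]
      integral_dominated_convergence[OF m mf w AE_I2[OF lim] AE_I2[OF bound]]
    have "(\<lambda>n. integral\<^sup>L \<nu>G (?f n)) \<longlonglongrightarrow> cinner \<phi> (\<Gamma> b X \<phi>)"
      using \<Gamma>_compress[OF E cE b X, of \<phi>] i by (simp add: has_bochner_integral_iff)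
    from LIMSEQ_unique[OF dc(2) this] dc(1) show ?thesis by (simp add: has_bochner_integral_iff)
  qed
  ultimately show ?thesis using b by (simp add: has_density_def)
qed

subsection \<open>The trace formula\<close>

lemma weight_total: "(\<integral>\<^sup>+g. ennreal (weight \<phi> g) \<partial>\<nu>G) = ennreal ((norm \<phi>)\<^sup>2)"
proof -
  have "has_bochner_integral \<nu>G (\<lambda>g. indicator (lift (cosets H)) g *\<^sub>R dens id \<phi> g) (cinner \<phi> (\<Gamma> id (cosets H) \<phi>))"
    by (rule has_densityD[OF has_density_all[OF bounded_clinear_id(1)] cosets_sets])
  from has_bochner_integral_Re[OF this] have "has_bochner_integral \<nu>G (weight \<phi>) ((norm \<phi>)\<^sup>2)"
    by (simp add: dens_id \<Gamma>_id_total cinner_eq_norm)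
  then show ?thesis
    using nn_integral_eq_integral[of \<nu>G "weight \<phi>"] weight_nonneg by (simp add: has_bochner_integral_iff)
qed

text \<open>Integrating \<open>\<Sum> |\<langle>f|B\<^sub>k W(g)\<^sup>* \<phi>\<rangle>|\<^sup>2 = \<Sum> |\<langle>\<phi>|W(g) B\<^sub>k\<^sup>* f\<rangle>|\<^sup>2\<close> term by term turns
  the total mass into \<open>d\<close> times the sum of the squared Hilbert--Schmidt norms.\<close>

lemma hilbert_schmidt_total:
  fixes e :: "nat \<Rightarrow> 'v"
  assumes nz: "\<exists>\<phi>::'v. \<phi> \<noteq> 0" and E: "is_onb E"
    and e: "enumerates e E"
  shows "(\<Sum>k. \<Sum>n. ennreal ((norm (B k (e n)))\<^sup>2)) = ennreal (1 / d)"
proof -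
  obtain F :: "'k set" where F: "is_onb F" using onb_exists by blast
  obtain f :: "nat \<Rightarrow> 'k" where f: "enumerates f F"
    using countable_enumerates[OF onb_countable[OF F sepK]] by blast
  note nsE = norm_sq_suminf[OF E e] and nsF = norm_sq_suminf[OF F f]
  obtain \<phi>0 :: 'v where "\<phi>0 \<noteq> 0" using nz by blast
  define \<phi> where "\<phi> = (1 / norm \<phi>0) *\<^sub>R \<phi>0"
  have \<phi>: "norm \<phi> = 1" using \<open>\<phi>0 \<noteq> 0\<close> by (simp add: \<phi>_def)
  have eq: "cmod (cinner (f m) (B k (cadjoint (W g) \<phi>))) = cmod (cinner \<phi> (W g (cadjoint (B k) (f m))))" for m k g
  proof -
    have "cinner (f m) (B k (cadjoint (W g) \<phi>)) = cinner (W g (cadjoint (B k) (f m))) \<phi>"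
      by (simp add: cadjoint_right cadjoint_exists[OF B, symmetric])
    then show ?thesis by (metis cinner_commute complex_mod_cnj)
  qed
  have meas: "(\<lambda>g. ennreal ((cmod (cinner \<phi> (W g x)))\<^sup>2)) \<in> borel_measurable \<nu>G" for x
  proof -
    have "(\<lambda>g. (cmod (cinner \<phi> (W g x)))\<^sup>2) \<in> borel_measurable borel"
      by (intro borel_measurable_continuous_onI continuous_intros W_continuous)
    then show ?thesis by (simp add: measurable_cong_sets[OF sets_nuG refl])
  qed
  have "ennreal 1 = (\<integral>\<^sup>+g. ennreal (weight \<phi> g) \<partial>\<nu>G)" by (simp add: weight_total \<phi>)
  also have "\<dots> = (\<integral>\<^sup>+g. (\<Sum>k. \<Sum>m. ennreal ((cmod (cinner \<phi> (W g (cadjoint (B k) (f m)))))\<^sup>2)) \<partial>\<nu>G)"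
  proof (rule nn_integral_cong)
    fix g
    have "ennreal (weight \<phi> g) = (\<Sum>k. ennreal ((norm (B k (cadjoint (W g) \<phi>)))\<^sup>2))"
      unfolding weight_def by (intro suminf_ennreal2[symmetric] B_summable) simp
    then show "ennreal (weight \<phi> g) = (\<Sum>k. \<Sum>m. ennreal ((cmod (cinner \<phi> (W g (cadjoint (B k) (f m)))))\<^sup>2))"
      unfolding nsF eq .
  qed
  also have "\<dots> = (\<Sum>k. \<integral>\<^sup>+g. (\<Sum>m. ennreal ((cmod (cinner \<phi> (W g (cadjoint (B k) (f m)))))\<^sup>2)) \<partial>\<nu>G)"
    by (intro nn_integral_suminf borel_measurable_suminf_order meas)
  also have "\<dots> = (\<Sum>k. \<Sum>m. \<integral>\<^sup>+g. ennreal ((cmod (cinner \<phi> (W g (cadjoint (B k) (f m)))))\<^sup>2) \<partial>\<nu>G)"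
    by (intro suminf_cong nn_integral_suminf meas)
  also have "\<dots> = (\<Sum>k. \<Sum>m. ennreal d * ennreal ((norm (cadjoint (B k) (f m)))\<^sup>2))"
    unfolding nn_square_integral \<phi> using d by (simp add: ennreal_mult)
  also have "\<dots> = ennreal d * (\<Sum>k. \<Sum>m. ennreal ((norm (cadjoint (B k) (f m)))\<^sup>2))" by simp
  also have "(\<Sum>k. \<Sum>m. ennreal ((norm (cadjoint (B k) (f m)))\<^sup>2)) = (\<Sum>k. \<Sum>n. ennreal ((norm (B k (e n)))\<^sup>2))"
  proof (rule suminf_cong)
    fix k
    have "(\<Sum>m. ennreal ((norm (cadjoint (B k) (f m)))\<^sup>2)) = (\<Sum>m. \<Sum>n. ennreal ((cmod (cinner (e n) (cadjoint (B k) (f m))))\<^sup>2))"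
      by (simp only: nsE)
    also have "\<dots> = (\<Sum>n. \<Sum>m. ennreal ((cmod (cinner (e n) (cadjoint (B k) (f m))))\<^sup>2))"
      by (rule ennreal_suminf_swap)
    also have "\<dots> = (\<Sum>n. \<Sum>m. ennreal ((cmod (cinner (f m) (B k (e n))))\<^sup>2))"
    proof -
      have "cmod (cinner (e n) (cadjoint (B k) (f m))) = cmod (cinner (f m) (B k (e n)))" for n m
        unfolding cadjoint_right[OF B] by (metis cinner_commute complex_mod_cnj)
      then show ?thesis by simp
    qed
    finally show "(\<Sum>m. ennreal ((norm (cadjoint (B k) (f m)))\<^sup>2)) = (\<Sum>n. ennreal ((norm (B k (e n)))\<^sup>2))"
      by (simp only: nsF)
  qed
  finally have "ennreal d * (\<Sum>k. \<Sum>n. ennreal ((norm (B k (e n)))\<^sup>2)) = ennreal d * ennreal (1 / d)"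
    using d by (simp flip: ennreal_mult)
  then show ?thesis using d by (simp add: ennreal_mult_cancel_left)
qed

lemma tr_square_sum:
  assumes A: "bounded_clinear A" and E: "E = (SOME E :: 'v set. is_onb E)"
    and s: "((\<lambda>e. (norm (A e))\<^sup>2) has_sum t) E"
  shows "tr (cadjoint A \<circ> A) = complex_of_real t"
proof -
  have "cinner x (cadjoint A (A x)) = complex_of_real ((norm (A x))\<^sup>2)" for x
    by (simp add: cadjoint_right[OF A] cinner_eq_norm)
  then have "tr (cadjoint A \<circ> A) = (\<Sum>\<^sub>\<infinity>e\<in>E. complex_of_real ((norm (A e))\<^sup>2))"
    unfolding tr_def E[symmetric] by (simp del: of_real_power)
  also have "\<dots> = complex_of_real t" by (intro infsumI has_sum_of_real s)
  finally show ?thesis .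
qed

theorem kraus_trace:
  assumes nz: "\<exists>\<phi>::'v. \<phi> \<noteq> 0"
  shows "hilbert_schmidt (B k)" "((\<lambda>k. tr (cadjoint (B k) \<circ> B k)) has_sum complex_of_real (1 / d)) UNIV"
proof -
  define E where "E = (SOME E :: 'v set. is_onb E)"
  have E: "is_onb E" unfolding E_def using onb_exists by (rule someI_ex)
  obtain e :: "nat \<Rightarrow> 'v" where e: "enumerates e E"
    using countable_enumerates[OF onb_countable[OF E sepV]] by blast
  note total = hilbert_schmidt_total[OF nz E e]
  have "(\<Sum>n. ennreal ((norm (B k (e n)))\<^sup>2)) \<noteq> top" for k
  proof
    assume top: "(\<Sum>n. ennreal ((norm (B k (e n)))\<^sup>2)) = top"
    have "(\<Sum>k\<in>{k}. \<Sum>n. ennreal ((norm (B k (e n)))\<^sup>2)) \<le> (\<Sum>k. \<Sum>n. ennreal ((norm (B k (e n)))\<^sup>2))"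
      by (rule sum_le_suminf) auto
    then show False unfolding total by (simp add: top top_unique)
  qed
  then have s: "summable (\<lambda>n. (norm (B k (e n)))\<^sup>2)" for k
    by (intro summable_suminf_not_top) auto
  define t where "t k = (\<Sum>n. (norm (B k (e n)))\<^sup>2)" for k
  have t0: "0 \<le> t k" for k unfolding t_def by (intro suminf_nonneg s) simp
  have hs: "((\<lambda>x. (norm (B k x))\<^sup>2) has_sum t k) E" for k
  proof -
    have "((\<lambda>n. (norm (B k (e n)))\<^sup>2) has_sum t k) UNIV"
      unfolding t_def by (intro norm_summable_imp_has_sum summable_sums s) (use s in simp)
    then show ?thesis
      using e[unfolded enumerates_def, rule_format, of "\<lambda>x. (norm (B k x))\<^sup>2"] by (simp add: bclin_zero[OF B])
  qed
  then show "hilbert_schmidt (B k)"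
    using E B unfolding hilbert_schmidt_def summable_on_def by blast
  have "(\<Sum>k. ennreal (t k)) = ennreal (1 / d)"
    unfolding t_def suminf_ennreal2[OF zero_le_power2 s, symmetric] by (rule total)
  then have st: "summable t" "suminf t = 1 / d"
  proof -
    show "summable t" by (rule summable_suminf_not_top[OF t0]) (simp add: \<open>(\<Sum>k. ennreal (t k)) = ennreal (1 / d)\<close>)
    then show "suminf t = 1 / d"
      using \<open>(\<Sum>k. ennreal (t k)) = ennreal (1 / d)\<close> suminf_ennreal2[OF t0] suminf_nonneg[OF _ t0] d by simp
  qed
  have "(t has_sum 1 / d) UNIV"
    using st t0 by (intro norm_summable_imp_has_sum) (auto simp: sums_iff)
  then have "((\<lambda>k. complex_of_real (t k)) has_sum complex_of_real (1 / d)) UNIV" by (rule has_sum_of_real)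
  then show "((\<lambda>k. tr (cadjoint (B k) \<circ> B k)) has_sum complex_of_real (1 / d)) UNIV"
    by (simp add: tr_square_sum[OF B E_def hs])
qed

end

text \<open>The Kraus operators of the conclusion are numbered from \<open>1\<close> as an unordered
  family, whereas \<open>vsum\<close> is a series over all natural numbers.\<close>

lemma infsum_shift_vsum:
  fixes y :: "nat \<Rightarrow> 'k::chilbert_space"
  assumes y: "summable (\<lambda>k. (norm (y k))\<^sup>2)" and b: "bounded_clinear b"
  shows "(\<Sum>\<^sub>\<infinity>j\<in>{j. 1 \<le> j}. cinner (y (j - 1)) (b (y (j - 1)))) = vsum y b"
proof -
  have "bij_betw Suc UNIV {j :: nat. 1 \<le> j}"
    by (rule bij_betw_byWitness[where f' = "\<lambda>j. j - 1"]) auto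
  from infsum_reindex_bij_betw[OF this, of "\<lambda>j. cinner (y (j - 1)) (b (y (j - 1)))"]
  have "(\<Sum>\<^sub>\<infinity>j\<in>{j. 1 \<le> j}. cinner (y (j - 1)) (b (y (j - 1)))) = (\<Sum>\<^sub>\<infinity>k. cinner (y k) (b (y k)))"
    by simp
  also have "\<dots> = vsum y b"
    unfolding vsum_def
    by (intro infsumI norm_summable_imp_has_sum vsum_abs_summable[OF y b] summable_sums vsum_summable[OF y b])
  finally show ?thesis .
qed

theorem theorem7:
  fixes H :: "'g::{topological_group_add, second_countable_topology, t2_space} set"
    and \<nu>G \<nu>H :: "'g measure" and \<nu>\<Omega> :: "'g set measure"
    and W :: "'g \<Rightarrow> 'v::chilbert_space \<Rightarrow> 'v"
    and u :: "'g \<Rightarrow> 'k::chilbert_space \<Rightarrow> 'k"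
    and d :: real
    and \<Gamma> :: "('k \<Rightarrow> 'k) \<Rightarrow> 'g set set \<Rightarrow> 'v \<Rightarrow> 'v"
  assumes "separable_space (euclidean :: 'v topology)"
    and "separable_space (euclidean :: 'k topology)"
    and "\<exists>\<phi>::'v. \<phi> \<noteq> 0"
    and "locally_compact_space (euclidean :: 'g topology)"
    and "unimodular_group TYPE('g)"
    and "type_I_group TYPE('g)"
    and "is_add_subgroup H" and "compact H"
    and "haar_measure_on UNIV \<nu>G"
    and "haar_measure_on H \<nu>H" and "emeasure \<nu>H H = 1"
    and "coset_measure H \<nu>G \<nu>H \<nu>\<Omega>"
    and "unitary_rep W"
    and "d > 0"
    and "\<And>\<phi> \<psi>. norm \<phi> = 1 \<Longrightarrow> norm \<psi> = 1 \<Longrightarrow>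
           (LINT g|\<nu>G. (cmod (cinner \<phi> (W g \<psi>)))\<^sup>2) = d"
    and "projective_unitary_rep u"
    and "\<Gamma> \<in> covariant_instruments H u W"
  shows "\<exists>(r::enat) (B :: nat \<Rightarrow> 'v \<Rightarrow> 'k). let J = {j. 1 \<le> j \<and> enat j < r + 1} in
     (\<forall>j\<in>J. hilbert_schmidt (B j)) \<and>
     (\<forall>\<phi> b. \<forall>h\<in>H. bounded_clinear b \<longrightarrow>
        (\<Sum>\<^sub>\<infinity>j\<in>J. cinner (B j \<phi>) (cadjoint (u h) (b (u h (B j \<phi>)))))
          = (\<Sum>\<^sub>\<infinity>j\<in>J. cinner (B j (W h \<phi>)) (b (B j (W h \<phi>))))) \<and>
     ((\<lambda>j. tr (cadjoint (B j) \<circ> B j)) has_sum complex_of_real (1 / d)) J \<and>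
     (\<forall>\<phi> b. \<forall>X\<in>sets (coset_borel H). bounded_clinear b \<longrightarrow>
        (let F = on_coset (\<lambda>g. \<Sum>\<^sub>\<infinity>j\<in>J.
               cinner (u g (B j (cadjoint (W g) \<phi>))) (b (u g (B j (cadjoint (W g) \<phi>)))))
         in set_integrable \<nu>\<Omega> X F \<and> cinner \<phi> (\<Gamma> b X \<phi>) = (LINT c:X|\<nu>\<Omega>. F c)))"
proof -
  interpret covariant_instrument H \<nu>G \<nu>H \<nu>\<Omega> W u d \<Gamma>
    by (intro covariant_instrument.intro compact_homogeneous_space.intro covariant_instrument_axioms.intro assms)
  have d0: "0 \<le> 1 / d" using \<open>d > 0\<close> by simp
  obtain q where q: "cp_kernel (1 / d) q" "\<And>h s t. h \<in> H \<Longrightarrow> q (act h s) (act h t) = q s t"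
    "\<And>\<eta> \<phi> X. X \<in> sets (coset_borel H) \<Longrightarrow> emeasure (instr_measure (rank1 \<eta> \<eta>) \<phi>) X
        = (\<integral>\<^sup>+g. ennreal (Re (q (act g (\<eta>, \<phi>)) (act g (\<eta>, \<phi>)))) * indicator (lift X) g \<partial>\<nu>G)"
    using density_kernel by blast
  obtain A :: "nat \<Rightarrow> 'v \<Rightarrow> 'k" where A: "\<And>k. bounded_clinear (A k)"
    "\<And>\<eta> \<phi> \<xi> \<psi>. (\<lambda>k. cnj (cinner \<eta> (A k \<phi>)) * cinner \<xi> (A k \<psi>)) sums q (\<eta>, \<phi>) (\<xi>, \<psi>)"
    "\<And>\<phi>. summable (\<lambda>k. (norm (A k \<phi>))\<^sup>2)"
    using cpk_kraus[OF q(1) d0 sepK sepV] by blast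
  interpret kraus_decomposition H \<nu>G \<nu>H \<nu>\<Omega> W u d \<Gamma> q A
    by unfold_locales (fact q A)+
  define B where "B j = A (j - 1)" for j
  have J: "{j. 1 \<le> j \<and> enat j < \<infinity> + 1} = {j. 1 \<le> j}" by simp
  have hs: "hilbert_schmidt (B j)" for j
    unfolding B_def by (rule kraus_trace(1)[OF assms(3)])
  have cov: "(\<Sum>\<^sub>\<infinity>j\<in>{j. 1 \<le> j}. cinner (B j \<phi>) (cadjoint (u h) (b (u h (B j \<phi>)))))
      = (\<Sum>\<^sub>\<infinity>j\<in>{j. 1 \<le> j}. cinner (B j (W h \<phi>)) (b (B j (W h \<phi>))))"
    if "h \<in> H" "bounded_clinear b" for \<phi> b h
  proof -
    have "(\<Sum>\<^sub>\<infinity>j\<in>{j. 1 \<le> j}. cinner (B j \<phi>) (cadjoint (u h) (b (u h (B j \<phi>))))) = vsum (\<lambda>k. u h (A k \<phi>)) b"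
      using infsum_shift_vsum[OF u_B_summable[of h \<phi>] that(2)] by (simp add: B_def cadjoint_right)
    also have "\<dots> = vsum (\<lambda>k. A k (W h \<phi>)) b" by (rule B_covariant[OF that(2,1)])
    also have "\<dots> = (\<Sum>\<^sub>\<infinity>j\<in>{j. 1 \<le> j}. cinner (B j (W h \<phi>)) (b (B j (W h \<phi>))))"
      using infsum_shift_vsum[OF A(3)[of "W h \<phi>"] that(2)] by (simp add: B_def)
    finally show ?thesis .
  qed
  have bij: "bij_betw Suc UNIV {j. 1 \<le> j}"
    by (rule bij_betw_byWitness[where f' = "\<lambda>j. j - 1"]) auto
  have trace: "((\<lambda>j. tr (cadjoint (B j) \<circ> B j)) has_sum complex_of_real (1 / d)) {j. 1 \<le> j}"
    using kraus_trace(2)[OF assms(3)] has_sum_reindex_bij_betw[OF bij, of "\<lambda>j. tr (cadjoint (B j) \<circ> B j)"]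
    by (simp add: B_def)
  have dens: "set_integrable \<nu>\<Omega> X F \<and> cinner \<phi> (\<Gamma> b X \<phi>) = (LINT c:X|\<nu>\<Omega>. F c)"
    if X: "X \<in> sets (coset_borel H)" and b: "bounded_clinear b"
      and F: "F = on_coset (\<lambda>g. \<Sum>\<^sub>\<infinity>j\<in>{j. 1 \<le> j}.
        cinner (u g (B j (cadjoint (W g) \<phi>))) (b (u g (B j (cadjoint (W g) \<phi>)))))" for \<phi> b X F
  proof -
    have "F = on_coset (dens b \<phi>)"
      unfolding F B_def
      by (rule arg_cong[where f = on_coset], rule ext) (simp only: dens_def infsum_shift_vsum[OF u_B_summable b])
    moreover have "has_bochner_integral \<nu>G (\<lambda>g. indicator (lift X) g *\<^sub>R on_coset (dens b \<phi>) (coset g)) (cinner \<phi> (\<Gamma> b X \<phi>))"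
      using has_densityD[OF has_density_all[OF b] X, of \<phi>] by (simp only: on_coset_dens[OF b])
    moreover have "on_coset (dens b \<phi>) \<in> borel_measurable (coset_borel H)"
      using has_density_all[OF b, of \<phi>] by (simp add: has_density_def)
    ultimately show ?thesis using set_integral_lift[OF X] by simp
  qed
  show ?thesis
    \<comment> \<open>With \<open>r = \<infinity>\<close> a finite number of Kraus operators is continued by zero operators.\<close>
    by (rule exI[of _ \<infinity>], rule exI[of _ B]) (simp only: J Let_def, intro conjI ballI allI impI hs cov trace dens refl)
qed

end
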